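(* Let $n\ge3$ and let $K:\mathbb{R}^n\to[0,\infty)$ be smooth, not identically zero, with $\int_{\mathbb{R}^n}K\,dx<\infty$ and $K(x)=O(|x|^{-\ell})$ as $|x|\to\infty$ for some $\ell>2$. Then there exists a number $0<\beta_0<\infty$ such that the problem $$\Delta u+K(x)u^{\frac{n}{n-2}}=0,\ u\ge0\ \text{in }\mathbb{R}^n,\qquad \lim_{|x|\to\infty}u(x)=\beta,$$ has a (minimal) solution for every $0<\beta<\beta_0$ and has no solution for $\beta>\beta_0$. If moreover $K$ is radially symmetric about the origin with $K(0)>0$, the problem also has a solution for $\beta=\beta_0$. *)

theory Defs
  imports "HOL-Analysis.Analysis" "HOL-Library.Landau_Symbols"
begin

fun pd :: "('a::euclidean_space \<Rightarrow> real) \<Rightarrow> 'a list \<Rightarrow> 'a \<Rightarrow> real" where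
  "pd f [] = f"
| "pd f (v # vs) = (\<lambda>x. frechet_derivative (pd f vs) (at x) v)"

definition smooth_fun :: "('a::euclidean_space \<Rightarrow> real) \<Rightarrow> bool" where
  "smooth_fun f \<longleftrightarrow> (\<forall>vs. set vs \<subseteq> Basis \<longrightarrow> pd f vs differentiable_on UNIV)"

definition C2_fun :: "('a::euclidean_space \<Rightarrow> real) \<Rightarrow> bool" where
  "C2_fun u \<longleftrightarrow>
     (\<forall>vs. set vs \<subseteq> Basis \<longrightarrow> length vs \<le> 1 \<longrightarrow> pd u vs differentiable_on UNIV) \<and>
     (\<forall>vs. set vs \<subseteq> Basis \<longrightarrow> length vs = 2 \<longrightarrow> continuous_on UNIV (pd u vs))"

definition laplacian :: "('a::euclidean_space \<Rightarrow> real) \<Rightarrow> 'a \<Rightarrow> real" where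
  "laplacian u x = (\<Sum>i\<in>Basis. pd u [i, i] x)"

definition is_solution :: "('a::euclidean_space \<Rightarrow> real) \<Rightarrow> real \<Rightarrow> ('a \<Rightarrow> real) \<Rightarrow> bool" where
  "is_solution K \<beta> u \<longleftrightarrow>
     C2_fun u \<and> (\<forall>x. u x \<ge> 0) \<and>
     (\<forall>x. laplacian u x + K x * u x powr (real DIM('a) / (real DIM('a) - 2)) = 0) \<and>
     (u \<longlongrightarrow> \<beta>) at_infinity"

end

theory Submission
  imports Defs
begin

text \<open>A solution with limit \<open>\<beta>\<close> is a fixed point of \<open>u \<mapsto> \<beta> + N (K u\<^sup>p)\<close>, where \<open>N\<close> is the
  Newtonian potential and \<open>p = n/(n-2)\<close>. By the maximum principle every solution with limit at least
  \<open>\<beta>\<close> dominates the increasing iterates started at the constant \<open>\<beta>\<close>; conversely bounded iterates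
  converge to a solution, which is therefore minimal. So solvability is equivalent to boundedness of
  the iterates, and this defines \<open>\<beta>0\<close>. For small \<open>\<beta>\<close> the constant \<open>2\<beta>\<close> is a bound; for large
  \<open>\<beta>\<close> the infimum of the iterates over a ball where \<open>K\<close> is positive doubles at every step.
  For radial \<open>K\<close> the minimal solutions are radial, and since \<open>p\<close> is the borderline exponent of Serrin,
  a logarithmic estimate for the flux bounds them independently of \<open>\<beta>\<close>, which gives a solution
  at \<open>\<beta>0\<close>.

  The potential is the limit of convolutions with truncated kernels that differ from each other only
  near the origin. Because \<open>K\<close> is bounded and integrable, dominated convergence shows that the
  potential vanishes at infinity.\<close>

section \<open>Convolution and differentiation under the integral\<close>

text \<open>Working with the iterates keeps every comparison linear: each iterate solves a Poisson
  equation whose right-hand side is already known, so the maximum principle for the Laplacian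
  suffices and two solutions of the nonlinear equation are never compared directly. The positive
  limit \<open>\<beta>\<close> keeps the iterates away from 0, so that their real powers are as
  differentiable as they are.

  At \<open>\<beta>0\<close> the danger is that the bounds for smaller limits blow up. For radial
  \<open>K\<close> this is excluded by the identity \<open>(n - 2) * p = n\<close>: in the
  inequality for the flux all powers of the radius cancel except one factor \<open>1 / r\<close>.
  Its integral diverges at 0, so a solution concentrated at too small a scale would make a negative
  power of the flux negative.

  On the analytic side the obstacle is the Hessian of the Newtonian kernel, which has size
  \<open>norm y powr (- n)\<close> and is not integrable at the origin. With dyadic truncation radii
  the kernel and its gradient lead to geometric series, and the Hessian is reduced to the gradient
  by moving one derivative onto the density.\<close>

lemma has_derivative_integral_dominated:
  fixes \<Phi> :: "'a::euclidean_space \<Rightarrow> 'b::euclidean_space \<Rightarrow> real"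
  assumes r: "r > 0"
    and der: "\<And>x y. x \<in> ball x0 r \<Longrightarrow> ((\<lambda>x. \<Phi> x y) has_derivative \<Phi>' x y) (at x)"
    and int: "\<And>x. x \<in> ball x0 r \<Longrightarrow> integrable M (\<Phi> x)"
    and meas: "\<And>h. (\<lambda>y. \<Phi>' x0 y h) \<in> borel_measurable M"
    and bnd: "\<And>x y h. x \<in> ball x0 r \<Longrightarrow> \<bar>\<Phi>' x y h\<bar> \<le> b y * norm h"
    and b: "integrable M b"
  shows "((\<lambda>x. \<integral>y. \<Phi> x y \<partial>M) has_derivative (\<lambda>h. \<integral>y. \<Phi>' x0 y h \<partial>M)) (at x0)"
proof -
  have x0: "x0 \<in> ball x0 r" using r by simp
  have lin: "linear (\<Phi>' x0 y)" for y
    using der[OF x0] has_derivative_linear by blast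
  have b0: "b y \<ge> 0" for y
  proof -
    obtain i :: 'a where "i \<in> Basis" using nonempty_Basis by blast
    then show ?thesis using bnd[OF x0, of y i] by (simp add: order_trans[OF abs_ge_zero])
  qed
  have int': "integrable M (\<lambda>y. \<Phi>' x0 y h)" for h
    by (rule Bochner_Integration.integrable_bound[OF integrable_mult_left[OF b, of "norm h"] meas])
       (use bnd[OF x0] b0 in auto)
  have bl: "bounded_linear (\<lambda>h. \<integral>y. \<Phi>' x0 y h \<partial>M)"
  proof (rule bounded_linear_intro[where K = "\<integral>y. b y \<partial>M"])
    fix h k show "(\<integral>y. \<Phi>' x0 y (h + k) \<partial>M) = (\<integral>y. \<Phi>' x0 y h \<partial>M) + (\<integral>y. \<Phi>' x0 y k \<partial>M)"
      by (simp add: linear_add[OF lin] int')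
  next
    fix c h show "(\<integral>y. \<Phi>' x0 y (c *\<^sub>R h) \<partial>M) = c *\<^sub>R (\<integral>y. \<Phi>' x0 y h \<partial>M)"
      by (simp add: linear_cmul[OF lin])
  next
    fix h :: 'a
    have "norm (\<integral>y. \<Phi>' x0 y h \<partial>M) \<le> (\<integral>y. b y * norm h \<partial>M)"
      by (rule Bochner_Integration.integral_norm_bound_integral)
         (use bnd[OF x0] int' b in auto)
    then show "norm (\<integral>y. \<Phi>' x0 y h \<partial>M) \<le> norm h * (\<integral>y. b y \<partial>M)"
      by (simp add: mult.commute)
  qed
  \<comment> \<open>The mean value inequality converts the bound on the derivative into a Lipschitz
    bound with the same integrable weight, so the remainder quotients below are dominated by
    \<open>2 * b\<close>.\<close>
  have lip: "\<bar>\<Phi> (x0 + h) y - \<Phi> x0 y\<bar> \<le> b y * norm h" if "norm h < r" for h y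
  proof -
    have "norm (\<Phi> (x0 + h) y - \<Phi> x0 y) \<le> b y * norm ((x0 + h) - x0)"
    proof (rule differentiable_bound[where S = "ball x0 r" and f' = "\<lambda>x. \<Phi>' x y"])
      fix x assume x: "x \<in> ball x0 r"
      show "((\<lambda>x. \<Phi> x y) has_derivative \<Phi>' x y) (at x within ball x0 r)"
        using der[OF x] has_derivative_at_withinI by blast
      show "onorm (\<Phi>' x y) \<le> b y"
        by (rule onorm_bound) (use b0 bnd[OF x] in auto)
    qed (use that r in \<open>auto simp: dist_norm\<close>)
    then show ?thesis by simp
  qed
  show ?thesis
    unfolding has_derivative_at
  proof (intro conjI bl)
    let ?q = "\<lambda>h. norm ((\<integral>y. \<Phi> (x0 + h) y \<partial>M) - (\<integral>y. \<Phi> x0 y \<partial>M) - (\<integral>y. \<Phi>' x0 y h \<partial>M)) / norm h"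
    show "?q \<midarrow>0\<rightarrow> 0"
      unfolding tendsto_at_iff_sequentially
    proof (intro allI impI)
      fix X :: "nat \<Rightarrow> 'a"
      assume X: "\<forall>i. X i \<in> UNIV - {0}" "X \<longlonglongrightarrow> 0"
      then obtain N where N: "\<And>i. i \<ge> N \<Longrightarrow> norm (X i) < r"
        using r LIMSEQ_D[OF X(2) r] by auto
      define Y where "Y i = X (i + N)" for i
      have Y: "Y \<longlonglongrightarrow> 0" "\<And>i. norm (Y i) < r" "\<And>i. Y i \<noteq> 0"
        using X N LIMSEQ_ignore_initial_segment[OF X(2), of N] by (auto simp: Y_def[abs_def])
      define s where "s i y = (\<Phi> (x0 + Y i) y - \<Phi> x0 y - \<Phi>' x0 y (Y i)) / norm (Y i)" for i y
      have inti: "integrable M (\<lambda>y. \<Phi> (x0 + Y i) y)" for i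
        using Y(2) by (intro int) (simp add: dist_norm)
      have "(\<lambda>i. \<integral>y. s i y \<partial>M) \<longlonglongrightarrow> (\<integral>y. 0 \<partial>M)"
      proof (rule integral_dominated_convergence[where w = "\<lambda>y. 2 * b y"])
        show "s i \<in> borel_measurable M" for i
          unfolding s_def using inti[of i] int[OF x0] int'[of "Y i"] by auto
        show "integrable M (\<lambda>y. 2 * b y)" using b by simp
        show "AE y in M. (\<lambda>i. s i y) \<longlonglongrightarrow> 0"
        proof (rule AE_I2)
          fix y
          have "(\<lambda>h. norm (\<Phi> (x0 + h) y - \<Phi> x0 y - \<Phi>' x0 y h) / norm h) \<midarrow>0\<rightarrow> 0"
            using der[OF x0, of y] unfolding has_derivative_at by blast
          then have "((\<lambda>h. norm (\<Phi> (x0 + h) y - \<Phi> x0 y - \<Phi>' x0 y h) / norm h) \<circ> Y) \<longlonglongrightarrow> 0"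
            using Y unfolding tendsto_at_iff_sequentially by auto
          then have "(\<lambda>i. norm (s i y)) \<longlonglongrightarrow> 0"
            by (simp add: s_def o_def)
          then show "(\<lambda>i. s i y) \<longlonglongrightarrow> 0" by (rule tendsto_norm_zero_cancel)
        qed
        show "AE y in M. norm (s i y) \<le> 2 * b y" for i
        proof (rule AE_I2)
          fix y
          have "\<bar>\<Phi> (x0 + Y i) y - \<Phi> x0 y - \<Phi>' x0 y (Y i)\<bar> \<le> 2 * b y * norm (Y i)"
            using lip[OF Y(2)[of i], of y] bnd[OF x0, of y "Y i"] by linarith
          then show "norm (s i y) \<le> 2 * b y"
            using Y(3)[of i] by (simp add: s_def divide_le_eq)
        qed
      qed simp
      then have "(\<lambda>i. norm (\<integral>y. s i y \<partial>M)) \<longlonglongrightarrow> 0"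
        using tendsto_norm_zero by fastforce
      moreover have "norm (\<integral>y. s i y \<partial>M) = ?q (Y i)" for i
        unfolding s_def using inti[of i] int[OF x0] int'[of "Y i"] by simp
      ultimately have "(\<lambda>i. ?q (X (i + N))) \<longlonglongrightarrow> 0"
        by (simp add: Y_def)
      then have "(\<lambda>i. ?q (X i)) \<longlonglongrightarrow> 0" by (rule LIMSEQ_offset)
      then show "(?q \<circ> X) \<longlonglongrightarrow> 0" by (simp add: o_def)
    qed
  qed
qed

lemma integrable_indicator_cball:
  "integrable lborel (indicator (cball c r) :: 'a::euclidean_space \<Rightarrow> real)"
  using emeasure_lborel_cball_finite[of c r] by (intro integrable_real_indicator) auto

definition conv :: "('a::euclidean_space \<Rightarrow> real) \<Rightarrow> ('a \<Rightarrow> real) \<Rightarrow> 'a \<Rightarrow> real" where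
  "conv G f x = (\<integral>y. G (x - y) * f y \<partial>lborel)"

text \<open>The map \<open>z \<mapsto> x - z\<close> preserves Lebesgue measure. Moving
  \<open>x\<close> into the second factor is what allows a derivative to fall on \<open>f\<close>
  instead of on \<open>G\<close>.\<close>

lemma conv_commute:
  fixes f :: "'a::euclidean_space \<Rightarrow> real"
  assumes [measurable]: "G \<in> borel_measurable borel" "f \<in> borel_measurable borel"
  shows "conv G f x = (\<integral>z. G z * f (x - z) \<partial>lborel)"
proof -
  have "lborel = density (distr lborel borel (\<lambda>z::'a. x + (-1) *\<^sub>R z)) (\<lambda>_. 1)"
    using lborel_affine[of "-1" x] by simp
  then have eq: "lborel = distr lborel borel (\<lambda>z::'a. x - z)" by (simp add: density_1)
  have "conv G f x = (\<integral>y. G (x - y) * f y \<partial>distr lborel borel (\<lambda>z::'a. x - z))"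
    unfolding conv_def using eq by simp
  also have "\<dots> = (\<integral>z. G z * f (x - z) \<partial>lborel)"
    by (subst integral_distr) auto
  finally show ?thesis .
qed

lemma integrable_conv_kernel:
  fixes f :: "'a::euclidean_space \<Rightarrow> real"
  assumes f: "integrable lborel f" and [measurable]: "G \<in> borel_measurable borel"
    and G: "\<And>y. \<bar>G y\<bar> \<le> M"
  shows "integrable lborel (\<lambda>y. G (x - y) * f y)"
proof (rule Bochner_Integration.integrable_bound[OF integrable_mult_right[of M, OF f]])
  have [measurable]: "f \<in> borel_measurable borel" using f by auto
  show "(\<lambda>y. G (x - y) * f y) \<in> borel_measurable lborel" by measurable
  show "AE y in lborel. norm (G (x - y) * f y) \<le> norm (M * f y)"
    using G by (auto simp: abs_mult intro!: mult_right_mono order_trans[OF G])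
qed

lemma conv_diff_kernel:
  assumes "integrable lborel f" "G \<in> borel_measurable borel" "\<And>y. \<bar>G y\<bar> \<le> M"
    "H \<in> borel_measurable borel" "\<And>y. \<bar>H y\<bar> \<le> N"
  shows "conv (\<lambda>y. G y - H y) f x = conv G f x - conv H f x"
  unfolding conv_def
  by (subst Bochner_Integration.integral_diff[symmetric])
     (use integrable_conv_kernel[of f G M] integrable_conv_kernel[of f H N] assms in
      \<open>auto simp: algebra_simps\<close>)

text \<open>The derivative falls on the kernel. Since \<open>G\<close> and \<open>G'\<close> are
  globally bounded, \<open>M * \<bar>f y\<bar>\<close> dominates, and \<open>f\<close> enters
  through its integrability alone.\<close>

lemma conv_has_derivative_kernel:
  fixes f :: "'a::euclidean_space \<Rightarrow> real"
  assumes G: "\<And>y. (G has_derivative G' y) (at y)" "\<And>y. \<bar>G y\<bar> \<le> M"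
    and G': "\<And>y h. \<bar>G' y h\<bar> \<le> M * norm h" "\<And>h. continuous_on UNIV (\<lambda>y. G' y h)"
    and f: "integrable lborel f"
  shows "(conv G f has_derivative (\<lambda>h. conv (\<lambda>y. G' y h) f x)) (at x)"
  unfolding conv_def
proof (rule has_derivative_integral_dominated[where r = 1 and b = "\<lambda>y. M * \<bar>f y\<bar>"
      and \<Phi>' = "\<lambda>x y h. G' (x - y) h * f y"])
  have [measurable]: "f \<in> borel_measurable borel" using f by auto
  have "continuous_on UNIV G"
    using G(1) by (meson differentiableI differentiable_imp_continuous_within continuous_at_imp_continuous_on)
  then have Gm: "G \<in> borel_measurable borel" by (rule borel_measurable_continuous_onI)
  have [measurable]: "(\<lambda>y. G' y h) \<in> borel_measurable borel" for h
    by (rule borel_measurable_continuous_onI[OF G'(2)])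
  show "(\<lambda>y. G' (x - y) h * f y) \<in> borel_measurable lborel" for h
    by measurable
  show "integrable lborel (\<lambda>y. G (z - y) * f y)" for z
    by (rule integrable_conv_kernel[OF f Gm G(2)])
  show "integrable lborel (\<lambda>y. M * \<bar>f y\<bar>)" using f by simp
  show "((\<lambda>x. G (x - y) * f y) has_derivative (\<lambda>h. G' (z - y) h * f y)) (at z)" for z y
  proof -
    have "((\<lambda>x. x - y) has_derivative (\<lambda>h. h)) (at z)" by (auto intro!: derivative_eq_intros)
    from has_derivative_compose[OF this, of G "G' (z - y)"] G(1)
    show ?thesis by (intro has_derivative_mult_left) auto
  qed
  show "\<bar>G' (z - y) h * f y\<bar> \<le> M * \<bar>f y\<bar> * norm h" for z y h
    using mult_right_mono[OF G'(1)[of "z - y" h], of "\<bar>f y\<bar>"] by (simp add: abs_mult ac_simps)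
qed auto

text \<open>Continuity is given for each direction separately. Expanding \<open>h\<close> in the
  basis bounds the operator norm by \<open>\<Sum>i\<in>Basis. \<bar>f' y i\<bar>\<close>, which is
  continuous in \<open>y\<close>.\<close>

lemma continuous_derivative_bounded:
  fixes f :: "'a::euclidean_space \<Rightarrow> real"
  assumes f: "\<And>y. (f has_derivative f' y) (at y)" "\<And>h. continuous_on UNIV (\<lambda>y. f' y h)"
  shows "\<exists>C. \<forall>y\<in>cball a R. \<forall>h. \<bar>f' y h\<bar> \<le> C * norm h"
proof -
  have fb: "\<bar>f' y h\<bar> \<le> (\<Sum>i\<in>Basis. \<bar>f' y i\<bar>) * norm h" for y h
  proof -
    have lin: "linear (f' y)" using f(1) has_derivative_linear by blast
    have "f' y h = f' y (\<Sum>i\<in>Basis. (h \<bullet> i) *\<^sub>R i)" by (simp add: euclidean_representation)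
    also have "\<dots> = (\<Sum>i\<in>Basis. (h \<bullet> i) * f' y i)"
      by (simp add: linear_sum[OF lin] linear_cmul[OF lin])
    finally have "\<bar>f' y h\<bar> \<le> (\<Sum>i\<in>Basis. \<bar>(h \<bullet> i) * f' y i\<bar>)" by simp
    also have "\<dots> \<le> (\<Sum>i\<in>Basis. \<bar>f' y i\<bar> * norm h)"
    proof (rule sum_mono)
      fix i :: 'a assume "i \<in> Basis"
      from mult_right_mono[OF Basis_le_norm[OF this, of h], of "\<bar>f' y i\<bar>"]
      show "\<bar>(h \<bullet> i) * f' y i\<bar> \<le> \<bar>f' y i\<bar> * norm h" by (simp add: abs_mult mult.commute)
    qed
    finally show ?thesis by (simp add: sum_distrib_right)
  qed
  have "compact ((\<lambda>y. \<Sum>i\<in>Basis. \<bar>f' y i\<bar>) ` cball a R)"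
    by (intro compact_continuous_image continuous_intros continuous_on_subset[OF f(2)]) auto
  then obtain C where C: "\<And>y. y \<in> cball a R \<Longrightarrow> (\<Sum>i\<in>Basis. \<bar>f' y i\<bar>) \<le> C"
    by (fastforce dest!: compact_imp_bounded simp: bounded_real)
  have "\<bar>f' y h\<bar> \<le> C * norm h" if "y \<in> cball a R" for y h
    using fb[of y h] mult_right_mono[OF C[OF that], of "norm h"] by (rule order_trans) simp
  then show ?thesis by blast
qed

text \<open>The counterpart of \<open>conv_has_derivative_kernel\<close> with the derivative on
  \<open>f\<close>. As \<open>H\<close> vanishes outside the unit ball, bounds for \<open>f'\<close>
  near \<open>x\<close> are enough.\<close>

lemma conv_has_derivative_fun:
  fixes f :: "'a::euclidean_space \<Rightarrow> real"
  assumes H: "H \<in> borel_measurable borel" "\<And>z. \<bar>H z\<bar> \<le> B" "\<And>z. norm z > 1 \<Longrightarrow> H z = 0"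
    and f: "\<And>y. (f has_derivative f' y) (at y)" "\<And>h. continuous_on UNIV (\<lambda>y. f' y h)"
  shows "(conv H f has_derivative (\<lambda>h. conv H (\<lambda>y. f' y h) x)) (at x)"
proof -
  have contf: "continuous_on UNIV f"
    using f(1) by (meson differentiableI differentiable_imp_continuous_within continuous_at_imp_continuous_on)
  note [measurable] = H(1) borel_measurable_continuous_onI[OF contf]
    borel_measurable_continuous_onI[OF f(2)]
  have B0: "B \<ge> 0" using H(2)[of 0] by linarith
  \<comment> \<open>Radius 2 is the radius 1 of the ball in which the point moves plus the radius 1
    of the support of \<open>H\<close>.\<close>
  obtain C where C: "\<And>y h. y \<in> cball x 2 \<Longrightarrow> \<bar>f' y h\<bar> \<le> C * norm h"
    using continuous_derivative_bounded[OF f] by blast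
  have *: "\<bar>f' (y - z) h\<bar> \<le> C * norm h" if "y \<in> ball x 1" "norm z \<le> 1" for y z h
  proof -
    have "dist x (y - z) \<le> dist x y + norm z"
      using norm_triangle_ineq[of "x - y" z] by (simp add: dist_norm algebra_simps)
    then have "y - z \<in> cball x 2" using that by auto
    then show ?thesis by (rule C)
  qed
  have "((\<lambda>x. \<integral>z. H z * f (x - z) \<partial>lborel) has_derivative (\<lambda>h. \<integral>z. H z * f' (x - z) h \<partial>lborel)) (at x)"
  proof (rule has_derivative_integral_dominated[where r = 1
        and b = "\<lambda>z. B * C * indicator (cball 0 1) z"
        and \<Phi>' = "\<lambda>x z h. H z * f' (x - z) h"])
    show "(\<lambda>z. H z * f' (x - z) h) \<in> borel_measurable lborel" for h by measurable
    show "integrable lborel (\<lambda>z::'a. B * C * indicator (cball 0 1) z)"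
      by (intro integrable_mult_right integrable_indicator_cball)
    show "((\<lambda>x. H z * f (x - z)) has_derivative (\<lambda>h. H z * f' (y - z) h)) (at y)" for y z
    proof -
      have "((\<lambda>x. x - z) has_derivative (\<lambda>h. h)) (at y)" by (auto intro!: derivative_eq_intros)
      from has_derivative_compose[OF this, of f "f' (y - z)"] f(1)
      show ?thesis by (intro has_derivative_mult_right) auto
    qed
    show "\<bar>H z * f' (y - z) h\<bar> \<le> B * C * indicator (cball 0 1) z * norm h" if y: "y \<in> ball x 1" for y z h
    proof (cases "norm z \<le> 1")
      case True
      have "\<bar>H z * f' (y - z) h\<bar> \<le> B * (C * norm h)"
        unfolding abs_mult by (intro mult_mono H(2) *[OF y True]) (use B0 in auto)
      with True show ?thesis by simp
    qed (use H(3) in auto)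
    show "integrable lborel (\<lambda>z. H z * f (y - z))" for y
    proof -
      have "compact (f ` cball y 1)"
        by (intro compact_continuous_image continuous_on_subset[OF contf]) auto
      then obtain D where D: "\<And>z. z \<in> cball y 1 \<Longrightarrow> \<bar>f z\<bar> \<le> D"
        by (fastforce dest!: compact_imp_bounded simp: bounded_real)
      show ?thesis
      proof (rule Bochner_Integration.integrable_bound[where f = "\<lambda>z. B * D * indicator (cball 0 1) z"])
        show "integrable lborel (\<lambda>z::'a. B * D * indicator (cball 0 1) z)"
          by (intro integrable_mult_right integrable_indicator_cball)
        show "AE z in lborel. norm (H z * f (y - z)) \<le> norm (B * D * indicator (cball 0 1) z)"
        proof (rule AE_I2)
          fix z :: 'a
          show "norm (H z * f (y - z)) \<le> norm (B * D * indicator (cball 0 1) z)"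
          proof (cases "norm z \<le> 1")
            case True
            have "\<bar>f (y - z)\<bar> \<le> D" using True by (intro D) (simp add: dist_norm)
            then have "\<bar>H z\<bar> * \<bar>f (y - z)\<bar> \<le> B * D" by (intro mult_mono H(2)) (use B0 in auto)
            also have "\<dots> \<le> \<bar>B\<bar> * \<bar>D\<bar>" by (metis abs_ge_self abs_mult)
            finally show ?thesis using True by (simp add: abs_mult)
          qed (use H(3) in auto)
        qed
      qed measurable
    qed
  qed auto
  moreover have "conv H f = (\<lambda>x. \<integral>z. H z * f (x - z) \<partial>lborel)"
    by (intro ext conv_commute) measurable
  moreover have "conv H (\<lambda>y. f' y h) x = (\<integral>z. H z * f' (x - z) h \<partial>lborel)" for h
    by (intro conv_commute) measurable
  ultimately show ?thesis by simp
qed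

text \<open>Height times volume of the support. The factor \<open>r ^ DIM('a)\<close> is what beats
  the growth of the truncated kernels near the origin.\<close>

lemma conv_compact_bound:
  fixes f :: "'a::euclidean_space \<Rightarrow> real"
  assumes [measurable]: "H \<in> borel_measurable borel" "f \<in> borel_measurable borel"
    and r: "r \<ge> 0"
    and H: "\<And>z. \<bar>H z\<bar> \<le> B" "\<And>z. norm z > r \<Longrightarrow> H z = 0"
    and f: "\<And>y. y \<in> cball x r \<Longrightarrow> \<bar>f y\<bar> \<le> C"
  shows "\<bar>conv H f x\<bar> \<le> B * C * (unit_ball_vol (DIM('a)) * r ^ DIM('a))"
proof -
  have B0: "B \<ge> 0" using H(1)[of 0] by linarith
  have C0: "C \<ge> 0" using f[of x] r by (auto intro: order_trans[OF abs_ge_zero])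
  have int: "integrable lborel (\<lambda>z::'a. B * C * indicator (cball 0 r) z)"
    by (intro integrable_mult_right integrable_indicator_cball)
  have le: "norm (H z * f (x - z)) \<le> B * C * indicator (cball 0 r) z" for z
  proof (cases "norm z \<le> r")
    case True
    have "\<bar>f (x - z)\<bar> \<le> C" using True by (intro f) (simp add: dist_norm)
    then have "\<bar>H z\<bar> * \<bar>f (x - z)\<bar> \<le> B * C" by (intro mult_mono H(1)) (use B0 in auto)
    with True show ?thesis by (simp add: abs_mult)
  qed (use H(2) in auto)
  have "norm (\<integral>z. H z * f (x - z) \<partial>lborel) \<le> (\<integral>z. B * C * indicator (cball (0::'a) r) z \<partial>lborel)"
  proof (rule Bochner_Integration.integral_norm_bound_integral[OF Bochner_Integration.integrable_bound[OF int] int])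
    show "AE z in lborel. norm (H z * f (x - z)) \<le> norm (B * C * indicator (cball 0 r) z)"
      using le B0 C0 by (intro AE_I2) (simp add: order_trans[OF le abs_ge_self])
  qed (use le in measurable)
  also have "\<dots> = B * C * (unit_ball_vol (DIM('a)) * r ^ DIM('a))"
    using r by (simp add: content_cball)
  finally show ?thesis by (simp add: conv_commute)
qed

text \<open>The evaluation point moves with the index, so that one statement covers continuity,
  where \<open>X i\<close> converges, and decay, where it escapes to infinity.\<close>

lemma conv_LIMSEQ_kernel:
  fixes f :: "'a::euclidean_space \<Rightarrow> real"
  assumes f: "integrable lborel f" and H: "\<And>i. H i \<in> borel_measurable borel" "\<And>i y. \<bar>H i y\<bar> \<le> M"
    and l: "\<And>y. (\<lambda>i. H i (X i - y)) \<longlonglongrightarrow> L y"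
  shows "(\<lambda>i. conv (H i) f (X i)) \<longlonglongrightarrow> (\<integral>y. L y * f y \<partial>lborel)"
  unfolding conv_def
proof (rule integral_dominated_convergence[where w = "\<lambda>y. M * \<bar>f y\<bar>"])
  have [measurable]: "f \<in> borel_measurable borel" using f by auto
  note [measurable] = H(1)
  show "(\<lambda>y. H i (X i - y) * f y) \<in> borel_measurable lborel" for i by measurable
  have "L \<in> borel_measurable lborel"
    by (rule borel_measurable_LIMSEQ_real[OF l]) measurable
  then show "(\<lambda>y. L y * f y) \<in> borel_measurable lborel" by measurable
  show "integrable lborel (\<lambda>y. M * \<bar>f y\<bar>)" using f by simp
  show "AE y in lborel. (\<lambda>i. H i (X i - y) * f y) \<longlonglongrightarrow> L y * f y"
    by (intro AE_I2 tendsto_mult l tendsto_const)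
  show "AE y in lborel. norm (H i (X i - y) * f y) \<le> M * \<bar>f y\<bar>" for i
    by (auto simp: abs_mult intro!: mult_right_mono H)
qed

lemma continuous_on_conv:
  fixes f :: "'a::euclidean_space \<Rightarrow> real"
  assumes f: "integrable lborel f" and H: "continuous_on UNIV H" "\<And>y. \<bar>H y\<bar> \<le> M"
  shows "continuous_on UNIV (conv H f)"
  unfolding continuous_on_sequentially
proof (intro allI ballI impI, elim conjE)
  fix X :: "nat \<Rightarrow> 'a" and a assume X: "X \<longlonglongrightarrow> a"
  have "(\<lambda>i. conv H f (X i)) \<longlonglongrightarrow> (\<integral>y. H (a - y) * f y \<partial>lborel)"
  proof (rule conv_LIMSEQ_kernel[OF f])
    fix y
    show "(\<lambda>i. H (X i - y)) \<longlonglongrightarrow> H (a - y)"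
      by (rule isCont_tendsto_compose[where g=H]) 
         (use H(1) X in \<open>auto simp: continuous_on_eq_continuous_at intro!: tendsto_intros\<close>)
  qed (use H in \<open>auto intro: borel_measurable_continuous_onI\<close>)
  then show "(conv H f \<circ> X) \<longlonglongrightarrow> conv H f a" by (simp add: conv_def o_def)
qed

text \<open>For fixed \<open>y\<close> the points \<open>X i - y\<close> escape to infinity, so the
  integrand tends to 0 pointwise while \<open>M * \<bar>f y\<bar>\<close> dominates it.\<close>

lemma conv_tendsto_0_at_infinity:
  fixes f :: "'a::euclidean_space \<Rightarrow> real"
  assumes f: "integrable lborel f" and H: "H \<in> borel_measurable borel" "\<And>y. \<bar>H y\<bar> \<le> M"
    and lim: "(H \<longlongrightarrow> 0) at_infinity"
  shows "(conv H f \<longlongrightarrow> 0) at_infinity"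
proof (rule ccontr)
  assume "\<not> ?thesis"
  then obtain e where e: "e > 0" "\<forall>b. \<exists>x. norm x \<ge> b \<and> \<not> dist (conv H f x) 0 < e"
    unfolding Lim_at_infinity by blast
  then have "\<forall>n::nat. \<exists>x. norm x \<ge> real n \<and> \<bar>conv H f x\<bar> \<ge> e" by (auto simp: not_less)
  then obtain X where X: "\<And>n. norm (X n) \<ge> real n" "\<And>n. \<bar>conv H f (X n)\<bar> \<ge> e" by metis
  have "(\<lambda>i. conv H f (X i)) \<longlonglongrightarrow> (\<integral>y. 0 * f y \<partial>lborel)"
  proof (rule conv_LIMSEQ_kernel[OF f H])
    fix y
    have "filterlim (\<lambda>i. norm (X i - y)) at_top sequentially"
    proof (rule filterlim_at_top_mono[where f="\<lambda>i. real i - norm y"])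
      show "filterlim (\<lambda>i. real i - norm y) at_top sequentially"
        using filterlim_tendsto_add_at_top[OF tendsto_const[of "- norm y"] filterlim_real_sequentially]
        by (simp add: add.commute[of "- norm y"])
      show "\<forall>\<^sub>F i in sequentially. real i - norm y \<le> norm (X i - y)"
        using X(1) norm_triangle_ineq2[of _ y] by (intro always_eventually) (smt (verit))
    qed
    then have "filterlim (\<lambda>i. X i - y) at_infinity sequentially"
      by (rule filterlim_norm_at_top_imp_at_infinity)
    then show "(\<lambda>i. H (X i - y)) \<longlonglongrightarrow> 0"
      by (rule filterlim_compose[OF lim])
  qed
  then have "(\<lambda>i. \<bar>conv H f (X i)\<bar>) \<longlonglongrightarrow> 0" using tendsto_rabs_zero by simp
  then show False using X(2) e(1) LIMSEQ_le_const[of "\<lambda>i. \<bar>conv H f (X i)\<bar>" 0 e] by force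
qed

section \<open>Truncated Newtonian kernels\<close>

lemma has_real_derivative_glue:
  fixes p q :: "real \<Rightarrow> real"
  assumes p: "\<And>s. s \<le> c \<Longrightarrow> (p has_real_derivative p' s) (at s)"
    and q: "\<And>s. s \<ge> c \<Longrightarrow> (q has_real_derivative q' s) (at s)"
    and c: "p c = q c" "p' c = q' c"
  shows "((\<lambda>s. if s \<le> c then p s else q s) has_real_derivative (if s \<le> c then p' s else q' s)) (at s)"
    (is "(?f has_real_derivative _) _")
proof -
  consider "s < c" | "s = c" | "s > c" by linarith
  then show ?thesis
  proof cases
    case 1
    have "\<forall>\<^sub>F x in nhds s. x < c" using 1 by (intro order_tendstoD(2)[of id _ _ c, unfolded id_def]) (auto intro: tendsto_ident_at filterlim_ident)
    then have "\<forall>\<^sub>F x in nhds s. ?f x = p x" by eventually_elim auto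
    with p[of s] 1 show ?thesis by (subst DERIV_cong_ev[where g = p]) auto
  next
    case 3
    have "\<forall>\<^sub>F x in nhds s. x > c" using 3 by (intro order_tendstoD(1)[of id _ _ c, unfolded id_def]) (auto intro: tendsto_ident_at filterlim_ident)
    then have "\<forall>\<^sub>F x in nhds s. ?f x = q x" by eventually_elim auto
    with q[of s] 3 show ?thesis by (subst DERIV_cong_ev[where g = q]) auto
  next
    case 2
    \<comment> \<open>At the seam each branch supplies a derivative within its closed half-line, and
      the two half-lines cover the whole line.\<close>
    have "(?f has_real_derivative p' c) (at c within {..c})"
      by (rule has_field_derivative_transform_within[OF has_field_derivative_at_within[OF p[of c]], of 1])
         auto
    moreover have "(?f has_real_derivative p' c) (at c within {c..})"
      unfolding c(2)
      by (rule has_field_derivative_transform_within[OF has_field_derivative_at_within[OF q[of c]], of 1])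
         (use c in auto)
    ultimately have "(?f has_real_derivative p' c) (at c within ({..c} \<union> {c..}))"
      unfolding has_field_derivative_iff by (rule Lim_Un)
    moreover have "{..c} \<union> {c..} = UNIV" by auto
    ultimately show ?thesis using 2 by simp
  qed
qed

text \<open>Replacing \<open>s powr (- m)\<close> on \<open>s \<le> 1\<close> by its second Taylor polynomial at \<open>1\<close> keeps the
  profile twice differentiable, and leaves a Laplacian of one sign that is supported in the unit ball
  (\<open>prof_laplace\<close>).\<close>

definition prof0 :: "real \<Rightarrow> real \<Rightarrow> real" where
  "prof0 m s = (if s \<le> 1 then 1 - m * (s - 1) + m * (m + 1) / 2 * (s - 1)\<^sup>2 else s powr (- m))"

definition prof1 :: "real \<Rightarrow> real \<Rightarrow> real" where
  "prof1 m s = (if s \<le> 1 then - m + m * (m + 1) * (s - 1) else - m * s powr (- m - 1))"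

definition prof2 :: "real \<Rightarrow> real \<Rightarrow> real" where
  "prof2 m s = (if s \<le> 1 then m * (m + 1) else m * (m + 1) * s powr (- m - 2))"

lemma prof0_deriv: "(prof0 m has_real_derivative prof1 m s) (at s)"
  unfolding prof0_def[abs_def] prof1_def
  by (rule has_real_derivative_glue) (auto intro!: derivative_eq_intros simp: field_simps)

lemma prof1_deriv: "(prof1 m has_real_derivative prof2 m s) (at s)"
  unfolding prof1_def[abs_def] prof2_def
  by (rule has_real_derivative_glue) (auto intro!: derivative_eq_intros simp: field_simps)

lemma continuous_on_prof:
  "continuous_on UNIV (prof0 m)" "continuous_on UNIV (prof1 m)" "continuous_on UNIV (prof2 m)"
proof -
  show "continuous_on UNIV (prof0 m)" "continuous_on UNIV (prof1 m)"
    using DERIV_continuous_on[of UNIV "prof0 m"] DERIV_continuous_on[of UNIV "prof1 m"]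
      prof0_deriv prof1_deriv by blast+
  have "continuous_on ({..1} \<union> {1..}) (\<lambda>s. if s \<le> 1 then m * (m + 1) else m * (m + 1) * s powr (- m - 2))"
    by (rule continuous_on_cases) (auto intro!: continuous_intros)
  moreover have "{..1} \<union> {1..} = (UNIV :: real set)" by auto
  ultimately show "continuous_on UNIV (prof2 m)" by (simp add: prof2_def[abs_def])
qed

text \<open>On \<open>s \<le> 1\<close> the terms of degree one and two are nonnegative, so the
  polynomial is at least 1. This becomes a lower bound for the kernels that is uniform in the
  truncation radius.\<close>

lemma prof0_ge:
  assumes m: "m > 0" shows "prof0 m s \<ge> (max 1 s) powr (- m)"
proof (cases "s \<le> 1")
  case True
  then have "m * (s - 1) \<le> 0" using m by (intro mult_nonneg_nonpos) auto
  moreover have "0 \<le> m * (m + 1) / 2 * (s - 1)\<^sup>2" using m by simp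
  ultimately show ?thesis using True by (simp add: prof0_def)
qed (simp add: prof0_def)

lemma prof0_bound:
  assumes m: "m > 0" and s: "s \<ge> 0" shows "\<bar>prof0 m s\<bar> \<le> (1 + m)\<^sup>2"
proof -
  have "prof0 m s \<ge> 0" using prof0_ge[OF m, of s] powr_ge_zero order_trans by blast
  moreover have "prof0 m s \<le> (1 + m)\<^sup>2"
  proof (cases "s \<le> 1")
    case True
    have "m * (1 - s) \<le> m * 1" using m s by (intro mult_left_mono) auto
    moreover have "(s - 1)\<^sup>2 \<le> 1" using s True by (simp add: abs_square_le_1)
    then have "m * (m + 1) / 2 * (s - 1)\<^sup>2 \<le> m * (m + 1) / 2 * 1" using m by (intro mult_left_mono) auto
    moreover have "m * m > 0" using m by simp
    ultimately have "1 - m * (s - 1) + m * (m + 1) / 2 * (s - 1)\<^sup>2 \<le> 1 + m + m * (m + 1) / 2"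
      by (simp add: right_diff_distrib)
    also have "\<dots> \<le> (1 + m)\<^sup>2" using m by (simp add: power2_eq_square field_simps)
    finally show ?thesis using True by (simp add: prof0_def)
  next
    case False
    then have "s powr (- m) \<le> s powr 0" using m by (intro powr_mono) auto
    then have "s powr (- m) \<le> 1" using False by simp
    also have "1 \<le> (1 + m)\<^sup>2" using m by simp
    finally show ?thesis using False by (simp add: prof0_def)
  qed
  ultimately show ?thesis by simp
qed

text \<open>The weight \<open>sqrt s\<close> stands for the factor \<open>norm y\<close> that the
  chain rule produces in the gradient. The constant \<open>(1 + m)\<^sup>2\<close> is crude, chosen
  to serve for all three profiles.\<close>

lemma prof1_bound:
  assumes m: "m > 0" and s: "s \<ge> 0"
  shows "\<bar>prof1 m s\<bar> \<le> (1 + m)\<^sup>2" "sqrt s * \<bar>prof1 m s\<bar> \<le> (1 + m)\<^sup>2"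
proof -
  have mm: "m \<le> (1 + m)\<^sup>2" using m by (simp add: power2_eq_square algebra_simps)
  have small: "\<bar>prof1 m s\<bar> \<le> (1 + m)\<^sup>2" if "s \<le> 1"
  proof -
    have "m * (m + 1) * (1 - s) \<le> m * (m + 1) * 1" using m s by (intro mult_left_mono) auto
    moreover have "m * (m + 1) * (1 - s) \<ge> 0" using m that by simp
    ultimately show ?thesis using m that by (simp add: prof1_def power2_eq_square algebra_simps)
  qed
  have large: "\<bar>prof1 m s\<bar> \<le> m / s" if "s > 1"
  proof -
    have "s powr (- m - 1) \<le> s powr (-1)" using m that by (intro powr_mono) auto
    then have "m * s powr (- m - 1) \<le> m * s powr (-1)" using m by (intro mult_left_mono) auto
    then show ?thesis using that m by (simp add: prof1_def abs_mult powr_minus divide_inverse)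
  qed
  show "\<bar>prof1 m s\<bar> \<le> (1 + m)\<^sup>2"
  proof (cases "s \<le> 1")
    case False
    then have "m / s \<le> m" using m by (simp add: field_simps)
    with large False mm show ?thesis by linarith
  qed (rule small)
  show "sqrt s * \<bar>prof1 m s\<bar> \<le> (1 + m)\<^sup>2"
  proof (cases "s \<le> 1")
    case True
    then have "sqrt s * \<bar>prof1 m s\<bar> \<le> 1 * (1 + m)\<^sup>2" using small s by (intro mult_mono) auto
    then show ?thesis by simp
  next
    case False
    have "sqrt s \<le> s" using False by (intro real_le_lsqrt) (auto simp: power2_eq_square)
    then have "sqrt s * \<bar>prof1 m s\<bar> \<le> s * (m / s)" using large False by (intro mult_mono) auto
    with False mm show ?thesis by simp
  qed
qed

lemma prof2_bound:
  assumes m: "m > 0" and s: "s \<ge> 0"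
  shows "s * \<bar>prof2 m s\<bar> \<le> (1 + m)\<^sup>2"
proof -
  have mm: "m * (m + 1) \<le> (1 + m)\<^sup>2" using m by (simp add: power2_eq_square algebra_simps)
  show ?thesis
  proof (cases "s \<le> 1")
    case True
    then have "s * (m * (m + 1)) \<le> 1 * (m * (m + 1))" using m by (intro mult_right_mono) auto
    also have "\<dots> \<le> (1 + m)\<^sup>2" using mm by simp
    finally show ?thesis using True m by (simp add: prof2_def abs_mult)
  next
    case False
    have "s powr (- m - 2) \<le> s powr (-1)" using m False by (intro powr_mono) auto
    then have "s * s powr (- m - 2) \<le> 1" using False by (simp add: powr_minus field_simps)
    then have "m * (m + 1) * (s * s powr (- m - 2)) \<le> m * (m + 1) * 1" using m by (intro mult_left_mono) auto
    also have "\<dots> \<le> (1 + m)\<^sup>2" using mm by simp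
    finally show ?thesis using False m by (simp add: prof2_def abs_mult ac_simps)
  qed
qed

text \<open>In dimension \<open>2 * m + 2\<close> the left side is the Laplacian of
  \<open>prof0 m (y \<bullet> y)\<close> at \<open>s = y \<bullet> y\<close>. For
  \<open>s > 1\<close> it vanishes, the profile being then the harmonic function
  \<open>norm y powr (- 2 * m)\<close>.\<close>

lemma prof_laplace:
  "2 * (2 * m + 2) * prof1 m s + 4 * s * prof2 m s = - (4 * m * (m + 1) * (m + 2) * max 0 (1 - s))"
proof (cases "s \<le> 1")
  case False
  have e: "1 + (- m - 2) = - m - 1" by simp
  from False have "s * s powr (- m - 2) = s powr (- m - 1)"
    using powr_mult_base[of s "- m - 2"] unfolding e by simp
  moreover have "4 * s * prof2 m s = 4 * (m * (m + 1)) * (s * s powr (- m - 2))"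
    using False by (simp add: prof2_def)
  ultimately have "4 * s * prof2 m s = 4 * (m * (m + 1)) * s powr (- m - 1)" by simp
  with False show ?thesis by (simp add: prof1_def algebra_simps)
qed (simp add: prof1_def prof2_def max_def algebra_simps)

text \<open>For \<open>2 * m = DIM - 2\<close> these are the Newtonian kernel truncated at radius \<open>1 / sqrt A\<close>, its
  gradient and its Hessian.\<close>

definition ker0 :: "real \<Rightarrow> real \<Rightarrow> 'a::euclidean_space \<Rightarrow> real" where
  "ker0 m A y = A powr m * prof0 m (A * (y \<bullet> y))"

definition ker1 :: "real \<Rightarrow> real \<Rightarrow> 'a::euclidean_space \<Rightarrow> 'a \<Rightarrow> real" where
  "ker1 m A y h = A powr (m + 1) * (2 * (y \<bullet> h)) * prof1 m (A * (y \<bullet> y))"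

definition ker2 :: "real \<Rightarrow> real \<Rightarrow> 'a::euclidean_space \<Rightarrow> 'a \<Rightarrow> 'a \<Rightarrow> real" where
  "ker2 m A y h j = A powr (m + 1) * (2 * (j \<bullet> h)) * prof1 m (A * (y \<bullet> y)) +
     A powr (m + 2) * (4 * (y \<bullet> h) * (y \<bullet> j)) * prof2 m (A * (y \<bullet> y))"

context
  fixes m A :: real
  assumes m: "m > 0" and A: "A > 0"
begin

lemma powr_A_Suc: "A powr (m + 1) = A powr m * A" "A powr (m + 2) = A powr (m + 1) * A"
  using A powr_mult_base[of A m] powr_mult_base[of A "m + 1"] by (simp_all add: ac_simps)

lemma ker0_has_derivative: "(ker0 m A has_derivative ker1 m A y) (at y)"
proof -
  have "((\<lambda>y. A * (y \<bullet> y)) has_derivative (\<lambda>h. A * (2 * (y \<bullet> h)))) (at y)"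
    by (auto intro!: derivative_eq_intros simp: inner_commute)
  from DERIV_compose_FDERIV[OF prof0_deriv this]
  have "((\<lambda>y. A powr m * prof0 m (A * (y \<bullet> y))) has_derivative
      (\<lambda>h. A powr m * (A * (2 * (y \<bullet> h)) * prof1 m (A * (y \<bullet> y))))) (at y)"
    by (rule has_derivative_mult_right)
  then show ?thesis
    unfolding ker0_def[abs_def] ker1_def[abs_def] powr_A_Suc by (simp only: ac_simps)
qed

lemma ker1_has_derivative: "((\<lambda>y. ker1 m A y h) has_derivative ker2 m A y h) (at y)"
proof -
  have "((\<lambda>y. A * (y \<bullet> y)) has_derivative (\<lambda>h. A * (2 * (y \<bullet> h)))) (at y)"
    by (auto intro!: derivative_eq_intros simp: inner_commute)
  note * = DERIV_compose_FDERIV[OF prof1_deriv this]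
  have "((\<lambda>y. A powr (m + 1) * (2 * (y \<bullet> h))) has_derivative (\<lambda>j. A powr (m + 1) * (2 * (j \<bullet> h)))) (at y)"
    by (auto intro!: derivative_eq_intros)
  from has_derivative_mult[OF this *] show ?thesis
    unfolding ker1_def[abs_def] ker2_def[abs_def] powr_A_Suc
    by (rule has_derivative_eq_rhs) (auto simp: algebra_simps)
qed

lemma continuous_on_ker:
  "continuous_on UNIV (ker0 m A)" "continuous_on UNIV (\<lambda>y. ker1 m A y h)"
  "continuous_on UNIV (\<lambda>y. ker2 m A y h j)"
  unfolding ker0_def[abs_def] ker1_def[abs_def] ker2_def[abs_def]
  by (auto intro!: continuous_intros continuous_on_compose2[OF continuous_on_prof(1)]
      continuous_on_compose2[OF continuous_on_prof(2)] continuous_on_compose2[OF continuous_on_prof(3)])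

lemma ker_measurable [measurable]:
  "ker0 m A \<in> borel_measurable borel" "(\<lambda>y. ker1 m A y h) \<in> borel_measurable borel"
  "(\<lambda>y. ker2 m A y h j) \<in> borel_measurable borel"
  using continuous_on_ker by (auto intro: borel_measurable_continuous_onI)

lemma ker0_bound: "\<bar>ker0 m A y\<bar> \<le> A powr m * (1 + m)\<^sup>2"
  unfolding ker0_def abs_mult using prof0_bound[OF m, of "A * (y \<bullet> y)"] A
  by (auto intro!: mult_left_mono)

lemma ker1_bound: "\<bar>ker1 m A y h\<bar> \<le> 2 * A powr (m + 1/2) * (1 + m)\<^sup>2 * norm h"
proof -
  have s: "sqrt (A * (y \<bullet> y)) = sqrt A * norm y"
    by (simp add: real_sqrt_mult norm_eq_sqrt_inner)
  \<comment> \<open>Half a power of \<open>A\<close> is absorbed into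
    \<open>sqrt (A * (y \<bullet> y))\<close>, which the weighted bound for \<open>prof1\<close>
    controls; the exponent \<open>m + 1/2\<close> is what remains.\<close>
  have "A powr (m + 1) = A powr (m + 1/2) * sqrt A"
    using A powr_add[of A "m + 1/2" "1/2"] by (simp add: powr_half_sqrt add.commute)
  then have "\<bar>ker1 m A y h\<bar> = 2 * A powr (m + 1/2) * (sqrt A * (\<bar>y \<bullet> h\<bar> * \<bar>prof1 m (A * (y \<bullet> y))\<bar>))"
    using A by (simp add: ker1_def abs_mult)
  also have "\<dots> \<le> 2 * A powr (m + 1/2) * (sqrt A * (norm y * norm h * \<bar>prof1 m (A * (y \<bullet> y))\<bar>))"
    using A by (intro mult_left_mono mult_right_mono Cauchy_Schwarz_ineq2) auto
  also have "\<dots> = 2 * A powr (m + 1/2) * ((sqrt (A * (y \<bullet> y)) * \<bar>prof1 m (A * (y \<bullet> y))\<bar>) * norm h)"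
    unfolding s by (simp add: ac_simps)
  also have "\<dots> \<le> 2 * A powr (m + 1/2) * ((1 + m)\<^sup>2 * norm h)"
    using A by (intro mult_left_mono mult_right_mono prof1_bound m) auto
  finally show ?thesis by (simp add: ac_simps)
qed

lemma ker2_bound: "\<bar>ker2 m A y h j\<bar> \<le> 6 * A powr (m + 1) * (1 + m)\<^sup>2 * norm h * norm j"
proof -
  let ?s = "A * (y \<bullet> y)"
  have s: "?s = A * (norm y * norm y)" by (simp add: dot_square_norm power2_eq_square)
  have 1: "\<bar>j \<bullet> h\<bar> * \<bar>prof1 m ?s\<bar> \<le> norm j * norm h * (1 + m)\<^sup>2"
    using A by (intro mult_mono Cauchy_Schwarz_ineq2 prof1_bound m) auto
  have "A * (\<bar>y \<bullet> h\<bar> * \<bar>y \<bullet> j\<bar> * \<bar>prof2 m ?s\<bar>) \<le> A * ((norm y * norm h) * (norm y * norm j) * \<bar>prof2 m ?s\<bar>)"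
    using A by (intro mult_left_mono mult_right_mono mult_mono Cauchy_Schwarz_ineq2) auto
  also have "\<dots> = (?s * \<bar>prof2 m ?s\<bar>) * (norm j * norm h)" unfolding s by (simp add: ac_simps)
  also have "\<dots> \<le> (1 + m)\<^sup>2 * (norm j * norm h)"
    using A by (intro mult_right_mono prof2_bound m) auto
  finally have 2: "A * (\<bar>y \<bullet> h\<bar> * \<bar>y \<bullet> j\<bar> * \<bar>prof2 m ?s\<bar>) \<le> norm j * norm h * (1 + m)\<^sup>2" by (simp add: ac_simps)
  have "\<bar>ker2 m A y h j\<bar> \<le> \<bar>A powr (m + 1) * (2 * (j \<bullet> h)) * prof1 m ?s\<bar> + \<bar>A powr (m + 2) * (4 * (y \<bullet> h) * (y \<bullet> j)) * prof2 m ?s\<bar>"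
    unfolding ker2_def by (rule abs_triangle_ineq)
  also have "\<dots> = A powr (m + 1) * (2 * (\<bar>j \<bullet> h\<bar> * \<bar>prof1 m ?s\<bar>) + 4 * (A * (\<bar>y \<bullet> h\<bar> * \<bar>y \<bullet> j\<bar> * \<bar>prof2 m ?s\<bar>)))"
    unfolding powr_A_Suc(2) using A by (simp add: abs_mult algebra_simps)
  also have "\<dots> \<le> A powr (m + 1) * (2 * (norm j * norm h * (1 + m)\<^sup>2) + 4 * (norm j * norm h * (1 + m)\<^sup>2))"
    using 1 2 A by (intro mult_left_mono add_mono) auto
  finally show ?thesis by (simp add: algebra_simps)
qed

lemma ker0_ge:
  assumes A1: "A \<ge> 1" shows "ker0 m A y \<ge> (max 1 (y \<bullet> y)) powr (- m)"
proof -
  have "max 1 (A * (y \<bullet> y)) \<le> A * max 1 (y \<bullet> y)"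
    using A1 mult_mono[of 1 A 1 "max 1 (y \<bullet> y)"] mult_left_mono[of "y \<bullet> y" "max 1 (y \<bullet> y)" A] by simp
  then have "(A * max 1 (y \<bullet> y)) powr (- m) \<le> max 1 (A * (y \<bullet> y)) powr (- m)"
    using m by (intro powr_mono2') auto
  then have "A powr m * (A * max 1 (y \<bullet> y)) powr (- m) \<le> A powr m * prof0 m (A * (y \<bullet> y))"
    using prof0_ge[OF m, of "A * (y \<bullet> y)"] by (intro mult_left_mono) auto
  moreover have "A powr m * (A * max 1 (y \<bullet> y)) powr (- m) = max 1 (y \<bullet> y) powr (- m)"
    using A by (simp add: powr_mult powr_minus)
  ultimately show ?thesis by (simp add: ker0_def)
qed

text \<open>Neither right-hand side contains \<open>A\<close>: outside the larger truncation ball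
  two kernels coincide, so their difference has compact support.\<close>

lemma ker_outside:
  assumes "A * (y \<bullet> y) > 1"
  shows "ker0 m A y = (y \<bullet> y) powr (- m)" "ker1 m A y h = - 2 * m * (y \<bullet> h) * (y \<bullet> y) powr (- m - 1)"
proof -
  have *: "y \<bullet> y > 0" using assms A by (metis inner_gt_zero_iff inner_zero_left mult_zero_right not_one_less_zero)
  show "ker0 m A y = (y \<bullet> y) powr (- m)"
    using assms A * by (simp add: ker0_def prof0_def powr_mult powr_minus)
  have "A powr (m + 1) * A powr (- m - 1) = 1" using A by (simp add: powr_add[symmetric])
  then show "ker1 m A y h = - 2 * m * (y \<bullet> h) * (y \<bullet> y) powr (- m - 1)"
    using assms A * by (simp add: ker1_def prof1_def powr_mult)
qed

lemma ker0_tendsto: "(ker0 m A \<longlongrightarrow> 0) (at_infinity :: 'a::euclidean_space filter)"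
proof (rule Lim_transform_eventually)
  have "filterlim (\<lambda>y::'a. norm y) at_top at_infinity" by (rule filterlim_at_infinity_imp_norm_at_top[OF filterlim_ident])
  then have "filterlim (\<lambda>y::'a. norm y * norm y) at_top at_infinity"
    using filterlim_at_top_mult_at_top by blast
  then have sq: "filterlim (\<lambda>y::'a. y \<bullet> y) at_top at_infinity"
    by (simp add: dot_square_norm power2_eq_square)
  show "((\<lambda>y::'a. (y \<bullet> y) powr (- m)) \<longlongrightarrow> 0) at_infinity"
    using m by (intro tendsto_neg_powr sq) auto
  have "\<forall>\<^sub>F y::'a in at_infinity. y \<bullet> y > 1 / A" using sq by (simp add: filterlim_at_top_dense)
  then show "\<forall>\<^sub>F y::'a in at_infinity. (y \<bullet> y) powr (- m) = ker0 m A y"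
  proof eventually_elim
    case (elim y)
    then have "A * (y \<bullet> y) > 1" using A by (simp add: field_simps)
    then show ?case by (simp add: ker_outside)
  qed
qed

lemma ker2_trace:
  assumes "2 * m + 2 = real DIM('a)"
  shows "(\<Sum>i\<in>Basis. ker2 m A (y::'a::euclidean_space) i i) =
     - (A powr (m + 1) * (4 * m * (m + 1) * (m + 2) * max 0 (1 - A * (y \<bullet> y))))"
proof -
  have "(\<Sum>i\<in>Basis. ker2 m A y i i) = A powr (m + 1) * (2 * real DIM('a)) * prof1 m (A * (y \<bullet> y)) +
      A powr (m + 2) * (4 * (\<Sum>i\<in>Basis. (y \<bullet> i) * (y \<bullet> i))) * prof2 m (A * (y \<bullet> y))"
    unfolding ker2_def sum.distrib sum_distrib_right sum_distrib_left
    by (simp add: inner_Basis sum_distrib_left[symmetric] sum_distrib_right[symmetric] mult.assoc)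
  also have "(\<Sum>i\<in>Basis. (y \<bullet> i) * (y \<bullet> i)) = y \<bullet> y"
    by (rule euclidean_inner[symmetric])
  also have "A powr (m + 1) * (2 * real DIM('a)) * prof1 m (A * (y \<bullet> y)) + A powr (m + 2) * (4 * (y \<bullet> y)) * prof2 m (A * (y \<bullet> y))
    = A powr (m + 1) * (2 * (2 * m + 2) * prof1 m (A * (y \<bullet> y)) + 4 * (A * (y \<bullet> y)) * prof2 m (A * (y \<bullet> y)))"
    unfolding powr_A_Suc(2) assms by (simp add: algebra_simps)
  finally show ?thesis unfolding prof_laplace by simp
qed

end

section \<open>The Newtonian potential\<close>

text \<open>The explicit tail bound matters as much as the convergence: applied at every point it
  makes the convergence of the potentials and their derivatives uniform.\<close>

lemma geometric_increments_converge:
  fixes a :: "nat \<Rightarrow> real"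
  assumes a: "\<And>k. \<bar>a (Suc k) - a k\<bar> \<le> C * q ^ k" and q: "0 \<le> q" "q < 1"
  shows "a \<longlonglongrightarrow> lim a" "\<bar>lim a - a k\<bar> \<le> C * q ^ k / (1 - q)"
proof -
  have "summable (\<lambda>k. C * q ^ k)" using q by (intro summable_mult summable_geometric) auto
  then have sm: "summable (\<lambda>k. a (Suc k) - a k)"
    by (rule summable_comparison_test[rotated]) (use a in auto)
  then have "(\<lambda>n. \<Sum>i<n. a (Suc i) - a i) \<longlonglongrightarrow> (\<Sum>k. a (Suc k) - a k)" by (rule summable_LIMSEQ)
  then have "(\<lambda>n. a n - a 0) \<longlonglongrightarrow> (\<Sum>k. a (Suc k) - a k)" by (simp add: sum_lessThan_telescope)
  from tendsto_add[OF this tendsto_const[of "a 0"]] have "convergent a" by (auto simp: convergent_def)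
  then show lim: "a \<longlonglongrightarrow> lim a" by (simp add: convergent_LIMSEQ_iff)
  have C0: "C \<ge> 0" using a[of 0] by simp
  have *: "\<bar>a (k + j) - a k\<bar> \<le> C * q ^ k * (\<Sum>i<j. q ^ i)" for j
  proof (induction j)
    case (Suc j)
    have "\<bar>a (k + Suc j) - a k\<bar> \<le> \<bar>a (Suc (k + j)) - a (k + j)\<bar> + \<bar>a (k + j) - a k\<bar>" by simp
    also have "\<dots> \<le> C * q ^ (k + j) + C * q ^ k * (\<Sum>i<j. q ^ i)" using Suc a by (intro add_mono)
    finally show ?case by (simp add: power_add algebra_simps)
  qed simp
  have "(\<lambda>j. \<bar>a (j + k) - a k\<bar>) \<longlonglongrightarrow> \<bar>lim a - a k\<bar>"
    by (intro tendsto_intros LIMSEQ_ignore_initial_segment lim)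
  moreover have "\<bar>a (j + k) - a k\<bar> \<le> C * q ^ k / (1 - q)" for j
  proof -
    have "(\<Sum>i<j. q ^ i) \<le> 1 / (1 - q)"
      using q by (simp add: sum_gp_strict divide_right_mono)
    then have "C * q ^ k * (\<Sum>i<j. q ^ i) \<le> C * q ^ k * (1 / (1 - q))"
      using C0 q by (intro mult_left_mono) auto
    with *[of j] show ?thesis by (simp add: add.commute)
  qed
  ultimately show "\<bar>lim a - a k\<bar> \<le> C * q ^ k / (1 - q)"
    using LIMSEQ_le_const2 by blast
qed

lemma has_derivative_locally_uniform_limit:
  fixes f :: "nat \<Rightarrow> 'a::real_normed_vector \<Rightarrow> real"
  assumes S: "convex S" "open S" "x \<in> S"
    and f: "\<And>k y. y \<in> S \<Longrightarrow> (f k has_derivative f' k y) (at y)"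
    and le: "\<And>k y h. y \<in> S \<Longrightarrow> \<bar>f' k y h - g' y h\<bar> \<le> e k * norm h" and e: "e \<longlonglongrightarrow> 0"
    and g: "\<And>y. y \<in> S \<Longrightarrow> (\<lambda>k. f k y) \<longlonglongrightarrow> g y"
  shows "(g has_derivative g' x) (at x)"
proof -
  have "\<exists>g0. \<forall>y\<in>S. (\<lambda>k. f k y) \<longlonglongrightarrow> g0 y \<and> (g0 has_derivative g' y) (at y within S)"
  proof (rule has_derivative_sequence[where f = f and f' = f' and ?x0.0 = x and l = "g x"])
    show "(f k has_derivative f' k y) (at y within S)" if "y \<in> S" for k y
      using f[OF that] has_derivative_at_withinI by blast
    fix d :: real assume d: "d > 0"
    have "\<forall>\<^sub>F k in sequentially. e k < d" using e d order_tendstoD by blast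
    then show "\<forall>\<^sub>F k in sequentially. \<forall>y\<in>S. \<forall>h. norm (f' k y h - g' y h) \<le> d * norm h"
    proof eventually_elim
      case (elim k)
      show ?case
      proof (intro ballI allI)
        fix y h assume "y \<in> S"
        then have "norm (f' k y h - g' y h) \<le> e k * norm h" using le by simp
        also have "\<dots> \<le> d * norm h" using elim by (intro mult_right_mono) auto
        finally show "norm (f' k y h - g' y h) \<le> d * norm h" .
      qed
    qed
  qed (use S g in auto)
  then obtain g0 where g0: "\<And>y. y \<in> S \<Longrightarrow> (\<lambda>k. f k y) \<longlonglongrightarrow> g0 y"
    "\<And>y. y \<in> S \<Longrightarrow> (g0 has_derivative g' y) (at y within S)" by blast
  have eq: "g0 y = g y" if "y \<in> S" for y
    using LIMSEQ_unique[OF g0(1)[OF that] g[OF that]] .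
  have "(g0 has_derivative g' x) (at x)" using g0(2)[OF S(3)] S at_within_open by metis
  then show ?thesis using has_derivative_transform_within_open[OF _ S(2,3)] eq by blast
qed

lemma continuous_on_uniform_limit_bound:
  fixes f :: "nat \<Rightarrow> 'a::topological_space \<Rightarrow> real"
  assumes f: "\<And>k. continuous_on S (f k)"
    and le: "\<And>k y. y \<in> S \<Longrightarrow> \<bar>f k y - g y\<bar> \<le> e k" and e: "e \<longlonglongrightarrow> 0"
  shows "continuous_on S g"
proof (rule uniform_limit_theorem[of _ f sequentially])
  show "uniform_limit S f g sequentially"
  proof (rule uniform_limitI)
    fix d :: real assume "d > 0"
    then have "\<forall>\<^sub>F k in sequentially. e k < d" using e order_tendstoD by blast
    then show "\<forall>\<^sub>F k in sequentially. \<forall>x\<in>S. dist (f k x) (g x) < d"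
    proof eventually_elim
      case (elim k)
      then show ?case using le[of _ k] by (auto simp: dist_real_def intro: le_less_trans)
    qed
  qed
qed (use f in auto)

text \<open>Height of a kernel times volume of its truncation ball, up to constants. For
  \<open>n = 2 * m + 2\<close> and \<open>a\<close> equal to \<open>m\<close>,
  \<open>m + 1/2\<close> and \<open>m + 1\<close> the exponent on the right is -2, -1 and 0: decay
  for the kernel and its gradient, exact normalisation for its Laplacian.\<close>

lemma powr_dyadic:
  "(4 ^ k) powr a * ((1/2) ^ k) ^ n = (2 ^ k) powr (2 * a - real n)"
proof -
  define x :: real where "x = 2 ^ k"
  have x: "x > 0" by (simp add: x_def)
  have "(4::real) ^ k = x powr 2" 
    by (simp add: x_def powr_numeral power2_eq_square flip: power_mult_distrib)
  then have 1: "(4 ^ k) powr a = x powr (2 * a)" by (simp add: powr_powr)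
  have "(1/2::real) ^ k = inverse x" by (simp add: x_def power_one_over inverse_eq_divide)
  then have "((1/2::real) ^ k) ^ n = inverse (x ^ n)" by (simp only: power_inverse)
  also have "\<dots> = x powr (- real n)" using x by (simp add: powr_minus powr_realpow)
  finally show ?thesis unfolding 1 by (simp add: x_def[symmetric] flip: powr_add)
qed

lemma four_pos: "(4::real) ^ k > 0" by simp

text \<open>The parameter \<open>4 ^ k\<close> puts the truncation radius at
  \<open>(1/2) ^ k\<close>. Taking a limit of truncations instead of a singular integral lets the
  gradient and the Hessian follow the same pattern.\<close>

definition pot :: "real \<Rightarrow> ('a::euclidean_space \<Rightarrow> real) \<Rightarrow> 'a \<Rightarrow> real" where
  "pot m f x = lim (\<lambda>k. conv (ker0 m (4 ^ k)) f x)"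

definition dpot :: "real \<Rightarrow> ('a::euclidean_space \<Rightarrow> real) \<Rightarrow> 'a \<Rightarrow> 'a \<Rightarrow> real" where
  "dpot m f x h = lim (\<lambda>k. conv (\<lambda>y. ker1 m (4 ^ k) y h) f x)"

definition ddpot :: "real \<Rightarrow> ('a::euclidean_space \<Rightarrow> real) \<Rightarrow> 'a \<Rightarrow> 'a \<Rightarrow> 'a \<Rightarrow> real" where
  "ddpot m f h x j = lim (\<lambda>k. conv (\<lambda>y. ker2 m (4 ^ k) y h j) f x)"

text \<open>For \<open>n = 2 * m + 2\<close> this is minus the Laplacian of the kernel with
  truncation radius 1, by \<open>ker2_trace\<close>; its integral \<open>bump_mass\<close> is the
  classical constant \<open>n - 2\<close> times the area of the unit sphere.\<close>

definition bump :: "real \<Rightarrow> 'a::euclidean_space \<Rightarrow> real" where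
  "bump m y = 4 * m * (m + 1) * (m + 2) * max 0 (1 - y \<bullet> y)"

definition bump_mass :: "real \<Rightarrow> 'a::euclidean_space itself \<Rightarrow> real" where
  "bump_mass m T = (\<integral>y. bump m (y::'a) \<partial>lborel)"

text \<open>Here and in \<open>kdiff1\<close> the power of 4 comes from the finer of two consecutive
  kernels and the summand 1 from the coarser one.\<close>

definition kdiff0 :: "real \<Rightarrow> 'a::euclidean_space itself \<Rightarrow> real" where
  "kdiff0 m T = (4 powr m + 1) * (1 + m)\<^sup>2 * unit_ball_vol (DIM('a))"

definition kdiff1 :: "real \<Rightarrow> 'a::euclidean_space itself \<Rightarrow> real" where
  "kdiff1 m T = 2 * (4 powr (m + 1/2) + 1) * (1 + m)\<^sup>2 * unit_ball_vol (DIM('a))"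

context
  fixes m :: real and T :: "'a::euclidean_space itself"
  assumes m: "m > 0" and dim: "2 * m + 2 = real DIM('a)"
begin

lemma outside_dyadic:
  fixes z :: 'a assumes "norm z > (1/2) ^ k" shows "4 ^ k * (z \<bullet> z) > 1" "4 ^ Suc k * (z \<bullet> z) > 1"
proof -
  have "(4::real) ^ k * ((1/2) ^ k * (1/2) ^ k) = 1" by (simp add: power_mult_distrib[symmetric])
  moreover have "(1/2) ^ k * (1/2) ^ k < norm z * norm z"
    using assms by (intro mult_strict_mono) (auto intro: less_trans[of _ "(1/2)^k"])
  ultimately have "1 < 4 ^ k * (norm z * norm z)"
    using mult_strict_left_mono[of "(1/2) ^ k * (1/2) ^ k" "norm z * norm z" "4 ^ k"] by simp
  then show 1: "4 ^ k * (z \<bullet> z) > 1" by (simp add: dot_square_norm power2_eq_square)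
  then show "4 ^ Suc k * (z \<bullet> z) > 1" by simp
qed

text \<open>Consecutive kernels differ only within radius \<open>(1/2) ^ k\<close>, where their size
  is of order \<open>2 ^ k\<close> to the power \<open>n - 2\<close> and the volume is of order
  \<open>2 ^ k\<close> to the power \<open>- n\<close>.\<close>

lemma conv_ker0_increment:
  fixes f :: "'a \<Rightarrow> real"
  assumes f: "integrable lborel f" "\<And>y. \<bar>f y\<bar> \<le> C"
  shows "\<bar>conv (ker0 m (4 ^ Suc k)) f x - conv (ker0 m (4 ^ k)) f x\<bar> \<le> kdiff0 m T * C * (1/4) ^ k"
proof -
  note km[measurable] = ker_measurable[OF m four_pos]
  note kb = ker0_bound[OF m four_pos]
  have [measurable]: "f \<in> borel_measurable borel" using f by auto
  have eq: "conv (ker0 m (4 ^ Suc k)) f x - conv (ker0 m (4 ^ k)) f x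
      = conv (\<lambda>y. ker0 m (4 ^ Suc k) y - ker0 m (4 ^ k) y) f x"
    by (rule conv_diff_kernel[symmetric, OF f(1) km(1) kb km(1) kb])
  have pw: "(4 ^ Suc k) powr m = 4 powr m * (4 ^ k) powr m" by (simp add: powr_mult)
  have "\<bar>conv (\<lambda>y. ker0 m (4 ^ Suc k) y - ker0 m (4 ^ k) y) f x\<bar>
    \<le> ((4 powr m + 1) * (1 + m)\<^sup>2 * (4 ^ k) powr m) * C * (unit_ball_vol (DIM('a)) * ((1/2) ^ k) ^ DIM('a))"
  proof (rule conv_compact_bound)
    fix z :: 'a
    show "\<bar>ker0 m (4 ^ Suc k) z - ker0 m (4 ^ k) z\<bar> \<le> (4 powr m + 1) * (1 + m)\<^sup>2 * (4 ^ k) powr m"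
      using kb[of "Suc k" z] kb[of k z] unfolding pw by (simp add: algebra_simps)
    assume "(1/2) ^ k < norm z"
    from outside_dyadic[OF this] show "ker0 m (4 ^ Suc k) z - ker0 m (4 ^ k) z = 0"
      using ker_outside(1)[OF m four_pos, of k z] ker_outside(1)[OF m four_pos, of "Suc k" z] by simp
  next
    show "(\<lambda>z::'a. ker0 m (4 ^ Suc k) z - ker0 m (4 ^ k) z) \<in> borel_measurable borel"
      by measurable
  qed (use f in auto)
  also have "\<dots> = kdiff0 m T * C * ((4 ^ k) powr m * ((1/2) ^ k) ^ DIM('a))"
    by (simp add: kdiff0_def ac_simps)
  also have "(4 ^ k) powr m * ((1/2) ^ k) ^ DIM('a) = (1/4::real) ^ k"
  proof -
    have "2 * m - real DIM('a) = -2" using dim by simp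
    moreover have "(2 ^ k) powr (-2) = 1 / ((2::real) ^ k)\<^sup>2" by (simp add: powr_minus inverse_eq_divide)
    moreover have "((2::real) ^ k)\<^sup>2 = 4 ^ k" by (simp add: power2_eq_square flip: power_mult_distrib)
    ultimately show ?thesis unfolding powr_dyadic by (simp add: power_one_over)
  qed
  finally show ?thesis unfolding eq .
qed

text \<open>The bound on \<open>g\<close> is local because \<open>g\<close> will also be a
  directional derivative of the density, which is controlled near \<open>x\<close> only.\<close>

lemma conv_ker1_increment:
  fixes g :: "'a \<Rightarrow> real"
  assumes [measurable]: "g \<in> borel_measurable borel" and g: "\<And>y. y \<in> cball x 1 \<Longrightarrow> \<bar>g y\<bar> \<le> C"
  shows "\<bar>conv (\<lambda>y. ker1 m (4 ^ Suc k) y h - ker1 m (4 ^ k) y h) g x\<bar> \<le> kdiff1 m T * C * norm h * (1/2) ^ k"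
proof -
  note km[measurable] = ker_measurable[OF m four_pos]
  note kb = ker1_bound[OF m four_pos]
  have pw: "(4 ^ Suc k) powr (m + 1/2) = 4 powr (m + 1/2) * (4 ^ k) powr (m + 1/2)" by (simp add: powr_mult)
  have "\<bar>conv (\<lambda>y. ker1 m (4 ^ Suc k) y h - ker1 m (4 ^ k) y h) g x\<bar>
    \<le> (2 * (4 powr (m + 1/2) + 1) * (1 + m)\<^sup>2 * norm h * (4 ^ k) powr (m + 1/2)) * C * (unit_ball_vol (DIM('a)) * ((1/2) ^ k) ^ DIM('a))"
  proof (rule conv_compact_bound)
    fix z :: 'a
    show "\<bar>ker1 m (4 ^ Suc k) z h - ker1 m (4 ^ k) z h\<bar> \<le> 2 * (4 powr (m + 1/2) + 1) * (1 + m)\<^sup>2 * norm h * (4 ^ k) powr (m + 1/2)"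
      using kb[of "Suc k" z h] kb[of k z h] unfolding pw by (simp add: algebra_simps)
    assume "(1/2) ^ k < norm z"
    from outside_dyadic[OF this] show "ker1 m (4 ^ Suc k) z h - ker1 m (4 ^ k) z h = 0"
      using ker_outside(2)[OF m four_pos, of k z] ker_outside(2)[OF m four_pos, of "Suc k" z] by simp
  next
    fix y assume "y \<in> cball x ((1/2) ^ k)"
    moreover have "(1/2::real) ^ k \<le> 1" by (rule power_le_one) auto
    ultimately show "\<bar>g y\<bar> \<le> C" by (intro g) auto
  next
    show "(\<lambda>z::'a. ker1 m (4 ^ Suc k) z h - ker1 m (4 ^ k) z h) \<in> borel_measurable borel"
      by measurable
  qed auto
  also have "\<dots> = kdiff1 m T * C * norm h * ((4 ^ k) powr (m + 1/2) * ((1/2) ^ k) ^ DIM('a))"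
    by (simp add: kdiff1_def ac_simps)
  also have "(4 ^ k) powr (m + 1/2) * ((1/2) ^ k) ^ DIM('a) = (1/2::real) ^ k"
  proof -
    have "2 * (m + 1/2) - real DIM('a) = -1" using dim by simp
    moreover have "(2 ^ k) powr (-1) = 1 / (2::real) ^ k" by (simp add: powr_minus inverse_eq_divide)
    ultimately show ?thesis unfolding powr_dyadic by (simp only: power_one_over)
  qed
  finally show ?thesis .
qed

lemma pot_LIMSEQ:
  fixes f :: "'a \<Rightarrow> real"
  assumes f: "integrable lborel f" "\<And>y. \<bar>f y\<bar> \<le> C"
  shows "(\<lambda>k. conv (ker0 m (4 ^ k)) f x) \<longlonglongrightarrow> pot m f x"
    and "\<bar>pot m f x - conv (ker0 m (4 ^ k)) f x\<bar> \<le> kdiff0 m T * C * (1/4) ^ k / (1 - 1/4)"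
  unfolding pot_def
  using geometric_increments_converge[of "\<lambda>k. conv (ker0 m (4 ^ k)) f x", OF conv_ker0_increment[OF f]]
  by auto

lemma dpot_LIMSEQ:
  fixes f :: "'a \<Rightarrow> real"
  assumes f: "integrable lborel f" "\<And>y. \<bar>f y\<bar> \<le> C"
  shows "(\<lambda>k. conv (\<lambda>y. ker1 m (4 ^ k) y h) f x) \<longlonglongrightarrow> dpot m f x h"
    and "\<bar>dpot m f x h - conv (\<lambda>y. ker1 m (4 ^ k) y h) f x\<bar> \<le> kdiff1 m T * C * norm h * (1/2) ^ k / (1 - 1/2)"
proof -
  note km = ker_measurable[OF m four_pos]
  have "\<bar>conv (\<lambda>y. ker1 m (4 ^ Suc k) y h) f x - conv (\<lambda>y. ker1 m (4 ^ k) y h) f x\<bar> \<le> kdiff1 m T * C * norm h * (1/2) ^ k" for k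
    using conv_ker1_increment[of f x C k h] f
    by (subst conv_diff_kernel[symmetric, OF f(1) km(2) ker1_bound[OF m four_pos] km(2) ker1_bound[OF m four_pos]]) auto
  from geometric_increments_converge[of "\<lambda>k. conv (\<lambda>y. ker1 m (4 ^ k) y h) f x", OF this]
  show "(\<lambda>k. conv (\<lambda>y. ker1 m (4 ^ k) y h) f x) \<longlonglongrightarrow> dpot m f x h"
    "\<bar>dpot m f x h - conv (\<lambda>y. ker1 m (4 ^ k) y h) f x\<bar> \<le> kdiff1 m T * C * norm h * (1/2) ^ k / (1 - 1/2)"
    unfolding dpot_def by auto
qed

lemma conv_ker0_has_derivative:
  fixes f :: "'a \<Rightarrow> real"
  assumes f: "integrable lborel f"
  shows "(conv (ker0 m (4 ^ k)) f has_derivative (\<lambda>h. conv (\<lambda>y. ker1 m (4 ^ k) y h) f x)) (at x)"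
proof (rule conv_has_derivative_kernel[where M = "max ((4 ^ k) powr m * (1 + m)\<^sup>2) (2 * (4 ^ k) powr (m + 1/2) * (1 + m)\<^sup>2)"])
  show "\<bar>ker1 m (4 ^ k) y h\<bar> \<le> max ((4 ^ k) powr m * (1 + m)\<^sup>2) (2 * (4 ^ k) powr (m + 1/2) * (1 + m)\<^sup>2) * norm h" for y h :: 'a
    by (rule order_trans[OF ker1_bound[OF m four_pos]]) (auto intro: mult_right_mono)
  show "\<bar>ker0 m (4 ^ k) y\<bar> \<le> max ((4 ^ k) powr m * (1 + m)\<^sup>2) (2 * (4 ^ k) powr (m + 1/2) * (1 + m)\<^sup>2)" for y :: 'a
    by (rule order_trans[OF ker0_bound[OF m four_pos]]) auto
qed (rule ker0_has_derivative[OF m four_pos] continuous_on_ker[OF m four_pos] f)+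

lemma conv_ker1_has_derivative:
  fixes f :: "'a \<Rightarrow> real"
  assumes f: "integrable lborel f"
  shows "(conv (\<lambda>y. ker1 m (4 ^ k) y h) f has_derivative (\<lambda>j. conv (\<lambda>y. ker2 m (4 ^ k) y h j) f x)) (at x)"
proof (rule conv_has_derivative_kernel[where M = "max (2 * (4 ^ k) powr (m + 1/2) * (1 + m)\<^sup>2 * norm h) (6 * (4 ^ k) powr (m + 1) * (1 + m)\<^sup>2 * norm h)"])
  show "\<bar>ker2 m (4 ^ k) y h j\<bar> \<le> max (2 * (4 ^ k) powr (m + 1/2) * (1 + m)\<^sup>2 * norm h) (6 * (4 ^ k) powr (m + 1) * (1 + m)\<^sup>2 * norm h) * norm j" for y j :: 'a
    by (rule order_trans[OF ker2_bound[OF m four_pos]]) (auto intro: mult_right_mono)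
  show "\<bar>ker1 m (4 ^ k) y h\<bar> \<le> max (2 * (4 ^ k) powr (m + 1/2) * (1 + m)\<^sup>2 * norm h) (6 * (4 ^ k) powr (m + 1) * (1 + m)\<^sup>2 * norm h)" for y :: 'a
    by (rule order_trans[OF ker1_bound[OF m four_pos]]) auto
qed (rule ker1_has_derivative[OF m four_pos] continuous_on_ker[OF m four_pos] f)+

lemma pot_has_derivative:
  fixes f :: "'a \<Rightarrow> real"
  assumes f: "integrable lborel f" "\<And>y. \<bar>f y\<bar> \<le> C"
  shows "(pot m f has_derivative dpot m f x) (at x)"
proof (rule has_derivative_locally_uniform_limit[where S = UNIV and e = "\<lambda>k. kdiff1 m T * C * (1/2) ^ k / (1 - 1/2)"])
  show "(conv (ker0 m (4 ^ k)) f has_derivative (\<lambda>h. conv (\<lambda>y. ker1 m (4 ^ k) y h) f y')) (at y')" for k y'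
    by (rule conv_ker0_has_derivative[OF f(1)])
  show "\<bar>conv (\<lambda>y. ker1 m (4 ^ k) y h) f y - dpot m f y h\<bar> \<le> kdiff1 m T * C * (1/2) ^ k / (1 - 1/2) * norm h" for k y h
    using dpot_LIMSEQ(2)[OF f, of y h k] by (simp add: abs_minus_commute ac_simps)
  have "(\<lambda>k. kdiff1 m T * C * (1/2) ^ k / (1 - 1/2)) \<longlonglongrightarrow> kdiff1 m T * C * 0 / (1 - 1/2)"
    by (intro tendsto_intros LIMSEQ_power_zero) auto
  then show "(\<lambda>k. kdiff1 m T * C * (1/2) ^ k / (1 - 1/2)) \<longlonglongrightarrow> 0" by simp
qed (use pot_LIMSEQ(1)[OF f] in auto)

lemma continuous_on_dpot:
  fixes f :: "'a \<Rightarrow> real"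
  assumes f: "integrable lborel f" "\<And>y. \<bar>f y\<bar> \<le> C"
  shows "continuous_on UNIV (\<lambda>x. dpot m f x h)"
proof (rule continuous_on_uniform_limit_bound[where f = "\<lambda>k. conv (\<lambda>y. ker1 m (4 ^ k) y h) f" and e = "\<lambda>k. kdiff1 m T * C * norm h * (1/2) ^ k / (1 - 1/2)"])
  show "continuous_on UNIV (conv (\<lambda>y. ker1 m (4 ^ k) y h) f)" for k
    by (rule continuous_on_conv[OF f(1) continuous_on_ker(2)[OF m four_pos] ker1_bound[OF m four_pos]])
  show "\<bar>conv (\<lambda>y. ker1 m (4 ^ k) y h) f y - dpot m f y h\<bar> \<le> kdiff1 m T * C * norm h * (1/2) ^ k / (1 - 1/2)" for k y
    using dpot_LIMSEQ(2)[OF f, of y h k] by (simp add: abs_minus_commute)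
  have "(\<lambda>k. kdiff1 m T * C * norm h * (1/2) ^ k / (1 - 1/2)) \<longlonglongrightarrow> kdiff1 m T * C * norm h * 0 / (1 - 1/2)"
    by (intro tendsto_intros LIMSEQ_power_zero) auto
  then show "(\<lambda>k. kdiff1 m T * C * norm h * (1/2) ^ k / (1 - 1/2)) \<longlonglongrightarrow> 0" by simp
qed

end

lemma conv_mono:
  fixes f g :: "'a::euclidean_space \<Rightarrow> real"
  assumes "integrable lborel f" "integrable lborel g" "G \<in> borel_measurable borel"
    "\<And>y. \<bar>G y\<bar> \<le> M" "\<And>y. G y \<ge> 0" "\<And>y. f y \<le> g y"
  shows "conv G f x \<le> conv G g x"
  unfolding conv_def
  by (rule integral_mono[OF integrable_conv_kernel[of f G M] integrable_conv_kernel[of g G M]])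
     (use assms in \<open>auto intro: mult_left_mono\<close>)

context
  fixes m :: real and T :: "'a::euclidean_space itself"
  assumes m: "m > 0" and dim: "2 * m + 2 = real DIM('a)"
begin

text \<open>The second derivatives of the kernels are not absolutely integrable in the limit, so one of the two
  derivatives is moved onto \<open>f\<close>.  Only the difference of two kernels is compactly supported, hence the
  formulation for increments: the derivatives of \<open>f\<close> need not be bounded globally.\<close>

lemma conv_ker2_increment:
  fixes f :: "'a \<Rightarrow> real"
  assumes f: "integrable lborel f" "\<And>y. (f has_derivative f' y) (at y)" "\<And>h. continuous_on UNIV (\<lambda>y. f' y h)"
    and C: "\<And>y j. y \<in> cball x 1 \<Longrightarrow> \<bar>f' y j\<bar> \<le> C * norm j"
  shows "\<bar>conv (\<lambda>y. ker2 m (4 ^ Suc k) y h j) f x - conv (\<lambda>y. ker2 m (4 ^ k) y h j) f x\<bar>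
     \<le> kdiff1 m T * C * norm h * norm j * (1/2) ^ k"
proof -
  let ?D = "\<lambda>y. ker1 m (4 ^ Suc k) y h - ker1 m (4 ^ k) y h"
  note km[measurable] = ker_measurable[OF m four_pos]
  note kb = ker1_bound[OF m four_pos]
  have eq: "conv ?D f = (\<lambda>x. conv (\<lambda>y. ker1 m (4 ^ Suc k) y h) f x - conv (\<lambda>y. ker1 m (4 ^ k) y h) f x)"
    by (intro ext conv_diff_kernel[OF f(1) km(2) kb km(2) kb])
  have 1: "(conv ?D f has_derivative (\<lambda>j. conv (\<lambda>y. ker2 m (4 ^ Suc k) y h j) f x - conv (\<lambda>y. ker2 m (4 ^ k) y h j) f x)) (at x)"
    unfolding eq by (intro has_derivative_diff conv_ker1_has_derivative[OF m dim f(1)])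
  have 2: "(conv ?D f has_derivative (\<lambda>j. conv ?D (\<lambda>y. f' y j) x)) (at x)"
  proof (rule conv_has_derivative_fun[OF _ _ _ f(2,3)])
    show "?D \<in> borel_measurable borel" by measurable
    fix z :: 'a
    show "\<bar>?D z\<bar> \<le> 2 * (4 ^ Suc k) powr (m + 1/2) * (1 + m)\<^sup>2 * norm h + 2 * (4 ^ k) powr (m + 1/2) * (1 + m)\<^sup>2 * norm h"
      using kb[of "Suc k" z h] kb[of k z h] by linarith
    assume z: "norm z > 1"
    have "(1/2::real) ^ k \<le> 1" by (rule power_le_one) auto
    with z have "norm z > (1/2) ^ k" by linarith
    from outside_dyadic[OF m dim this] show "?D z = 0"
      using ker_outside(2)[OF m four_pos, of k z] ker_outside(2)[OF m four_pos, of "Suc k" z] by simp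
  qed
  have "conv (\<lambda>y. ker2 m (4 ^ Suc k) y h j) f x - conv (\<lambda>y. ker2 m (4 ^ k) y h j) f x = conv ?D (\<lambda>y. f' y j) x"
    using has_derivative_unique[OF 1 2] by meson
  moreover have "\<bar>conv ?D (\<lambda>y. f' y j) x\<bar> \<le> kdiff1 m T * (C * norm j) * norm h * (1/2) ^ k"
    by (rule conv_ker1_increment[OF m dim]) (use C borel_measurable_continuous_onI[OF f(3)] in auto)
  ultimately show ?thesis by (simp add: ac_simps)
qed

lemma ddpot_LIMSEQ:
  fixes f :: "'a \<Rightarrow> real"
  assumes f: "integrable lborel f" "\<And>y. (f has_derivative f' y) (at y)" "\<And>h. continuous_on UNIV (\<lambda>y. f' y h)"
    and C: "\<And>y j. y \<in> cball x 1 \<Longrightarrow> \<bar>f' y j\<bar> \<le> C * norm j"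
  shows "(\<lambda>k. conv (\<lambda>y. ker2 m (4 ^ k) y h j) f x) \<longlonglongrightarrow> ddpot m f h x j"
    and "\<bar>ddpot m f h x j - conv (\<lambda>y. ker2 m (4 ^ k) y h j) f x\<bar> \<le> kdiff1 m T * C * norm h * norm j * (1/2) ^ k / (1 - 1/2)"
  unfolding ddpot_def
  using geometric_increments_converge[of "\<lambda>k. conv (\<lambda>y. ker2 m (4 ^ k) y h j) f x", OF conv_ker2_increment[OF f C]]
  by auto

text \<open>Local bounds on \<open>f'\<close> make the convergence of the Hessian integrals uniform
  on unit balls. That is enough, since differentiability and continuity are local.\<close>

lemma
  fixes f :: "'a \<Rightarrow> real"
  assumes f: "integrable lborel f" "\<And>y. \<bar>f y\<bar> \<le> C" 
    and f': "\<And>y. (f has_derivative f' y) (at y)" "\<And>h. continuous_on UNIV (\<lambda>y. f' y h)"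
  shows dpot_has_derivative: "((\<lambda>x. dpot m f x h) has_derivative ddpot m f h x) (at x)"
    and continuous_on_ddpot: "continuous_on UNIV (\<lambda>x. ddpot m f h x j)"
    and ddpot_LIMSEQ': "(\<lambda>k. conv (\<lambda>y. ker2 m (4 ^ k) y h j) f x) \<longlonglongrightarrow> ddpot m f h x j"
proof -
  have loc: "\<exists>D. \<forall>y\<in>ball x 1. \<forall>k h j. \<bar>conv (\<lambda>y. ker2 m (4 ^ k) y h j) f y - ddpot m f h y j\<bar>
      \<le> kdiff1 m T * D * norm h * norm j * (1/2) ^ k / (1 - 1/2)" for x
  proof -
    obtain D where D: "\<And>y h. y \<in> cball x 2 \<Longrightarrow> \<bar>f' y h\<bar> \<le> D * norm h"
      using continuous_derivative_bounded[OF f'] by blast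
    have "\<bar>conv (\<lambda>y. ker2 m (4 ^ k) y h j) f y - ddpot m f h y j\<bar>
      \<le> kdiff1 m T * D * norm h * norm j * (1/2) ^ k / (1 - 1/2)" if y: "y \<in> ball x 1" for y k h j
    proof -
      have "cball y 1 \<subseteq> cball x 2"
      proof
        fix z assume "z \<in> cball y 1"
        then show "z \<in> cball x 2" using y dist_triangle[of x z y] by auto
      qed
      then have "\<bar>f' z j\<bar> \<le> D * norm j" if "z \<in> cball y 1" for z j using D that by blast
      from ddpot_LIMSEQ(2)[OF f(1) f' this, of y h j k] show ?thesis
        by (simp add: abs_minus_commute)
    qed
    then show ?thesis by blast
  qed
  show "(\<lambda>k. conv (\<lambda>y. ker2 m (4 ^ k) y h j) f x) \<longlonglongrightarrow> ddpot m f h x j" for x h j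
  proof -
    obtain D where "\<And>y h. y \<in> cball x 1 \<Longrightarrow> \<bar>f' y h\<bar> \<le> D * norm h"
      using continuous_derivative_bounded[OF f'] by blast
    from ddpot_LIMSEQ(1)[OF f(1) f' this] show ?thesis by blast
  qed
  have lim0: "(\<lambda>k. c * (1/2) ^ k / (1 - 1/2)) \<longlonglongrightarrow> 0" for c :: real
  proof -
    have "(\<lambda>k. c * (1/2) ^ k / (1 - 1/2)) \<longlonglongrightarrow> c * 0 / (1 - 1/2)"
      by (intro tendsto_intros LIMSEQ_power_zero) auto
    then show ?thesis by simp
  qed
  show "((\<lambda>x. dpot m f x h) has_derivative ddpot m f h x) (at x)"
  proof -
    obtain D where D: "\<And>y k h j. y \<in> ball x 1 \<Longrightarrow> \<bar>conv (\<lambda>y. ker2 m (4 ^ k) y h j) f y - ddpot m f h y j\<bar>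
      \<le> kdiff1 m T * D * norm h * norm j * (1/2) ^ k / (1 - 1/2)" using loc[of x] by blast
    show ?thesis
    proof (rule has_derivative_locally_uniform_limit[where S = "ball x 1" and e = "\<lambda>k. kdiff1 m T * D * norm h * (1/2) ^ k / (1 - 1/2)"])
      show "(conv (\<lambda>y. ker1 m (4 ^ k) y h) f has_derivative (\<lambda>j. conv (\<lambda>y. ker2 m (4 ^ k) y h j) f y')) (at y')" for k y'
        by (rule conv_ker1_has_derivative[OF m dim f(1)])
      show "\<bar>conv (\<lambda>y. ker2 m (4 ^ k) y h j) f y - ddpot m f h y j\<bar> \<le> kdiff1 m T * D * norm h * (1/2) ^ k / (1 - 1/2) * norm j"
        if "y \<in> ball x 1" for k y j
        using D[OF that, of k h j] by (simp add: ac_simps)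
    qed (use dpot_LIMSEQ(1)[OF m dim f] lim0 in auto)
  qed
  show "continuous_on UNIV (\<lambda>x. ddpot m f h x j)"
    unfolding continuous_on_eq_continuous_at[OF open_UNIV]
  proof
    fix x :: 'a
    obtain D where D: "\<And>y k h j. y \<in> ball x 1 \<Longrightarrow> \<bar>conv (\<lambda>y. ker2 m (4 ^ k) y h j) f y - ddpot m f h y j\<bar>
      \<le> kdiff1 m T * D * norm h * norm j * (1/2) ^ k / (1 - 1/2)" using loc[of x] by blast
    have "continuous_on (ball x 1) (\<lambda>x. ddpot m f h x j)"
    proof (rule continuous_on_uniform_limit_bound[where f = "\<lambda>k. conv (\<lambda>y. ker2 m (4 ^ k) y h j) f" and e = "\<lambda>k. kdiff1 m T * D * norm h * norm j * (1/2) ^ k / (1 - 1/2)"])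
      show "continuous_on (ball x 1) (conv (\<lambda>y. ker2 m (4 ^ k) y h j) f)" for k
        by (rule continuous_on_subset[OF continuous_on_conv[OF f(1) continuous_on_ker(3)[OF m four_pos] ker2_bound[OF m four_pos]]]) auto
    qed (use D lim0 in auto)
    then show "isCont (\<lambda>x. ddpot m f h x j) x"
      by (subst (asm) continuous_on_eq_continuous_at) auto
  qed
qed

section \<open>The Laplacian of the potential\<close>

lemma bump_nonneg: "bump m (y::'a) \<ge> 0"
  using m by (simp add: bump_def)

lemma continuous_on_bump: "continuous_on UNIV (bump m :: 'a \<Rightarrow> real)"
  unfolding bump_def[abs_def] by (intro continuous_intros)

lemma bump_le: "bump m (y::'a) \<le> 4 * m * (m + 1) * (m + 2) * indicator (cball 0 1) y"
proof (cases "norm y \<le> 1")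
  case True
  have "4 * m * (m + 1) * (m + 2) * max 0 (1 - y \<bullet> y) \<le> 4 * m * (m + 1) * (m + 2) * 1"
    using m by (intro mult_left_mono) auto
  then show ?thesis using True by (simp add: bump_def)
next
  case False
  then have "y \<bullet> y > 1" by (simp add: dot_square_norm)
  then show ?thesis using False by (simp add: bump_def)
qed

lemma integrable_bump: "integrable lborel (bump m :: 'a \<Rightarrow> real)"
proof (rule Bochner_Integration.integrable_bound)
  show "integrable lborel (\<lambda>y. 4 * m * (m + 1) * (m + 2) * indicator (cball (0::'a) 1) y)"
    by (intro integrable_mult_right integrable_indicator_cball)
  show "(bump m :: 'a \<Rightarrow> real) \<in> borel_measurable lborel"
    using borel_measurable_continuous_onI[OF continuous_on_bump] by simp
  show "AE y in lborel. norm (bump m (y::'a)) \<le> norm (4 * m * (m + 1) * (m + 2) * indicator (cball 0 1) y)"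
    using bump_le bump_nonneg by (intro AE_I2) (simp add: order_trans[OF bump_le abs_ge_self])
qed

text \<open>On the ball of radius 1/2 the factor \<open>1 - y \<bullet> y\<close> is at least
  3/4.\<close>

lemma bump_mass_pos: "bump_mass m T > 0"
proof -
  let ?c = "4 * m * (m + 1) * (m + 2) * (3/4)"
  have "0 < ?c * (unit_ball_vol (DIM('a)) * (1/2) ^ DIM('a))" using m by simp
  also have "\<dots> = (\<integral>y. ?c * indicator (cball (0::'a) (1/2)) y \<partial>lborel)"
    by (simp add: content_cball)
  also have "\<dots> \<le> (\<integral>y. bump m (y::'a) \<partial>lborel)"
  proof (rule integral_mono)
    show "integrable lborel (\<lambda>y. ?c * indicator (cball (0::'a) (1/2)) y)"
      by (intro integrable_mult_right integrable_indicator_cball)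
    fix y :: 'a
    show "?c * indicator (cball 0 (1/2)) y \<le> bump m y"
    proof (cases "norm y \<le> 1/2")
      case True
      then have "(norm y)\<^sup>2 \<le> (1/2)\<^sup>2" by (intro power_mono) auto
      then have "3/4 \<le> max 0 (1 - y \<bullet> y)" by (auto simp: dot_square_norm power2_eq_square)
      then have "4 * m * (m + 1) * (m + 2) * (3/4) \<le> 4 * m * (m + 1) * (m + 2) * max 0 (1 - y \<bullet> y)"
        by (rule mult_left_mono) (use m in simp)
      then have "?c \<le> bump m y" by (simp only: bump_def)
      moreover have "indicator (cball 0 (1/2)) y = (1::real)" using True by simp
      ultimately show ?thesis by (simp only: mult_1_right)
    qed (use bump_nonneg in auto)
  qed (rule integrable_bump)
  finally show ?thesis by (simp add: bump_mass_def)
qed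

text \<open>An approximate identity: since \<open>2 * m + 2\<close> is the dimension,
  \<open>(4 ^ k) powr (m + 1)\<close> is the Jacobian of the dilation by \<open>2 ^ k\<close>. After
  rescaling, \<open>C * bump m z\<close> dominates the integrand.\<close>

lemma conv_bump_LIMSEQ:
  fixes f :: "'a \<Rightarrow> real"
  assumes f: "continuous_on UNIV f" "\<And>y. \<bar>f y\<bar> \<le> C"
  shows "(\<lambda>k. conv (\<lambda>z. (4 ^ k) powr (m + 1) * bump m (2 ^ k *\<^sub>R z)) f x) \<longlonglongrightarrow> bump_mass m T * f x"
proof -
  note [measurable] = borel_measurable_continuous_onI[OF f(1)] borel_measurable_continuous_onI[OF continuous_on_bump]
  have eq: "conv (\<lambda>z. (4 ^ k) powr (m + 1) * bump m (2 ^ k *\<^sub>R z)) f x = (\<integral>z. bump m z * f (x - (1/2) ^ k *\<^sub>R z) \<partial>lborel)" for k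
  proof -
    have pw: "(4 ^ k) powr (m + 1) * ((1/2) ^ k) ^ DIM('a) = (1::real)"
      using dim unfolding powr_dyadic by (simp add: algebra_simps)
    define c :: real where "c = (1/2) ^ k"
    have c: "c > 0" "2 ^ k * c = 1" by (simp_all add: c_def flip: power_mult_distrib)
    define F where "F z = ((4 ^ k) powr (m + 1) * bump m (2 ^ k *\<^sub>R z)) * f (x - z)" for z
    have [measurable]: "F \<in> borel_measurable borel" unfolding F_def[abs_def] by measurable
    have M: "lborel = density (distr lborel borel (\<lambda>z::'a. 0 + c *\<^sub>R z)) (\<lambda>_. ennreal (c ^ DIM('a)))"
      using lborel_affine[of c "0::'a"] c by simp
    have "conv (\<lambda>z. (4 ^ k) powr (m + 1) * bump m (2 ^ k *\<^sub>R z)) f x = (\<integral>z. F z \<partial>lborel)"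
      unfolding F_def by (rule conv_commute) measurable
    also have "\<dots> = (\<integral>z. F z \<partial>density (distr lborel borel (\<lambda>z::'a. 0 + c *\<^sub>R z)) (\<lambda>_. ennreal (c ^ DIM('a))))"
      using M by simp
    also have "\<dots> = (\<integral>z. c ^ DIM('a) *\<^sub>R F z \<partial>distr lborel borel (\<lambda>z::'a. 0 + c *\<^sub>R z))"
      by (rule integral_density) (use c in auto)
    also have "\<dots> = (\<integral>z. c ^ DIM('a) *\<^sub>R F (0 + c *\<^sub>R z) \<partial>lborel)"
      by (rule integral_distr) measurable
    also have "\<dots> = (\<integral>z. bump m z * f (x - c *\<^sub>R z) \<partial>lborel)"
    proof (rule Bochner_Integration.integral_cong[OF refl])
      fix z :: 'a
      have "2 ^ k *\<^sub>R (c *\<^sub>R z) = z" using c(2) by simp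
      then have "c ^ DIM('a) *\<^sub>R F (0 + c *\<^sub>R z) = ((4 ^ k) powr (m + 1) * c ^ DIM('a)) * (bump m z * f (x - c *\<^sub>R z))"
        by (simp add: F_def)
      also have "(4 ^ k) powr (m + 1) * c ^ DIM('a) = 1" using pw by (simp only: c_def)
      finally show "c ^ DIM('a) *\<^sub>R F (0 + c *\<^sub>R z) = bump m z * f (x - c *\<^sub>R z)" by simp
    qed
    finally have "conv (\<lambda>z. (4 ^ k) powr (m + 1) * bump m (2 ^ k *\<^sub>R z)) f x = (\<integral>z. bump m z * f (x - c *\<^sub>R z) \<partial>lborel)" .
    then show ?thesis unfolding c_def .
  qed
  have "(\<lambda>k. \<integral>z. bump m z * f (x - (1/2) ^ k *\<^sub>R z) \<partial>lborel) \<longlonglongrightarrow> (\<integral>z. bump m (z::'a) * f x \<partial>lborel)"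
  proof (rule integral_dominated_convergence[where w = "\<lambda>z::'a. C * bump m z"])
    show "integrable lborel (\<lambda>z::'a. C * bump m z)" using integrable_bump by simp
    show "AE z in lborel. norm (bump m z * f (x - (1/2) ^ k *\<^sub>R z)) \<le> C * bump m z" for k
    proof (rule AE_I2)
      fix z :: 'a
      have "\<bar>f (x - (1/2) ^ k *\<^sub>R z)\<bar> * bump m z \<le> C * bump m z"
        by (intro mult_right_mono f(2) bump_nonneg)
      then show "norm (bump m z * f (x - (1/2) ^ k *\<^sub>R z)) \<le> C * bump m z"
        using bump_nonneg[of z] by (simp add: abs_mult mult.commute)
    qed
    show "AE z in lborel. (\<lambda>k. bump m z * f (x - (1/2) ^ k *\<^sub>R z)) \<longlonglongrightarrow> bump m z * f x"
    proof (rule AE_I2)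
      fix z :: 'a
      have "(\<lambda>k. x - (1/2::real) ^ k *\<^sub>R z) \<longlonglongrightarrow> x - 0 *\<^sub>R z"
        by (intro tendsto_intros LIMSEQ_power_zero) auto
      then have "(\<lambda>k. x - (1/2::real) ^ k *\<^sub>R z) \<longlonglongrightarrow> x" by simp
      then have "(\<lambda>k. f (x - (1/2) ^ k *\<^sub>R z)) \<longlonglongrightarrow> f x"
        using f(1) by (auto simp: continuous_on_eq_continuous_at intro: isCont_tendsto_compose)
      then show "(\<lambda>k. bump m z * f (x - (1/2) ^ k *\<^sub>R z)) \<longlonglongrightarrow> bump m z * f x"
        by (intro tendsto_intros)
    qed
  qed measurable
  then show ?thesis unfolding eq bump_mass_def by simp
qed

text \<open>The traces of the truncated Hessian kernels are minus the rescaled bumps, so Poisson's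
  equation follows from \<open>conv_bump_LIMSEQ\<close>.\<close>

lemma ddpot_trace:
  fixes f :: "'a \<Rightarrow> real"
  assumes f: "integrable lborel f" "\<And>y. \<bar>f y\<bar> \<le> C" 
    and f': "\<And>y. (f has_derivative f' y) (at y)" "\<And>h. continuous_on UNIV (\<lambda>y. f' y h)"
  shows "(\<Sum>i\<in>Basis. ddpot m f i x i) = - bump_mass m T * f x"
proof -
  have cont: "continuous_on UNIV f"
    using f'(1) by (meson differentiableI differentiable_imp_continuous_within continuous_at_imp_continuous_on)
  have "(\<lambda>k. \<Sum>i\<in>Basis. conv (\<lambda>y. ker2 m (4 ^ k) y i i) f x) \<longlonglongrightarrow> (\<Sum>i\<in>Basis. ddpot m f i x i)"
    by (intro tendsto_sum ddpot_LIMSEQ'[OF f f'])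
  moreover have "(\<Sum>i\<in>Basis. conv (\<lambda>y. ker2 m (4 ^ k) y i i) f x) =
      - conv (\<lambda>z. (4 ^ k) powr (m + 1) * bump m (2 ^ k *\<^sub>R z)) f x" for k
  proof -
    have b: "(4::real) ^ k = 2 ^ k * 2 ^ k" by (simp flip: power_mult_distrib)
    have tr: "(\<Sum>i\<in>Basis. ker2 m (4 ^ k) z i i) = - ((4 ^ k) powr (m + 1) * bump m (2 ^ k *\<^sub>R z))" for z :: 'a
      using ker2_trace[OF m four_pos dim, of k z] by (simp add: bump_def) (simp add: b mult.assoc)
    have "(\<Sum>i\<in>Basis. conv (\<lambda>y. ker2 m (4 ^ k) y i i) f x) = (\<integral>y. (\<Sum>i\<in>Basis. ker2 m (4 ^ k) (x - y) i i * f y) \<partial>lborel)"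
      unfolding conv_def
      by (rule Bochner_Integration.integral_sum[symmetric])
         (rule integrable_conv_kernel[OF f(1) ker_measurable(3)[OF m four_pos] ker2_bound[OF m four_pos]])
    also have "\<dots> = (\<integral>y. - ((4 ^ k) powr (m + 1) * bump m (2 ^ k *\<^sub>R (x - y)) * f y) \<partial>lborel)"
      by (simp only: sum_distrib_right[symmetric] tr minus_mult_left)
    finally show ?thesis by (simp add: conv_def)
  qed
  moreover have "(\<lambda>k. - conv (\<lambda>z. (4 ^ k) powr (m + 1) * bump m (2 ^ k *\<^sub>R z)) f x) \<longlonglongrightarrow> - (bump_mass m T * f x)"
    by (intro tendsto_minus conv_bump_LIMSEQ[OF cont f(2)])
  ultimately show ?thesis using LIMSEQ_unique by fastforce
qed

section \<open>Order, bounds and limits for the potential\<close>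

lemma ker0_nonneg: "ker0 m (4 ^ k) (y::'a) \<ge> 0"
  using ker0_ge[OF m four_pos, of k y] by (simp add: order_trans[OF powr_ge_zero])

lemma pot_mono:
  fixes f g :: "'a \<Rightarrow> real"
  assumes f: "integrable lborel f" "\<And>y. \<bar>f y\<bar> \<le> C" and g: "integrable lborel g" "\<And>y. \<bar>g y\<bar> \<le> D"
    and le: "\<And>y. f y \<le> g y"
  shows "pot m f x \<le> pot m g x"
proof (rule LIMSEQ_le[OF pot_LIMSEQ(1)[OF m dim f] pot_LIMSEQ(1)[OF m dim g]])
  show "\<exists>N. \<forall>n\<ge>N. conv (ker0 m (4 ^ n)) f x \<le> conv (ker0 m (4 ^ n)) g x"
    using conv_mono[OF f(1) g(1) ker_measurable(1)[OF m four_pos] ker0_bound[OF m four_pos] ker0_nonneg le]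
    by blast
qed

lemma pot_cmult:
  fixes f :: "'a \<Rightarrow> real"
  assumes f: "integrable lborel f" "\<And>y. \<bar>f y\<bar> \<le> C"
  shows "pot m (\<lambda>y. c * f y) x = c * pot m f x"
proof -
  have "conv G (\<lambda>y. c * f y) x = c * conv G f x" for G by (simp add: conv_def mult.left_commute)
  then have "(\<lambda>k. conv (ker0 m (4 ^ k)) (\<lambda>y. c * f y) x) \<longlonglongrightarrow> c * pot m f x"
    using tendsto_mult_left[OF pot_LIMSEQ(1)[OF m dim f]] by simp
  then show ?thesis unfolding pot_def by (rule limI)
qed

lemma pot_nonneg:
  fixes f :: "'a \<Rightarrow> real"
  assumes f: "integrable lborel f" "\<And>y. \<bar>f y\<bar> \<le> C" "\<And>y. f y \<ge> 0"
  shows "pot m f x \<ge> 0"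
  using pot_mono[of "\<lambda>_. 0" 0 f C x] pot_cmult[OF f(1,2), of 0 x] f by simp

text \<open>The kernel with truncation radius 1 is bounded, hence controlled by the integral of
  \<open>\<bar>f y\<bar>\<close>; the remainder is the geometric tail from \<open>k = 0\<close>,
  controlled by the supremum \<open>C\<close>.\<close>

lemma pot_bounded:
  fixes f :: "'a \<Rightarrow> real"
  assumes f: "integrable lborel f" "\<And>y. \<bar>f y\<bar> \<le> C"
  shows "\<exists>B. \<forall>x. \<bar>pot m f x\<bar> \<le> B"
proof (intro exI allI)
  fix x :: 'a
  have "\<bar>conv (ker0 m (4 ^ 0)) f x\<bar> \<le> (\<integral>y. (1 + m)\<^sup>2 * \<bar>f y\<bar> \<partial>lborel)"
    unfolding conv_def
  proof (rule Bochner_Integration.integral_norm_bound_integral[where 'a='a and 'b=real, unfolded real_norm_def])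
    show "integrable lborel (\<lambda>y. ker0 m (4 ^ 0) (x - y) * f y)"
      by (rule integrable_conv_kernel[OF f(1) ker_measurable(1)[OF m four_pos] ker0_bound[OF m four_pos]])
    show "integrable lborel (\<lambda>y. (1 + m)\<^sup>2 * \<bar>f y\<bar>)" using f by simp
    show "\<bar>ker0 m (4 ^ 0) (x - y) * f y\<bar> \<le> (1 + m)\<^sup>2 * \<bar>f y\<bar>" for y
      using ker0_bound[OF m four_pos, of 0 "x - y"] by (auto simp: abs_mult intro!: mult_right_mono)
  qed
  then show "\<bar>pot m f x\<bar> \<le> (\<integral>y. (1 + m)\<^sup>2 * \<bar>f y\<bar> \<partial>lborel) + kdiff0 m T * C * (1/4) ^ 0 / (1 - 1/4)"
    using pot_LIMSEQ(2)[where T = T, OF m dim f, of x 0] by linarith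
qed

text \<open>The tail bound is uniform in \<open>x\<close>, so up to \<open>e/2\<close> the potential
  is a convolution with a bounded kernel that vanishes at infinity.\<close>

lemma pot_tendsto_0:
  fixes f :: "'a \<Rightarrow> real"
  assumes f: "integrable lborel f" "\<And>y. \<bar>f y\<bar> \<le> C"
  shows "(pot m f \<longlongrightarrow> 0) at_infinity"
proof (rule tendstoI)
  fix e :: real assume e: "e > 0"
  have "(\<lambda>k. kdiff0 m T * C * (1/4) ^ k / (1 - 1/4)) \<longlonglongrightarrow> kdiff0 m T * C * 0 / (1 - 1/4)"
    by (intro tendsto_intros LIMSEQ_power_zero) auto
  then have "\<forall>\<^sub>F k in sequentially. kdiff0 m T * C * (1/4) ^ k / (1 - 1/4) < e/2"
    by (rule order_tendstoD) (use e in simp)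
  then obtain k where k: "kdiff0 m T * C * (1/4) ^ k / (1 - 1/4) < e/2"
    by (auto simp: eventually_sequentially)
  have "(conv (ker0 m (4 ^ k)) f \<longlongrightarrow> 0) at_infinity"
    by (rule conv_tendsto_0_at_infinity[OF f(1) ker_measurable(1)[OF m four_pos] ker0_bound[OF m four_pos] ker0_tendsto[OF m four_pos]])
  then have "\<forall>\<^sub>F x in at_infinity. dist (conv (ker0 m (4 ^ k)) f x) 0 < e/2"
    using e by (intro tendstoD) auto
  then show "\<forall>\<^sub>F x in at_infinity. dist (pot m f x) 0 < e"
  proof eventually_elim
    case (elim x)
    then have 1: "\<bar>conv (ker0 m (4 ^ k)) f x\<bar> < e/2" by simp
    from 1 pot_LIMSEQ(2)[where T = T, OF m dim f, of x k] k have "\<bar>pot m f x\<bar> < e" by linarith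
    then show ?case by simp
  qed
qed

text \<open>The tail bound depends on \<open>f j\<close> only through the common bound
  \<open>C\<close>, so one \<open>k\<close> serves for all \<open>j\<close> and for the limit;
  dominated convergence then acts on a single bounded kernel.\<close>

lemma pot_dominated_LIMSEQ:
  fixes f :: "nat \<Rightarrow> 'a \<Rightarrow> real"
  assumes w: "integrable lborel w" "\<And>y. \<bar>w y\<bar> \<le> C"
    and f: "\<And>j. f j \<in> borel_measurable borel" "\<And>j y. \<bar>f j y\<bar> \<le> w y" "\<And>y. (\<lambda>j. f j y) \<longlonglongrightarrow> g y"
  shows "(\<lambda>j. pot m (f j) x) \<longlonglongrightarrow> pot m g x"
proof (rule LIMSEQ_I)
  fix e :: real assume e: "e > 0"
  have gm: "g \<in> borel_measurable borel" by (rule borel_measurable_LIMSEQ_real[OF f(3) f(1)])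
  have gw: "\<bar>g y\<bar> \<le> w y" for y
    by (rule LIMSEQ_le_const2[OF tendsto_rabs[OF f(3)]]) (use f(2) in auto)
  have w0: "\<bar>w y\<bar> = w y" for y using gw[of y] by simp
  have fi: "integrable lborel (f j)" for j
    by (rule Bochner_Integration.integrable_bound[OF w(1)]) (use f w0 in auto)
  have gi: "integrable lborel g"
    by (rule Bochner_Integration.integrable_bound[OF w(1)]) (use gm gw w0 in auto)
  have fb: "\<bar>f j y\<bar> \<le> C" for j y using f(2)[of j y] w(2)[of y] w0[of y] by linarith
  have gb: "\<bar>g y\<bar> \<le> C" for y using gw[of y] w(2)[of y] w0[of y] by linarith
  have "(\<lambda>k. kdiff0 m T * C * (1/4) ^ k / (1 - 1/4)) \<longlonglongrightarrow> kdiff0 m T * C * 0 / (1 - 1/4)"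
    by (intro tendsto_intros LIMSEQ_power_zero) auto
  then have "\<forall>\<^sub>F k in sequentially. kdiff0 m T * C * (1/4) ^ k / (1 - 1/4) < e/3"
    by (rule order_tendstoD) (use e in simp)
  then obtain k where k: "kdiff0 m T * C * (1/4) ^ k / (1 - 1/4) < e/3"
    by (auto simp: eventually_sequentially)
  let ?G = "ker0 m (4 ^ k) :: 'a \<Rightarrow> real" let ?M = "(4 ^ k) powr m * (1 + m)\<^sup>2"
  note km[measurable] = ker_measurable(1)[OF m four_pos] gm f(1)
  have "(\<lambda>j. conv ?G (f j) x) \<longlonglongrightarrow> conv ?G g x"
    unfolding conv_def
  proof (rule integral_dominated_convergence[where w = "\<lambda>y. ?M * w y"])
    show "integrable lborel (\<lambda>y. ?M * w y)" using w by simp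
    show "AE y in lborel. (\<lambda>j. ?G (x - y) * f j y) \<longlonglongrightarrow> ?G (x - y) * g y"
      by (intro AE_I2 tendsto_intros f(3))
    show "AE y in lborel. norm (?G (x - y) * f j y) \<le> ?M * w y" for j
    proof (rule AE_I2)
      fix y
      have "\<bar>?G (x - y)\<bar> * \<bar>f j y\<bar> \<le> ?M * w y"
        using ker0_bound[OF m four_pos, of k "x - y"] f(2)[of j y] by (rule mult_mono) (use m in auto)
      then show "norm (?G (x - y) * f j y) \<le> ?M * w y" by (simp add: abs_mult)
    qed
  qed measurable
  then obtain N where N: "\<And>j. j \<ge> N \<Longrightarrow> norm (conv ?G (f j) x - conv ?G g x) < e/3"
    using LIMSEQ_D[of "\<lambda>j. conv ?G (f j) x" "conv ?G g x" "e/3"] e by auto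
  have "norm (pot m (f j) x - pot m g x) < e" if "j \<ge> N" for j
    using N[OF that] k pot_LIMSEQ(2)[where T = T, OF m dim fi[of j] fb, of x k] pot_LIMSEQ(2)[where T = T, OF m dim gi gb, of x k]
    unfolding real_norm_def by linarith
  then show "\<exists>N. \<forall>j\<ge>N. norm (pot m (f j) x - pot m g x) < e" by blast
qed

text \<open>Two points of the ball are at most \<open>2 * r\<close> apart, so \<open>ker0_ge\<close>
  bounds all truncated kernels from below by the same constant there.\<close>

lemma pot_ge_on_ball:
  fixes f :: "'a \<Rightarrow> real"
  assumes f: "integrable lborel f" "\<And>y. \<bar>f y\<bar> \<le> C" "\<And>y. f y \<ge> 0"
    and r: "r \<ge> 0" and a: "\<And>y. y \<in> cball x0 r \<Longrightarrow> f y \<ge> a" "a \<ge> 0" and x: "x \<in> cball x0 r"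
  shows "pot m f x \<ge> a * (max 1 (4 * r\<^sup>2) powr (- m) * (unit_ball_vol (DIM('a)) * r ^ DIM('a)))"
proof (rule LIMSEQ_le_const[OF pot_LIMSEQ(1)[OF m dim f(1,2)]], intro exI allI impI)
  fix k :: nat
  let ?c = "max 1 (4 * r\<^sup>2) powr (- m)"
  have "a * (?c * (unit_ball_vol (DIM('a)) * r ^ DIM('a))) = (\<integral>y. (?c * a) * indicator (cball x0 r) y \<partial>lborel)"
    using r by (simp add: content_cball)
  also have "\<dots> \<le> conv (ker0 m (4 ^ k)) f x"
    unfolding conv_def
  proof (rule integral_mono)
    show "integrable lborel (\<lambda>y. (?c * a) * indicator (cball x0 r) y)"
      by (intro integrable_mult_right integrable_indicator_cball)
    show "integrable lborel (\<lambda>y. ker0 m (4 ^ k) (x - y) * f y)"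
      by (rule integrable_conv_kernel[OF f(1) ker_measurable(1)[OF m four_pos] ker0_bound[OF m four_pos]])
    fix y
    show "(?c * a) * indicator (cball x0 r) y \<le> ker0 m (4 ^ k) (x - y) * f y"
    proof (cases "y \<in> cball x0 r")
      case True
      have "dist x y \<le> dist x0 x + dist x0 y" using dist_triangle3[of x y x0] by simp
      then have "norm (x - y) \<le> 2 * r" using True x by (simp add: dist_norm[of x y])
      then have "(norm (x - y))\<^sup>2 \<le> (2 * r)\<^sup>2" by (intro power_mono) auto
      then have "(x - y) \<bullet> (x - y) \<le> 4 * r\<^sup>2" by (simp add: dot_square_norm power_mult_distrib)
      then have "?c \<le> (max 1 ((x - y) \<bullet> (x - y))) powr (- m)"
        using m by (intro powr_mono2') auto
      also have "\<dots> \<le> ker0 m (4 ^ k) (x - y)"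
        by (rule ker0_ge[OF m four_pos]) simp
      finally have "?c * a \<le> ker0 m (4 ^ k) (x - y) * f y"
        by (intro mult_mono a True ker0_nonneg)
      with True show ?thesis by simp
    qed (use ker0_nonneg f in auto)
  qed
  finally show "a * (?c * (unit_ball_vol (DIM('a)) * r ^ DIM('a))) \<le> conv (ker0 m (4 ^ k)) f x" .
qed

end

section \<open>The maximum principle\<close>

lemma C2_funI:
  fixes u :: "'a::euclidean_space \<Rightarrow> real"
  assumes u: "\<And>x. (u has_derivative u' x) (at x)"
    and u': "\<And>i x. i \<in> Basis \<Longrightarrow> ((\<lambda>x. u' x i) has_derivative u'' i x) (at x)"
    and c: "\<And>i j. i \<in> Basis \<Longrightarrow> j \<in> Basis \<Longrightarrow> continuous_on UNIV (\<lambda>x. u'' i x j)"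
  shows "C2_fun u" "laplacian u x = (\<Sum>i\<in>Basis. u'' i x i)"
proof -
  have pd1: "pd u [i] = (\<lambda>x. u' x i)" for i
    using frechet_derivative_at[OF u] by (metis pd.simps)
  \<comment> \<open>In \<open>pd u [j, i]\<close> the direction \<open>i\<close> is differentiated
    first.\<close>
  have pd2: "pd u [j, i] = (\<lambda>x. u'' i x j)" if "i \<in> Basis" for i j
  proof -
    have "frechet_derivative (pd u [i]) (at x) = u'' i x" for x
      unfolding pd1 using frechet_derivative_at[OF u'[OF that]] by simp
    then show ?thesis by (simp only: pd.simps)
  qed
  show "laplacian u x = (\<Sum>i\<in>Basis. u'' i x i)"
    unfolding laplacian_def by (rule sum.cong) (auto simp: pd2 simp del: pd.simps)
  show "C2_fun u"
    unfolding C2_fun_def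
  proof (intro conjI allI impI)
    fix vs :: "'a list" assume vs: "set vs \<subseteq> Basis" "length vs \<le> 1"
    consider "vs = []" | i where "vs = [i]" using vs(2) by (cases vs) auto
    then show "pd u vs differentiable_on UNIV"
    proof cases
      case 1 then show ?thesis using u by (auto simp: differentiable_on_def differentiable_def)
    next
      case 2
      then have "i \<in> Basis" using vs by simp
      then show ?thesis unfolding 2 pd1 using u' by (auto simp: differentiable_on_def differentiable_def)
    qed
  next
    fix vs :: "'a list" assume vs: "set vs \<subseteq> Basis" "length vs = 2"
    then obtain j i where "vs = [j, i]" by (auto simp: length_Suc_conv numeral_2_eq_2)
    then show "continuous_on UNIV (pd u vs)" using vs c pd2 by simp
  qed
qed

lemma C2_fun_has_derivative:
  assumes "C2_fun u"
  shows "(u has_derivative frechet_derivative u (at x)) (at x)"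
    and "i \<in> Basis \<Longrightarrow> (pd u [i] has_derivative frechet_derivative (pd u [i]) (at x)) (at x)"
proof -
  have diff: "pd u vs differentiable_on UNIV" if "set vs \<subseteq> Basis" "length vs \<le> 1" for vs
    using assms that unfolding C2_fun_def by blast
  have "pd u [] differentiable_on UNIV" by (rule diff) simp_all
  then show "(u has_derivative frechet_derivative u (at x)) (at x)"
    by (simp add: differentiable_on_def frechet_derivative_works)
  assume "i \<in> Basis"
  then have "pd u [i] differentiable_on UNIV" by (intro diff) simp_all
  then show "(pd u [i] has_derivative frechet_derivative (pd u [i]) (at x)) (at x)"
    by (simp only: differentiable_on_def frechet_derivative_works UNIV_I)
qed

lemma has_real_derivative_along_line:
  assumes "(f has_derivative f') (at (x + t *\<^sub>R h))"
  shows "((\<lambda>t. f (x + t *\<^sub>R h)) has_real_derivative f' h) (at t)"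
proof -
  have "((\<lambda>t. x + t *\<^sub>R h) has_derivative (\<lambda>s. s *\<^sub>R h)) (at t)"
    by (auto intro!: derivative_eq_intros)
  from has_derivative_compose[OF this assms]
  have "((\<lambda>t. f (x + t *\<^sub>R h)) has_derivative (\<lambda>s. f' (s *\<^sub>R h))) (at t)" .
  moreover have "f' (s *\<^sub>R h) = f' h * s" for s
    using linear_cmul[OF has_derivative_linear[OF assms], of s h] by simp
  ultimately show ?thesis by (simp add: has_field_derivative_def)
qed

lemma C2_fun_line_derivative:
  assumes u: "C2_fun u" and i: "i \<in> Basis"
  shows "((\<lambda>t. u (x + t *\<^sub>R i)) has_real_derivative pd u [i] (x + t *\<^sub>R i)) (at t)"
    and "((\<lambda>t. pd u [i] (x + t *\<^sub>R i)) has_real_derivative pd u [i, i] (x + t *\<^sub>R i)) (at t)"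
  using has_real_derivative_along_line[OF C2_fun_has_derivative(1)[OF u]]
    has_real_derivative_along_line[OF C2_fun_has_derivative(2)[OF u i]]
  by simp_all

lemma C2_fun_continuous:
  assumes "C2_fun u" shows "continuous_on UNIV u"
  using C2_fun_has_derivative(1)[OF assms]
  by (meson differentiableI differentiable_imp_continuous_within continuous_at_imp_continuous_on)

text \<open>With \<open>D < 0\<close> the first derivative, which vanishes at the minimum, would be
  negative just to the right of 0, and the mean value theorem would produce a smaller value of
  \<open>g\<close>.\<close>

lemma second_derivative_nonneg_at_min:
  fixes g :: "real \<Rightarrow> real"
  assumes g: "\<And>t. (g has_real_derivative g' t) (at t)" and g': "(g' has_real_derivative D) (at 0)"
    and e: "e > 0" "\<And>t. \<bar>t\<bar> < e \<Longrightarrow> g 0 \<le> g t"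
  shows "D \<ge> 0"
proof (rule ccontr)
  assume "\<not> ?thesis"
  then have D: "D < 0" by simp
  have g0: "g' 0 = 0" by (rule DERIV_local_min[OF g e(1)]) (use e in auto)
  obtain d where d: "d > 0" "\<And>h. h > 0 \<Longrightarrow> h < d \<Longrightarrow> g' (0 + h) < g' 0"
    using DERIV_neg_dec_right[OF g' D] by auto
  define t where "t = min d e / 2"
  have t: "t > 0" "t < d" "t < e" using d e by (auto simp: t_def)
  obtain s where s: "0 < s" "s < t" "g t - g 0 = (t - 0) * g' s"
    using MVT2[of 0 t g g'] t g by blast
  have "g' s < 0" using d(2)[of s] s t g0 by auto
  then have "t * g' s < 0" using t by (intro mult_pos_neg) auto
  then have "g t < g 0" using s by simp
  then show False using e(2)[of t] t by auto
qed

text \<open>If \<open>v - u\<close> were negative somewhere, subtracting a small multiple of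
  \<open>y \<bullet> y\<close> would give a function with an interior minimum, where the Laplacian
  of \<open>v - u\<close> must be strictly positive.\<close>

lemma laplacian_comparison:
  fixes u v :: "'a::euclidean_space \<Rightarrow> real"
  assumes u: "C2_fun u" and v: "C2_fun v" and le: "\<And>x. laplacian v x \<le> laplacian u x"
    and lim: "((\<lambda>x. v x - u x) \<longlongrightarrow> L) at_infinity" and L: "L \<ge> 0"
  shows "u x \<le> v x"
proof (rule ccontr)
  assume *: "\<not> u x \<le> v x"
  define d where "d = u x - v x"
  have d: "d > 0" using * by (simp add: d_def)
  have "\<forall>\<^sub>F y in at_infinity. v y - u y > - d/4"
    using order_tendstoD(1)[OF lim, of "- d/4"] L d by simp
  then obtain b where b: "\<And>y. norm y \<ge> b \<Longrightarrow> v y - u y > - d/4" by (auto simp: eventually_at_infinity)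
  define R where "R = max b (norm x) + 1"
  have R: "R > 0" "R \<ge> b" "R > norm x" using norm_ge_zero[of x] by (auto simp: R_def max_def simp del: norm_ge_zero)
  \<comment> \<open>On the sphere of radius \<open>R\<close> the perturbation equals
    \<open>d/4\<close>, so there \<open>q\<close> stays above \<open>- d/2\<close>, whereas
    \<open>q x \<le> - d\<close>. The minimum is therefore interior.\<close>
  define e where "e = d / (4 * R\<^sup>2)"
  have e: "e > 0" "e * R\<^sup>2 = d/4" using d R by (auto simp: e_def)
  define q where "q y = v y - u y - e * (y \<bullet> y)" for y
  have "continuous_on (cball 0 R) q" unfolding q_def
    by (intro continuous_intros continuous_on_subset[OF C2_fun_continuous[OF u]] continuous_on_subset[OF C2_fun_continuous[OF v]]) auto
  moreover have "cball 0 R \<noteq> ({} :: 'a set)" using R by auto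
  ultimately obtain z where z: "z \<in> cball 0 R" "\<And>y. y \<in> cball 0 R \<Longrightarrow> q z \<le> q y"
    using continuous_attains_inf[of "cball 0 R" q] by auto
  have "q z \<le> q x" using z R by auto
  also have "q x \<le> - d" using e by (simp add: q_def d_def)
  finally have qz: "q z \<le> - d" .
  have "norm z < R"
  proof (rule ccontr)
    assume "\<not> norm z < R"
    then have nz: "norm z = R" using z by auto
    then have "q z = v z - u z - d/4" using e by (simp add: q_def dot_square_norm)
    then show False using b[of z] nz R qz d by auto
  qed
  have "pd v [i, i] z - pd u [i, i] z - e * 2 \<ge> 0" if i: "i \<in> Basis" for i
  proof (rule second_derivative_nonneg_at_min)
    show "((\<lambda>t. q (z + t *\<^sub>R i)) has_real_derivative
        pd v [i] (z + t *\<^sub>R i) - pd u [i] (z + t *\<^sub>R i) - e * (2 * (z \<bullet> i) + 2 * t)) (at t)" for t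
    proof -
      have "(z + t *\<^sub>R i) \<bullet> (z + t *\<^sub>R i) = z \<bullet> z + 2 * (z \<bullet> i) * t + t\<^sup>2" for t
        using i by (simp add: inner_add_left inner_add_right inner_commute power2_eq_square algebra_simps)
      then have "(\<lambda>t. q (z + t *\<^sub>R i)) = (\<lambda>t. v (z + t *\<^sub>R i) - u (z + t *\<^sub>R i) - e * (z \<bullet> z + 2 * (z \<bullet> i) * t + t\<^sup>2))"
        by (simp add: q_def)
      moreover have "((\<lambda>t. v (z + t *\<^sub>R i) - u (z + t *\<^sub>R i) - e * (z \<bullet> z + 2 * (z \<bullet> i) * t + t\<^sup>2)) has_real_derivative
        pd v [i] (z + t *\<^sub>R i) - pd u [i] (z + t *\<^sub>R i) - e * (2 * (z \<bullet> i) + 2 * t)) (at t)"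
        by (rule DERIV_diff[OF DERIV_diff[OF C2_fun_line_derivative(1)[OF v i] C2_fun_line_derivative(1)[OF u i]]])
           (auto intro!: derivative_eq_intros)
      ultimately show ?thesis by simp
    qed
    have "((\<lambda>t. pd v [i] (z + t *\<^sub>R i) - pd u [i] (z + t *\<^sub>R i) - e * (2 * (z \<bullet> i) + 2 * t)) has_real_derivative
        pd v [i, i] (z + 0 *\<^sub>R i) - pd u [i, i] (z + 0 *\<^sub>R i) - e * 2) (at 0)"
      by (rule DERIV_diff[OF DERIV_diff[OF C2_fun_line_derivative(2)[OF v i] C2_fun_line_derivative(2)[OF u i]]])
         (auto intro!: derivative_eq_intros)
    then show "((\<lambda>t. pd v [i] (z + t *\<^sub>R i) - pd u [i] (z + t *\<^sub>R i) - e * (2 * (z \<bullet> i) + 2 * t)) has_real_derivative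
        pd v [i, i] z - pd u [i, i] z - e * 2) (at 0)" by (simp del: pd.simps)
    show "0 < R - norm z" using \<open>norm z < R\<close> by simp
    fix t :: real assume "\<bar>t\<bar> < R - norm z"
    then have "norm (z + t *\<^sub>R i) \<le> R" using norm_triangle_ineq[of z "t *\<^sub>R i"] i by simp
    then show "q (z + 0 *\<^sub>R i) \<le> q (z + t *\<^sub>R i)" using z(2) by simp
  qed
  then have "(\<Sum>i\<in>(Basis::'a set). e * 2) \<le> (\<Sum>i\<in>Basis. pd v [i, i] z - pd u [i, i] z)"
    by (intro sum_mono) (simp del: pd.simps)
  then have "real DIM('a) * (e * 2) \<le> laplacian v z - laplacian u z"
    by (simp add: laplacian_def sum_subtractf del: pd.simps)
  moreover have "real DIM('a) * (e * 2) > 0" using e by simp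
  ultimately show False using le[of z] by linarith
qed

section \<open>Admissible densities and the normalised potential\<close>

definition C1_fun :: "('a::euclidean_space \<Rightarrow> real) \<Rightarrow> bool" where
  "C1_fun f \<longleftrightarrow> (\<exists>f'. (\<forall>y. (f has_derivative f' y) (at y)) \<and> (\<forall>h. continuous_on UNIV (\<lambda>y. f' y h)))"

definition bdd_integrable :: "('a::euclidean_space \<Rightarrow> real) \<Rightarrow> bool" where
  "bdd_integrable f \<longleftrightarrow> integrable lborel f \<and> (\<exists>C. \<forall>y. \<bar>f y\<bar> \<le> C)"

lemma C1_fun_continuous:
  assumes "C1_fun f" shows "continuous_on UNIV f"
  using assms unfolding C1_fun_def
  by (meson differentiableI differentiable_imp_continuous_within continuous_at_imp_continuous_on)

text \<open>With this exponent the kernel is \<open>norm y\<close> to the power \<open>2 - n\<close>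
  away from the origin; division by \<open>bump_mass\<close> normalises the Laplacian of
  \<open>newton f\<close> to \<open>- f\<close>.\<close>

definition newton :: "('a::euclidean_space \<Rightarrow> real) \<Rightarrow> 'a \<Rightarrow> real" where
  "newton f x = pot ((real DIM('a) - 2) / 2) f x / bump_mass ((real DIM('a) - 2) / 2) TYPE('a)"

context
  fixes T :: "'a::euclidean_space itself"
  assumes dim: "DIM('a) \<ge> 3"
begin

lemma newton_exponent: "(real DIM('a) - 2) / 2 > 0" "2 * ((real DIM('a) - 2) / 2) + 2 = real DIM('a)"
  using dim by (auto simp: field_simps)

lemma mass_pos: "bump_mass ((real DIM('a) - 2) / 2) TYPE('a) > 0"
  by (rule bump_mass_pos[OF newton_exponent])

lemma newton_mono:
  fixes f g :: "'a \<Rightarrow> real"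
  assumes "bdd_integrable f" "bdd_integrable g" "\<And>y. f y \<le> g y"
  shows "newton f x \<le> newton g x"
proof -
  obtain C D where "integrable lborel f" "\<And>y. \<bar>f y\<bar> \<le> C" "integrable lborel g" "\<And>y. \<bar>g y\<bar> \<le> D"
    using assms(1,2) by (auto simp: bdd_integrable_def)
  from pot_mono[OF newton_exponent this assms(3)] show ?thesis
    unfolding newton_def by (rule divide_right_mono) (use mass_pos in simp)
qed

lemma newton_cmult:
  fixes f :: "'a \<Rightarrow> real"
  assumes "bdd_integrable f" shows "newton (\<lambda>y. c * f y) x = c * newton f x"
proof -
  obtain C where "integrable lborel f" "\<And>y. \<bar>f y\<bar> \<le> C"
    using assms by (auto simp: bdd_integrable_def)
  from pot_cmult[OF newton_exponent this] show ?thesis by (simp add: newton_def)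
qed

lemma newton_nonneg:
  fixes f :: "'a \<Rightarrow> real"
  assumes "bdd_integrable f" "\<And>y. f y \<ge> 0" shows "newton f x \<ge> 0"
proof -
  obtain C where "integrable lborel f" "\<And>y. \<bar>f y\<bar> \<le> C"
    using assms(1) by (auto simp: bdd_integrable_def)
  from pot_nonneg[OF newton_exponent this assms(2)] show ?thesis
    unfolding newton_def by (rule divide_nonneg_pos[OF _ mass_pos])
qed

lemma newton_bounded:
  fixes f :: "'a \<Rightarrow> real"
  assumes "bdd_integrable f" shows "\<exists>B>0. \<forall>x. newton f x \<le> B"
proof -
  obtain B where B: "\<And>x. \<bar>pot ((real DIM('a) - 2) / 2) f x\<bar> \<le> B"
    using assms pot_bounded[OF newton_exponent, of f] unfolding bdd_integrable_def by blast
  have "newton f x \<le> (B + 1) / bump_mass ((real DIM('a) - 2) / 2) TYPE('a)" for x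
    unfolding newton_def using B[of x] mass_pos by (intro divide_right_mono) auto
  moreover have "(B + 1) / bump_mass ((real DIM('a) - 2) / 2) TYPE('a) > 0"
    using B[of 0] mass_pos by (intro divide_pos_pos) auto
  ultimately show ?thesis by blast
qed

lemma newton_tendsto_0:
  fixes f :: "'a \<Rightarrow> real"
  assumes "bdd_integrable f" shows "(newton f \<longlongrightarrow> 0) at_infinity"
proof -
  have "(pot ((real DIM('a) - 2) / 2) f \<longlongrightarrow> 0) at_infinity"
    using assms pot_tendsto_0[OF newton_exponent, of f] unfolding bdd_integrable_def by blast
  from tendsto_divide_zero[OF this] show ?thesis by (simp add: newton_def[abs_def])
qed

lemma newton_dominated_LIMSEQ:
  fixes f :: "nat \<Rightarrow> 'a \<Rightarrow> real"
  assumes w: "bdd_integrable w"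
    and f: "\<And>j. f j \<in> borel_measurable borel" "\<And>j y. \<bar>f j y\<bar> \<le> w y" "\<And>y. (\<lambda>j. f j y) \<longlonglongrightarrow> g y"
  shows "(\<lambda>j. newton (f j) x) \<longlonglongrightarrow> newton g x"
proof -
  obtain C where C: "\<And>y. \<bar>w y\<bar> \<le> C" using w by (auto simp: bdd_integrable_def)
  have "(\<lambda>j. pot ((real DIM('a) - 2) / 2) (f j) x) \<longlonglongrightarrow> pot ((real DIM('a) - 2) / 2) g x"
    by (rule pot_dominated_LIMSEQ[OF newton_exponent, of w C]) (use w C f in \<open>auto simp: bdd_integrable_def\<close>)
  then show ?thesis unfolding newton_def by (intro tendsto_intros) (use mass_pos in auto)
qed

lemma newton_C1:
  fixes f :: "'a \<Rightarrow> real"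
  assumes "bdd_integrable f" shows "C1_fun (\<lambda>x. b + newton f x)"
proof -
  obtain C where f: "integrable lborel f" "\<And>y. \<bar>f y\<bar> \<le> C" using assms by (auto simp: bdd_integrable_def)
  let ?M = "bump_mass ((real DIM('a) - 2) / 2) TYPE('a)"
  have "((\<lambda>x. b + newton f x) has_derivative (\<lambda>h. dpot ((real DIM('a) - 2) / 2) f y h / ?M)) (at y)" for y
    unfolding newton_def
    by (rule has_derivative_eq_rhs[OF has_derivative_add[OF has_derivative_const has_derivative_divide'[OF pot_has_derivative[OF newton_exponent f] has_derivative_const]]])
       (use mass_pos in auto)
  moreover have "continuous_on UNIV (\<lambda>y. dpot ((real DIM('a) - 2) / 2) f y h / ?M)" for h
    by (intro continuous_intros continuous_on_dpot[OF newton_exponent f]) (use mass_pos in auto)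
  ultimately show ?thesis unfolding C1_fun_def by (intro exI[of _ "\<lambda>y h. dpot ((real DIM('a) - 2) / 2) f y h / ?M"]) auto
qed

lemma newton_C2:
  fixes f :: "'a \<Rightarrow> real"
  assumes f: "bdd_integrable f" and C1: "C1_fun f"
  shows "C2_fun (\<lambda>x. b + newton f x)" "laplacian (\<lambda>x. b + newton f x) x = - f x"
proof -
  obtain C where f: "integrable lborel f" "\<And>y. \<bar>f y\<bar> \<le> C" using f by (auto simp: bdd_integrable_def)
  obtain f' where f': "\<And>y. (f has_derivative f' y) (at y)" "\<And>h. continuous_on UNIV (\<lambda>y. f' y h)"
    using C1 unfolding C1_fun_def by blast
  let ?M = "bump_mass ((real DIM('a) - 2) / 2) TYPE('a)"
  have 1: "((\<lambda>x. b + newton f x) has_derivative (\<lambda>h. dpot ((real DIM('a) - 2) / 2) f y h / ?M)) (at y)" for y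
    unfolding newton_def
    by (rule has_derivative_eq_rhs[OF has_derivative_add[OF has_derivative_const has_derivative_divide'[OF pot_has_derivative[OF newton_exponent f] has_derivative_const]]])
       (use mass_pos in auto)
  have 2: "((\<lambda>x. dpot ((real DIM('a) - 2) / 2) f x i / ?M) has_derivative (\<lambda>j. ddpot ((real DIM('a) - 2) / 2) f i y j / ?M)) (at y)" for i y
    by (rule has_derivative_eq_rhs[OF has_derivative_divide'[OF dpot_has_derivative[OF newton_exponent f f'] has_derivative_const]])
       (use mass_pos in auto)
  have 3: "continuous_on UNIV (\<lambda>y. ddpot ((real DIM('a) - 2) / 2) f i y j / ?M)" for i j
    by (intro continuous_intros continuous_on_ddpot[OF newton_exponent f f']) (use mass_pos in auto)
  show "C2_fun (\<lambda>x. b + newton f x)" by (rule C2_funI(1)[OF 1 2 3])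
  have "laplacian (\<lambda>x. b + newton f x) x = (\<Sum>i\<in>Basis. ddpot ((real DIM('a) - 2) / 2) f i x i / ?M)"
    by (rule C2_funI(2)[OF 1 2 3])
  also have "\<dots> = (\<Sum>i\<in>Basis. ddpot ((real DIM('a) - 2) / 2) f i x i) / ?M" by (simp add: sum_divide_distrib)
  also have "(\<Sum>i\<in>Basis. ddpot ((real DIM('a) - 2) / 2) f i x i) = - ?M * f x" by (rule ddpot_trace[OF newton_exponent f f'])
  also have "- ?M * f x / ?M = - f x" using mass_pos by simp
  finally show "laplacian (\<lambda>x. b + newton f x) x = - f x" .
qed

text \<open>The constant is chosen before \<open>f\<close> and \<open>a\<close>, so the same one
  serves for every step of the iteration.\<close>

lemma newton_ge_on_ball:
  assumes r: "r > 0"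
  shows "\<exists>c>0. \<forall>(f::'a \<Rightarrow> real) a x. bdd_integrable f \<longrightarrow> (\<forall>y. f y \<ge> 0) \<longrightarrow> a \<ge> 0 \<longrightarrow>
     (\<forall>y\<in>cball x0 r. f y \<ge> a) \<longrightarrow> x \<in> cball x0 r \<longrightarrow> newton f x \<ge> c * a"
proof -
  let ?M = "bump_mass ((real DIM('a) - 2) / 2) TYPE('a)"
  define c where "c = (max 1 (4 * r\<^sup>2) powr (- ((real DIM('a) - 2) / 2)) * (unit_ball_vol (DIM('a)) * r ^ DIM('a)))"
  have "c > 0" using r by (auto simp: c_def intro!: mult_pos_pos)
  then have "c / ?M > 0" using mass_pos by simp
  moreover have "newton f x \<ge> c / ?M * a" if f: "bdd_integrable f" "\<forall>y. f y \<ge> 0" "a \<ge> 0" "\<forall>y\<in>cball x0 r. f y \<ge> a" "x \<in> cball x0 r"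
    for f :: "'a \<Rightarrow> real" and a x
  proof -
    obtain C where "integrable lborel f" "\<And>y. \<bar>f y\<bar> \<le> C" using f by (auto simp: bdd_integrable_def)
    from pot_ge_on_ball[OF newton_exponent this, of r x0 a x] have "pot ((real DIM('a) - 2) / 2) f x \<ge> a * c"
      using f r by (simp add: c_def)
    then have "a * c / ?M \<le> pot ((real DIM('a) - 2) / 2) f x / ?M" using mass_pos by (intro divide_right_mono) auto
    then show ?thesis by (simp add: newton_def mult.commute)
  qed
  ultimately show ?thesis by (intro exI[of _ "c / ?M"]) auto
qed

end

section \<open>Monotone iteration\<close>

locale semilinear =
  fixes K :: "'a::euclidean_space \<Rightarrow> real" and p :: real
  assumes dim: "DIM('a) \<ge> 3"
    and K_nonneg: "\<And>x. K x \<ge> 0"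
    and K_C1: "C1_fun K"
    and K_bdd: "bdd_integrable K"
    and K_nonzero: "\<exists>x. K x \<noteq> 0"
  defines "p \<equiv> real DIM('a) / (real DIM('a) - 2)"
begin

lemma p_gt_1: "p > 1"
  using dim by (simp add: p_def field_simps)

primrec iter :: "real \<Rightarrow> nat \<Rightarrow> 'a \<Rightarrow> real" where
  "iter \<beta> 0 = (\<lambda>x. \<beta>)"
| "iter \<beta> (Suc k) = (\<lambda>x. \<beta> + newton (\<lambda>y. K y * iter \<beta> k y powr p) x)"

lemma K_measurable [measurable]: "K \<in> borel_measurable borel"
  using K_bdd by (auto simp: bdd_integrable_def)

text \<open>The product is dominated by \<open>A powr p * K y\<close>, so it inherits integrability
  and boundedness from \<open>K\<close>.\<close>

lemma bdd_integrable_nonlinearity: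
  assumes u: "u \<in> borel_measurable borel" "\<And>x. 0 \<le> u x" "\<And>x. u x \<le> A"
  shows "bdd_integrable (\<lambda>y. K y * u y powr p)"
proof -
  note [measurable] = u(1)
  obtain C where C: "\<And>y. \<bar>K y\<bar> \<le> C" using K_bdd by (auto simp: bdd_integrable_def)
  have le: "\<bar>K y * u y powr p\<bar> \<le> A powr p * K y" for y
  proof -
    have "u y powr p \<le> A powr p" using u p_gt_1 by (intro powr_mono2) auto
    from mult_left_mono[OF this K_nonneg[of y]] show ?thesis
      using K_nonneg[of y] by (simp add: abs_mult mult.commute)
  qed
  have "integrable lborel (\<lambda>y. A powr p * K y)" using K_bdd by (simp add: bdd_integrable_def)
  then have "integrable lborel (\<lambda>y. K y * u y powr p)"
    by (rule Bochner_Integration.integrable_bound) (use le K_nonneg in \<open>auto simp: abs_mult\<close>)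
  moreover have "\<bar>K y * u y powr p\<bar> \<le> A powr p * C" for y
    using order_trans[OF le mult_left_mono[of "K y" C "A powr p"]] C[of y] by auto
  ultimately show ?thesis by (auto simp: bdd_integrable_def)
qed

text \<open>The chain rule for \<open>powr\<close> is applied at a positive base; for the iterates
  the lower bound \<open>\<beta>\<close> provides it.\<close>

lemma C1_fun_nonlinearity:
  assumes "C1_fun u" and pos: "\<And>x. u x > 0"
  shows "C1_fun (\<lambda>y. K y * u y powr p)"
proof -
  obtain u' where u: "\<And>y. (u has_derivative u' y) (at y)" "\<And>h. continuous_on UNIV (\<lambda>y. u' y h)"
    using assms unfolding C1_fun_def by blast
  obtain K' where K: "\<And>y. (K has_derivative K' y) (at y)" "\<And>h. continuous_on UNIV (\<lambda>y. K' y h)"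
    using K_C1 unfolding C1_fun_def by blast
  note cont = C1_fun_continuous[OF assms(1)] C1_fun_continuous[OF K_C1]
  have 1: "((\<lambda>y. u y powr p) has_derivative (\<lambda>h. u' y h * (p * u y powr (p - 1)))) (at y)" for y
    by (rule DERIV_compose_FDERIV[OF _ u(1)])
       (use has_real_derivative_powr[OF pos[of y], of p] in simp)
  have "((\<lambda>y. K y * u y powr p) has_derivative
      (\<lambda>h. K y * (u' y h * (p * u y powr (p - 1))) + K' y h * u y powr p)) (at y)" for y
    by (rule has_derivative_mult[OF K(1) 1])
  moreover have "continuous_on UNIV (\<lambda>y. K y * (u' y h * (p * u y powr (p - 1))) + K' y h * u y powr p)" for h
    by (intro continuous_intros cont u(2) K(2)) (use pos in \<open>auto simp: less_imp_neq[symmetric]\<close>)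
  ultimately show ?thesis unfolding C1_fun_def
    by (intro exI[of _ "\<lambda>y h. K y * (u' y h * (p * u y powr (p - 1))) + K' y h * u y powr p"]) auto
qed

text \<open>The lower bound \<open>\<beta>\<close> propagates because the potential of a nonnegative
  density is nonnegative. The upper bound may still depend on \<open>k\<close>; its uniformity in
  \<open>k\<close> is the question of solvability.\<close>

lemma iter_props:
  assumes "\<beta> > 0"
  shows "C1_fun (iter \<beta> k) \<and> (\<forall>x. iter \<beta> k x \<ge> \<beta>) \<and> (\<exists>A. \<forall>x. iter \<beta> k x \<le> A)"
proof (induction k)
  case 0
  show ?case unfolding C1_fun_def by (auto intro!: exI[of _ "\<lambda>y h. 0"])
next
  case (Suc k)
  then obtain A where A: "\<And>x. iter \<beta> k x \<le> A" by blast
  have ge: "iter \<beta> k x \<ge> \<beta>" for x using Suc by blast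
  then have nn: "iter \<beta> k x \<ge> 0" for x using assms by (meson less_imp_le order_trans)
  have m: "iter \<beta> k \<in> borel_measurable borel"
    using Suc C1_fun_continuous borel_measurable_continuous_onI by blast
  have b: "bdd_integrable (\<lambda>y. K y * iter \<beta> k y powr p)"
    by (rule bdd_integrable_nonlinearity[OF m nn A])
  obtain B where B: "\<And>x. newton (\<lambda>y. K y * iter \<beta> k y powr p) x \<le> B"
    using newton_bounded[OF dim b] by blast
  have "newton (\<lambda>y. K y * iter \<beta> k y powr p) x \<ge> 0" for x
    by (rule newton_nonneg[OF dim b]) (use K_nonneg in auto)
  then show ?case using newton_C1[OF dim b, of \<beta>] B by (auto intro!: exI[of _ "\<beta> + B"])
qed

lemma iter_nonlinearity:
  assumes "\<beta> > 0"
  shows "bdd_integrable (\<lambda>y. K y * iter \<beta> k y powr p)" "C1_fun (\<lambda>y. K y * iter \<beta> k y powr p)"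
    "iter \<beta> k \<in> borel_measurable borel" "iter \<beta> k x > 0"
proof -
  obtain A where A: "\<And>x. iter \<beta> k x \<le> A" using iter_props[OF assms] by blast
  have ge: "iter \<beta> k x \<ge> \<beta>" for x using iter_props[OF assms] by blast
  then show pos: "iter \<beta> k x > 0" for x using assms by (meson less_le_trans)
  show m: "iter \<beta> k \<in> borel_measurable borel"
    using iter_props[OF assms] C1_fun_continuous borel_measurable_continuous_onI by blast
  show "bdd_integrable (\<lambda>y. K y * iter \<beta> k y powr p)"
    by (rule bdd_integrable_nonlinearity[OF m less_imp_le[OF pos] A])
  show "C1_fun (\<lambda>y. K y * iter \<beta> k y powr p)"
    by (rule C1_fun_nonlinearity[OF _ pos]) (use iter_props[OF assms] in blast)
qed

lemma newton_nonlinearity_mono: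
  assumes "bdd_integrable (\<lambda>y. K y * u y powr p)" "bdd_integrable (\<lambda>y. K y * v y powr p)"
    and "\<And>y. 0 \<le> u y" "\<And>y. u y \<le> v y"
  shows "newton (\<lambda>y. K y * u y powr p) x \<le> newton (\<lambda>y. K y * v y powr p) x"
  by (rule newton_mono[OF dim assms(1,2)])
     (use assms(3,4) p_gt_1 K_nonneg in \<open>auto intro!: mult_left_mono powr_mono2\<close>)

lemma iter_mono:
  assumes "\<beta> > 0" shows "iter \<beta> k x \<le> iter \<beta> (Suc k) x"
proof (induction k arbitrary: x)
  case 0
  show ?case using iter_props[OF assms, of "Suc 0"] by simp
next
  case (Suc k)
  have "newton (\<lambda>y. K y * iter \<beta> k y powr p) x \<le> newton (\<lambda>y. K y * iter \<beta> (Suc k) y powr p) x"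
    by (rule newton_nonlinearity_mono[OF iter_nonlinearity(1)[OF assms] iter_nonlinearity(1)[OF assms] less_imp_le[OF iter_nonlinearity(4)[OF assms]] Suc])
  then show ?case by simp
qed

lemma iter_Suc_C2:
  assumes "\<beta> > 0"
  shows "C2_fun (iter \<beta> (Suc k))" "laplacian (iter \<beta> (Suc k)) x = - (K x * iter \<beta> k x powr p)"
  using newton_C2[OF dim iter_nonlinearity(1,2)[OF assms]] by simp_all

lemma iter_Suc_tendsto:
  assumes "\<beta> > 0" shows "(iter \<beta> (Suc k) \<longlongrightarrow> \<beta>) at_infinity"
  using tendsto_add[OF tendsto_const newton_tendsto_0[OF dim iter_nonlinearity(1)[OF assms]], of \<beta>] by simp

text \<open>If \<open>iter \<beta> k\<close> lies below \<open>v\<close>, then its density lies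
  below that of \<open>v\<close>, and the linear comparison applies to the next iterate. Allowing
  \<open>\<beta> \<le> \<beta>'\<close> makes solvability pass to smaller limits.\<close>

lemma iter_le_solution:
  assumes \<beta>: "0 < \<beta>" "\<beta> \<le> \<beta>'" and v: "is_solution K \<beta>' v"
  shows "iter \<beta> k x \<le> v x"
proof (induction k arbitrary: x)
  have C2: "C2_fun v" and lim: "(v \<longlongrightarrow> \<beta>') at_infinity"
    and eq: "\<And>x. laplacian v x = - (K x * v x powr p)"
    using v unfolding is_solution_def p_def by (auto simp: eq_neg_iff_add_eq_0)
  {
    case 0
    have c: "C2_fun (\<lambda>x::'a. \<beta>)" "laplacian (\<lambda>x::'a. \<beta>) y = 0" for y
      using C2_funI[of "\<lambda>x::'a. \<beta>" "\<lambda>_ _. 0" "\<lambda>_ _ _. 0"] by auto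
    have "((\<lambda>x. v x - \<beta>) \<longlongrightarrow> \<beta>' - \<beta>) at_infinity" by (intro tendsto_intros lim)
    then show ?case
      using laplacian_comparison[OF c(1) C2, of "\<beta>' - \<beta>" x] \<beta> eq K_nonneg c(2) by simp
  next
    case (Suc k)
    have "((\<lambda>x. v x - iter \<beta> (Suc k) x) \<longlongrightarrow> \<beta>' - \<beta>) at_infinity"
      by (intro tendsto_diff lim iter_Suc_tendsto \<beta>)
    moreover have "laplacian v y \<le> laplacian (iter \<beta> (Suc k)) y" for y
      unfolding eq iter_Suc_C2(2)[OF \<beta>(1)]
      using Suc K_nonneg[of y] less_imp_le[OF iter_nonlinearity(4)[OF \<beta>(1), of k y]] p_gt_1
      by (auto intro!: mult_left_mono powr_mono2)
    ultimately show ?case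
      using laplacian_comparison[OF iter_Suc_C2(1)[OF \<beta>(1)] C2] \<beta> by simp
  }
qed

text \<open>The monotone limits exist pointwise, and the iteration passes to the limit because
  \<open>K y * u y powr p\<close> itself dominates. Regularity is then read off from the fixed point
  equation.\<close>

lemma solution_of_bounded_iter:
  assumes \<beta>: "\<beta> > 0" and A: "\<And>k x. iter \<beta> k x \<le> A"
  shows "\<exists>u. is_solution K \<beta> u \<and> (\<forall>x. (\<lambda>k. iter \<beta> k x) \<longlonglongrightarrow> u x)"
proof -
  have "\<exists>l. (\<lambda>k. iter \<beta> k x) \<longlonglongrightarrow> l" for x
  proof -
    have "incseq (\<lambda>k. iter \<beta> k x)" by (rule incseq_SucI) (rule iter_mono[OF \<beta>])
    then obtain l where "(\<lambda>k. iter \<beta> k x) \<longlonglongrightarrow> l"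
      by (rule incseq_convergent[of _ A]) (use A in auto)
    then show ?thesis ..
  qed
  then obtain u where u: "\<And>x. (\<lambda>k. iter \<beta> k x) \<longlonglongrightarrow> u x" by metis
  have uA: "u x \<le> A" for x by (rule LIMSEQ_le_const2[OF u]) (use A in auto)
  have ge: "u x \<ge> \<beta>" for x by (rule LIMSEQ_le_const[OF u]) (use iter_props[OF \<beta>] in auto)
  have pos: "u x > 0" for x using ge[of x] \<beta> by linarith
  have um: "u \<in> borel_measurable borel"
    by (rule borel_measurable_LIMSEQ_real[OF u iter_nonlinearity(3)[OF \<beta>]])
  have b: "bdd_integrable (\<lambda>y. K y * u y powr p)"
    by (rule bdd_integrable_nonlinearity[OF um less_imp_le[OF pos] uA])
  have "(\<lambda>k. newton (\<lambda>y. K y * iter \<beta> k y powr p) x) \<longlonglongrightarrow> newton (\<lambda>y. K y * u y powr p) x" for x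
  proof (rule newton_dominated_LIMSEQ[OF dim b])
    show "(\<lambda>y. K y * iter \<beta> k y powr p) \<in> borel_measurable borel" for k
      using iter_nonlinearity(3)[OF \<beta>, of k, measurable] by measurable
    show "(\<lambda>k. K y * iter \<beta> k y powr p) \<longlonglongrightarrow> K y * u y powr p" for y
      by (intro tendsto_intros u) (use pos[of y] in auto)
    fix k y
    have "iter \<beta> k y \<le> u y"
      by (rule incseq_le[OF incseq_SucI u]) (rule iter_mono[OF \<beta>])
    then have "iter \<beta> k y powr p \<le> u y powr p"
      using iter_nonlinearity(4)[OF \<beta>, of k y] p_gt_1 by (intro powr_mono2) auto
    then show "\<bar>K y * iter \<beta> k y powr p\<bar> \<le> K y * u y powr p"
      using K_nonneg[of y] by (simp add: abs_mult mult_left_mono)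
  qed
  then have lim: "(\<lambda>k. iter \<beta> (Suc k) x) \<longlonglongrightarrow> \<beta> + newton (\<lambda>y. K y * u y powr p) x" for x
    by (simp add: tendsto_add)
  have fp: "u = (\<lambda>x. \<beta> + newton (\<lambda>y. K y * u y powr p) x)"
    using LIMSEQ_unique[OF LIMSEQ_Suc[OF u] lim] by blast
  \<comment> \<open>Bootstrap: a bounded integrable density makes \<open>u\<close> continuously
    differentiable, hence the density as well, hence \<open>u\<close> twice.\<close>
  have C1: "C1_fun u" using newton_C1[OF dim b, of \<beta>] fp by simp
  have C1': "C1_fun (\<lambda>y. K y * u y powr p)" by (rule C1_fun_nonlinearity[OF C1 pos])
  have "C2_fun u" "laplacian u x = - (K x * u x powr p)" for x
    using newton_C2[OF dim b C1', of \<beta>] fp by simp_all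
  moreover have "(u \<longlongrightarrow> \<beta>) at_infinity"
    using tendsto_add[OF tendsto_const newton_tendsto_0[OF dim b], of \<beta>] fp by simp
  ultimately have "is_solution K \<beta> u"
    unfolding is_solution_def p_def using less_imp_le[OF pos] by simp
  with u show ?thesis by blast
qed

lemma iter_bounded_small: "\<exists>\<beta>>0. \<forall>k x. iter \<beta> k x \<le> 2 * \<beta>"
proof -
  obtain B where B: "B > 0" "\<And>x. newton K x \<le> B" using newton_bounded[OF dim K_bdd] by blast
  \<comment> \<open>The solution of \<open>(2 * \<beta>) powr p * B = \<beta>\<close>, which makes
    the bound \<open>2 * \<beta>\<close> reproduce itself.\<close>
  define \<beta> where "\<beta> = (1 / (2 powr p * B)) powr (1 / (p - 1))"
  have \<beta>: "\<beta> > 0" using B by (simp add: \<beta>_def)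
  have "\<beta> powr (p - 1) = 1 / (2 powr p * B)" using p_gt_1 B by (simp add: \<beta>_def powr_powr)
  moreover have "(2 * \<beta>) powr p * B = \<beta> * ((2 powr p * B) * \<beta> powr (p - 1))"
    using \<beta> powr_mult_base[of \<beta> "p - 1"] by (simp add: powr_mult)
  ultimately have eq: "(2 * \<beta>) powr p * B = \<beta>" using B by simp
  have "iter \<beta> k x \<le> 2 * \<beta>" for k x
  proof (induction k arbitrary: x)
    case (Suc k)
    have le: "K y * iter \<beta> k y powr p \<le> (2 * \<beta>) powr p * K y" for y
      using Suc[of y] iter_nonlinearity(4)[OF \<beta>, of k y] K_nonneg[of y] p_gt_1
      by (subst mult.commute) (auto intro!: mult_right_mono powr_mono2)
    have "bdd_integrable (\<lambda>y. K y * (2 * \<beta>) powr p)"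
      by (rule bdd_integrable_nonlinearity[where A = "2 * \<beta>"]) (use \<beta> in auto)
    then have "bdd_integrable (\<lambda>y. (2 * \<beta>) powr p * K y)" by (simp add: mult.commute)
    from newton_mono[OF dim iter_nonlinearity(1)[OF \<beta>] this le]
    have "newton (\<lambda>y. K y * iter \<beta> k y powr p) x \<le> (2 * \<beta>) powr p * newton K x"
      using newton_cmult[OF dim K_bdd] by simp
    also have "\<dots> \<le> (2 * \<beta>) powr p * B" using B by (intro mult_left_mono) auto
    finally show ?case using eq by simp
  qed (use \<beta> in auto)
  with \<beta> show ?thesis by blast
qed

lemma iter_unbounded_large: "\<exists>b>0. \<forall>\<beta>\<ge>b. \<forall>A. \<exists>k x. iter \<beta> k x > A"
proof -
  obtain x0 where x0: "K x0 > 0" using K_nonzero K_nonneg by (metis less_eq_real_def)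
  have "isCont K x0" using C1_fun_continuous[OF K_C1] by (simp add: continuous_on_eq_continuous_at)
  then obtain d where d: "d > 0" "\<And>y. dist y x0 < d \<Longrightarrow> dist (K y) (K x0) < K x0 / 2"
    unfolding continuous_at using x0 by (metis half_gt_zero continuous_at continuous_at_eps_delta)
  define a where "a = K x0 / 2"
  define r where "r = d / 2"
  have r: "r > 0" and a: "a > 0" using d x0 by (auto simp: r_def a_def)
  have Ka: "K y \<ge> a" if "y \<in> cball x0 r" for y
  proof -
    have "dist y x0 < d" using that d by (simp add: r_def dist_commute)
    from d(2)[OF this] have "\<bar>K y - K x0\<bar> < K x0 / 2" by (simp only: dist_real_def)
    then show ?thesis unfolding a_def by linarith
  qed
  obtain c where c: "c > 0" "\<And>(f::'a \<Rightarrow> real) a x. bdd_integrable f \<Longrightarrow> (\<forall>y. f y \<ge> 0) \<Longrightarrow> a \<ge> 0 \<Longrightarrow>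
     (\<forall>y\<in>cball x0 r. f y \<ge> a) \<Longrightarrow> x \<in> cball x0 r \<Longrightarrow> newton f x \<ge> c * a"
    using newton_ge_on_ball[OF dim r, of x0] by blast
  \<comment> \<open>The solution of \<open>c * a * b powr (p - 1) = 2\<close>: for
    \<open>t \<ge> b\<close>, a lower bound \<open>t\<close> on the ball becomes at least
    \<open>c * a * t powr p \<ge> 2 * t\<close> after one step.\<close>
  define b where "b = (2 / (c * a)) powr (1 / (p - 1))"
  have b: "b > 0" using c a by (simp add: b_def)
  have bp: "b powr (p - 1) = 2 / (c * a)" using p_gt_1 c a by (simp add: b_def powr_powr)
  have grow: "iter \<beta> k x \<ge> 2 ^ k * \<beta>" if \<beta>: "\<beta> \<ge> b" and "x \<in> cball x0 r" for \<beta> k x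
    using \<open>x \<in> cball x0 r\<close>
  proof (induction k arbitrary: x)
    case (Suc k)
    let ?t = "2 ^ k * \<beta>"
    have \<beta>0: "\<beta> > 0" using \<beta> b by linarith
    have "1 * \<beta> \<le> ?t" using \<beta>0 by (intro mult_right_mono) auto
    then have t: "?t > 0" "?t \<ge> b"
      using \<beta>0 order_trans[OF \<beta>] unfolding mult_1_left by auto
    have "a * ?t powr p \<le> K y * iter \<beta> k y powr p" if "y \<in> cball x0 r" for y
      using Ka[OF that] Suc.IH[OF that] t a p_gt_1 K_nonneg[of y] by (intro mult_mono powr_mono2) auto
    then have "c * (a * ?t powr p) \<le> newton (\<lambda>y. K y * iter \<beta> k y powr p) x"
      using Suc.prems a K_nonneg by (intro c(2) iter_nonlinearity(1) \<beta>0) auto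
    moreover have "2 * ?t \<le> c * (a * ?t powr p)"
    proof -
      have "b powr (p - 1) \<le> ?t powr (p - 1)" using t b p_gt_1 by (intro powr_mono2) auto
      then have "c * a * (2 / (c * a)) \<le> c * a * ?t powr (p - 1)"
        unfolding bp using c a by (intro mult_left_mono) auto
      then have "2 \<le> c * a * ?t powr (p - 1)" using c a by simp
      then have "2 * ?t \<le> c * a * ?t powr (p - 1) * ?t" using t by (intro mult_right_mono) auto
      also have "\<dots> = c * (a * ?t powr p)" using powr_mult_base[of ?t "p - 1"] t by (simp add: ac_simps)
      finally show ?thesis .
    qed
    ultimately show ?case using \<beta>0 by (simp add: ac_simps)
  qed simp
  have "\<exists>k x. iter \<beta> k x > A" if \<beta>: "\<beta> \<ge> b" for \<beta> A
  proof -
    have \<beta>0: "\<beta> > 0" using \<beta> b by linarith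
    obtain k where "A / \<beta> < 2 ^ k" using real_arch_pow[of 2 "A / \<beta>"] by auto
    then have "A < 2 ^ k * \<beta>" using \<beta>0 by (simp add: field_simps)
    also have "\<dots> \<le> iter \<beta> k x0" using grow[OF \<beta>, of x0 k] r by simp
    finally show ?thesis by blast
  qed
  with b show ?thesis by blast
qed

text \<open>Replaces continuity of the iterates in \<open>\<beta>\<close> when \<open>\<beta>\<close> tends to the critical value from below.\<close>

lemma iter_scale:
  assumes \<beta>: "\<beta> > 0" and t: "0 < t" "t \<le> 1"
  shows "t powr (p ^ k) * iter \<beta> k x \<le> iter (t * \<beta>) k x"
proof (induction k arbitrary: x)
  case (Suc k)
  have t\<beta>: "t * \<beta> > 0" using t \<beta> by simp
  let ?s = "t powr (p ^ Suc k)"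
  have "1 \<le> p ^ Suc k" using p_gt_1 by (intro one_le_power) auto
  \<comment> \<open>The scaling factor does not exceed \<open>t\<close>, which settles the constant
    term \<open>\<beta>\<close> of the iteration.\<close>
  then have s: "?s \<le> t" using powr_mono'[of 1 "p ^ Suc k" t] t by simp
  have le: "?s * (K y * iter \<beta> k y powr p) \<le> K y * iter (t * \<beta>) k y powr p" for y
  proof -
    have "(t powr (p ^ k) * iter \<beta> k y) powr p \<le> iter (t * \<beta>) k y powr p"
      using Suc[of y] iter_nonlinearity(4)[OF \<beta>, of k y] p_gt_1 by (intro powr_mono2) auto
    moreover have "(t powr (p ^ k) * iter \<beta> k y) powr p = ?s * iter \<beta> k y powr p"
      using iter_nonlinearity(4)[OF \<beta>, of k y] by (simp add: powr_mult powr_powr mult.commute)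
    ultimately have "K y * (?s * iter \<beta> k y powr p) \<le> K y * iter (t * \<beta>) k y powr p"
      using K_nonneg[of y] by (intro mult_left_mono) auto
    then show ?thesis by (simp add: ac_simps)
  qed
  have b: "bdd_integrable (\<lambda>y. ?s * (K y * iter \<beta> k y powr p))"
  proof -
    obtain C where "\<And>y. \<bar>K y * iter \<beta> k y powr p\<bar> \<le> C"
      using iter_nonlinearity(1)[OF \<beta>, of k] by (auto simp: bdd_integrable_def)
    then have "\<bar>?s * (K y * iter \<beta> k y powr p)\<bar> \<le> ?s * C" for y
      by (subst abs_mult) (simp add: mult_left_mono)
    then show ?thesis using iter_nonlinearity(1)[OF \<beta>, of k]
      unfolding bdd_integrable_def by (intro conjI exI[of _ "?s * C"]) auto
  qed
  have "?s * newton (\<lambda>y. K y * iter \<beta> k y powr p) x \<le> newton (\<lambda>y. K y * iter (t * \<beta>) k y powr p) x"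
    using newton_mono[OF dim b iter_nonlinearity(1)[OF t\<beta>] le]
    by (simp only: newton_cmult[OF dim iter_nonlinearity(1)[OF \<beta>]])
  moreover have "?s * \<beta> \<le> t * \<beta>" using s \<beta> by (intro mult_right_mono) auto
  ultimately show ?case by (simp add: distrib_left del: power_Suc)
qed (use t in simp)

end

section \<open>A priori bound for radial solutions\<close>

text \<open>The derivative is asked for in the open interval only: the flux is differentiated at
  \<open>r > 0\<close>, and at \<open>r = 0\<close> continuity takes over.\<close>

lemma DERIV_nonneg_mono_right:
  fixes f :: "real \<Rightarrow> real"
  assumes "a \<le> b" "continuous_on {a..b} f" "\<And>x. a < x \<Longrightarrow> x < b \<Longrightarrow> (f has_real_derivative f' x) (at x)"
    "\<And>x. a < x \<Longrightarrow> x < b \<Longrightarrow> f' x \<ge> 0"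
  shows "f a \<le> f b"
  by (rule DERIV_nonneg_imp_increasing_open[OF assms(1) _ assms(2)]) (use assms(3,4) in blast)

text \<open>The flux form of the radial equation along a coordinate axis: \<open>g\<close> and
  \<open>\<kappa>\<close> stand for the solution and for \<open>K\<close> at
  \<open>r *\<^sub>R e\<close>. Being restrictions to a full line, they live on negative
  \<open>r\<close> as well.\<close>

definition radial_profile ::
  "nat \<Rightarrow> real \<Rightarrow> real \<Rightarrow> real \<Rightarrow> real \<Rightarrow> (real \<Rightarrow> real) \<Rightarrow> (real \<Rightarrow> real) \<Rightarrow> (real \<Rightarrow> real) \<Rightarrow> bool" where
  "radial_profile n p R c C g g' \<kappa> \<longleftrightarrow>
     (\<forall>r. (g has_real_derivative g' r) (at r)) \<and> (\<forall>r. g r \<ge> 0) \<and>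
     (\<forall>r>0. ((\<lambda>r. - (r ^ (n - 1) * g' r)) has_real_derivative r ^ (n - 1) * (\<kappa> r * g r powr p)) (at r)) \<and>
     continuous_on UNIV g' \<and> (\<forall>r. 0 \<le> \<kappa> r \<and> \<kappa> r \<le> C) \<and> (\<forall>r. 0 \<le> r \<and> r \<le> R \<longrightarrow> c \<le> \<kappa> r)"

text \<open>The flux \<open>M r = - r ^ (n - 1) * g' r\<close> satisfies \<open>M' \<ge> c1 * M powr p / r\<close>, so \<open>M powr (1 - p)\<close>
  decreases at least logarithmically in \<open>r\<close>.  If \<open>g 0 = e powr (2 - n)\<close>, the equation rescaled by \<open>e\<close> shows that \<open>M\<close> has
  a fixed size \<open>m0\<close> already at a radius comparable to \<open>e\<close>; hence \<open>e\<close> cannot be small.\<close>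

lemma radial_ode_bound:
  fixes n :: nat and R c C p :: real
  assumes n: "n \<ge> 3" and R: "R > 0" and c: "c > 0" and C: "C > 0" and p: "p = real n / (real n - 2)"
  shows "\<exists>A. \<forall>g g' \<kappa> r. radial_profile n p R c C g g' \<kappa> \<longrightarrow> r \<ge> 0 \<longrightarrow> g r \<le> A"
proof -
  define N where "N = real n"
  have N: "N \<ge> 3" using n by (simp add: N_def)
  have p1: "p > 1" using N by (simp add: p N_def[symmetric] field_simps)
  \<comment> \<open>The borderline identity, behind the normalisation \<open>en\<close> and the
    factor \<open>1 / r\<close> in \<open>MM\<close>.\<close>
  have pN: "(N - 2) * p = N" using N by (simp add: p N_def[symmetric])
  have p_eq: "p - 1 = 2 / (N - 2)" using N by (simp add: p N_def[symmetric] field_simps)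
  \<comment> \<open>With \<open>C / N * r0\<^sup>2 = 1\<close>, the profile loses at most half of
    its central value up to the radius \<open>r1 = r0 * e\<close>.\<close>
  define r0 where "r0 = sqrt (N / C)"
  have r0: "r0 > 0" "r0\<^sup>2 = N / C" using N C by (auto simp: r0_def)
  \<comment> \<open>The lower bound for the flux at \<open>r1\<close> that remains once
    \<open>a powr p * e ^ n = 1\<close> has removed the scale.\<close>
  define m0 where "m0 = c * (1/2) powr p * r0 ^ n / N"
  have m0: "m0 > 0" using c r0 N by (simp add: m0_def)
  \<comment> \<open>The factor \<open>(1/2) ^ (n - 1)\<close> is the loss in comparing the radii
    \<open>r\<close> and \<open>2 * r\<close> in \<open>gM\<close>.\<close>
  define c1 where "c1 = c * ((1/2) ^ (n - 1)) powr p"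
  have c1: "c1 > 0" using c by (simp add: c1_def)
  \<comment> \<open>A lower bound for \<open>ln r1\<close>, obtained by integrating the flux
    inequality from \<open>r1\<close> to \<open>R/2\<close> and discarding the flux term at
    \<open>R/2\<close>.\<close>
  define L where "L = ln (R/2) - m0 powr (1 - p) / ((p - 1) * c1)"
  \<comment> \<open>The first entry covers the case \<open>r1 \<ge> R/2\<close>, the second one the
    case \<open>r1 < R/2\<close>.\<close>
  define e0 where "e0 = min (R / (2 * r0)) (exp L / r0)"
  have e0: "e0 > 0" using R r0 by (simp add: e0_def)
  have "g s \<le> e0 powr (- (N - 2))"
    if prof: "radial_profile n p R c C g g' \<kappa>" and s: "s \<ge> 0" for g g' \<kappa> s
  proof -
    have g: "\<And>r. (g has_real_derivative g' r) (at r)" and gnn: "\<And>r. g r \<ge> 0"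
      and M': "\<And>r. r > 0 \<Longrightarrow> ((\<lambda>r. - (r ^ (n - 1) * g' r)) has_real_derivative r ^ (n - 1) * (\<kappa> r * g r powr p)) (at r)"
      and cont: "continuous_on UNIV g'" and \<kappa>: "\<And>r. 0 \<le> \<kappa> r" "\<And>r. \<kappa> r \<le> C"
      and \<kappa>c: "\<And>r. 0 \<le> r \<Longrightarrow> r \<le> R \<Longrightarrow> c \<le> \<kappa> r"
      using prof unfolding radial_profile_def by blast+
    define M where "M r = - (r ^ (n - 1) * g' r)" for r
    have M0: "M 0 = 0" using n by (simp add: M_def power_0_left)
    have contM: "continuous_on S M" for S
      unfolding M_def[abs_def] by (intro continuous_intros continuous_on_subset[OF cont]) auto
    have contg: "continuous_on S g" for S
      using g DERIV_continuous_on has_field_derivative_at_within by blast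
    have Md: "(M has_real_derivative r ^ (n - 1) * (\<kappa> r * g r powr p)) (at r)" if "r > 0" for r
      using M'[OF that] by (simp add: M_def[abs_def])
    have Mmono: "M a \<le> M b" if "0 \<le> a" "a \<le> b" for a b
      by (rule DERIV_nonneg_mono_right[OF that(2) contM Md]) (use that \<kappa> in auto)
    have Mnn: "M r \<ge> 0" if "r \<ge> 0" for r using Mmono[of 0 r] that M0 by simp
    have g'_eq: "g' r = - (M r / r ^ (n - 1))" if "r > 0" for r using that by (simp add: M_def)
    have gdec: "g b \<le> g a" if "0 \<le> a" "a \<le> b" for a b
    proof -
      have "- g a \<le> - g b"
      proof (rule DERIV_nonneg_mono_right[OF that(2)])
        show "continuous_on {a..b} (\<lambda>r. - g r)" by (intro continuous_intros contg)
        show "((\<lambda>r. - g r) has_real_derivative - g' r) (at r)" for r by (intro DERIV_minus g)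
        show "- g' r \<ge> 0" if "a < r" for r using g'_eq[of r] Mnn[of r] that \<open>0 \<le> a\<close> by simp
      qed
      then show ?thesis by simp
    qed
    define a where "a = g 0"
    show ?thesis
    proof (cases "a > 0")
      case False
      then have "g s \<le> 0" using gdec[of 0 s] s by (simp add: a_def)
      then show ?thesis by (meson order_trans powr_ge_zero)
    next
      case a: True
      define e where "e = a powr (- 1 / (N - 2))"
      have e: "e > 0" using a by (simp add: e_def)
      have "(- 1 / (N - 2)) * (- (N - 2)) = 1" using N by (simp add: field_simps)
      then have ae: "a = e powr (- (N - 2))" unfolding e_def powr_powr using a by simp
      \<comment> \<open>Two normalisations: \<open>e2\<close> makes the drop of \<open>g\<close> up
        to \<open>r1\<close> at most a fixed fraction of \<open>a\<close>, and \<open>en\<close>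
        makes the lower bound for the flux at \<open>r1\<close> independent of
        \<open>a\<close>.\<close>
      have e2: "a powr p * e\<^sup>2 = a"
      proof -
        have "e\<^sup>2 = a powr (1 - p)" using a p_eq by (simp add: e_def powr_powr field_simps flip: powr_numeral)
        then show ?thesis using a by (simp flip: powr_add)
      qed
      have en: "a powr p * e ^ n = 1"
      proof -
        have "e ^ n = e powr N" using e by (simp add: N_def powr_realpow)
        moreover have "- (N - 2) * p + N = 0" using pN by (simp add: algebra_simps)
        ultimately show ?thesis using e unfolding ae powr_powr by (simp flip: powr_add)
      qed
      define r1 where "r1 = r0 * e"
      have r1: "r1 > 0" using r0 e by (simp add: r1_def)
      have n1: "r ^ n = r ^ (n - 1) * r" for r :: real using n by (simp flip: power_Suc2)
      have "e \<ge> e0"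
      proof (cases "r1 < R/2")
        case False
        then have "e \<ge> R / (2 * r0)" using r0 by (simp add: r1_def field_simps)
        then show ?thesis by (simp add: e0_def)
      next
        case r1R: True
        have dpow: "((\<lambda>r. r ^ n / N) has_real_derivative r ^ (n - 1)) (at r)" for r
          using n by (auto intro!: derivative_eq_intros simp: N_def)
        \<comment> \<open>As \<open>g\<close> never exceeds its central value \<open>a\<close>, the
          flux grows at most like that of a constant density.\<close>
        have Mup: "M r \<le> C * a powr p * (r ^ n / N)" if r: "r \<ge> 0" for r
        proof -
          have "C * a powr p * (0 ^ n / N) - M 0 \<le> C * a powr p * (r ^ n / N) - M r"
          proof (rule DERIV_nonneg_mono_right[OF r])
            show "continuous_on {0..r} (\<lambda>r. C * a powr p * (r ^ n / N) - M r)"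
              using N by (intro continuous_intros contM) auto
            show "((\<lambda>r. C * a powr p * (r ^ n / N) - M r) has_real_derivative
                C * a powr p * t ^ (n - 1) - t ^ (n - 1) * (\<kappa> t * g t powr p)) (at t)" if "0 < t" for t
              by (intro DERIV_diff DERIV_cmult dpow Md that)
            show "0 \<le> C * a powr p * t ^ (n - 1) - t ^ (n - 1) * (\<kappa> t * g t powr p)" if "0 < t" for t
            proof -
              have "g t powr p \<le> a powr p"
                using gdec[of 0 t] gnn[of t] that p1 by (intro powr_mono2) (auto simp: a_def)
              then have "\<kappa> t * g t powr p \<le> C * a powr p" using \<kappa> C by (intro mult_mono) auto
              then have "t ^ (n - 1) * (\<kappa> t * g t powr p) \<le> t ^ (n - 1) * (C * a powr p)"
                using that by (intro mult_left_mono) auto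
              then show ?thesis by (simp add: ac_simps)
            qed
          qed
          then show ?thesis using M0 n by (simp add: power_0_left)
        qed
        \<comment> \<open>Dividing the flux bound by \<open>t ^ (n - 1)\<close> bounds the slope
          linearly in \<open>t\<close>; integration gives a quadratic loss, at most
          \<open>a / 2\<close> at \<open>r1\<close>.\<close>
        have glow: "g r \<ge> a / 2" if r: "0 \<le> r" "r \<le> r1" for r
        proof -
          have "g 0 + C * a powr p / N * (0\<^sup>2 / 2) \<le> g r + C * a powr p / N * (r\<^sup>2 / 2)"
          proof (rule DERIV_nonneg_mono_right[OF r(1)])
            show "continuous_on {0..r} (\<lambda>r. g r + C * a powr p / N * (r\<^sup>2 / 2))"
              by (intro continuous_intros contg) auto
            show "((\<lambda>r. g r + C * a powr p / N * (r\<^sup>2 / 2)) has_real_derivative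
                g' t + C * a powr p / N * t) (at t)" for t
              by (intro DERIV_add g DERIV_cmult) (auto intro!: derivative_eq_intros)
            show "0 \<le> g' t + C * a powr p / N * t" if "0 < t" for t
            proof -
              have "M t / t ^ (n - 1) \<le> C * a powr p * (t ^ n / N) / t ^ (n - 1)"
                using Mup[of t] that by (intro divide_right_mono) auto
              also have "\<dots> = C * a powr p / N * t" using that unfolding n1 by simp
              finally show ?thesis using g'_eq[OF that] by simp
            qed
          qed
          then have "a \<le> g r + C * a powr p / N * (r\<^sup>2 / 2)" by (simp add: a_def)
          also have "C * a powr p / N * (r\<^sup>2 / 2) \<le> C * a powr p / N * (r1\<^sup>2 / 2)"
            using r C N by (intro mult_left_mono divide_right_mono power_mono) auto
          also have "C * a powr p / N * (r1\<^sup>2 / 2) = (a powr p * e\<^sup>2) * (C / N * r0\<^sup>2) / 2"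
            by (simp add: r1_def power_mult_distrib)
          also have "\<dots> = a / 2" unfolding e2 r0(2) using C N by simp
          finally show ?thesis by simp
        qed
        have Mlow: "M r1 \<ge> m0"
        proof -
          have "M 0 - c * (a/2) powr p * (0 ^ n / N) \<le> M r1 - c * (a/2) powr p * (r1 ^ n / N)"
          proof (rule DERIV_nonneg_mono_right[OF less_imp_le[OF r1]])
            show "continuous_on {0..r1} (\<lambda>r. M r - c * (a/2) powr p * (r ^ n / N))"
              using N by (intro continuous_intros contM) auto
            show "((\<lambda>r. M r - c * (a/2) powr p * (r ^ n / N)) has_real_derivative
               t ^ (n - 1) * (\<kappa> t * g t powr p) - c * (a/2) powr p * t ^ (n - 1)) (at t)" if "0 < t" for t
              by (intro DERIV_diff DERIV_cmult dpow Md that)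
            show "0 \<le> t ^ (n - 1) * (\<kappa> t * g t powr p) - c * (a/2) powr p * t ^ (n - 1)" if "0 < t" "t < r1" for t
            proof -
              have "(a/2) powr p \<le> g t powr p" using glow[of t] that a p1 by (intro powr_mono2) auto
              then have "c * (a/2) powr p \<le> \<kappa> t * g t powr p"
                using \<kappa>c[of t] that r1R R c \<kappa>(1)[of t] by (intro mult_mono) auto
              then have "t ^ (n - 1) * (c * (a/2) powr p) \<le> t ^ (n - 1) * (\<kappa> t * g t powr p)"
                using that by (intro mult_left_mono) auto
              then show ?thesis by (simp add: ac_simps)
            qed
          qed
          then have "c * (a/2) powr p * (r1 ^ n / N) \<le> M r1" using M0 n by (simp add: power_0_left)
          moreover have "(a/2) powr p = (1/2) powr p * a powr p" using a powr_mult[of "1/2" a p] by simp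
          moreover have "c * ((1/2) powr p * a powr p) * (r1 ^ n / N) = m0 * (a powr p * e ^ n)"
            by (simp add: m0_def r1_def power_mult_distrib)
          ultimately show ?thesis using en by simp
        qed
        \<comment> \<open>Mean value theorem between \<open>r\<close> and \<open>2 * r\<close>: the
          drop of \<open>g\<close> there is at most \<open>g r\<close>, and the flux at the
          intermediate point is at least \<open>M r\<close>.\<close>
        have gM: "g r \<ge> (1/2) ^ (n - 1) * (M r * (r / r ^ (n - 1)))" if r: "r > 0" for r
        proof -
          obtain z where z: "r < z" "z < 2 * r" "g (2 * r) - g r = (2 * r - r) * g' z"
            using MVT2[of r "2 * r" g g'] g r by auto
          have "M r / (2 * r) ^ (n - 1) \<le> M z / z ^ (n - 1)"
            using z r Mnn[of r] Mmono[of r z] by (intro frac_le power_mono) auto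
          then have "r * (M r / (2 * r) ^ (n - 1)) \<le> r * (M z / z ^ (n - 1))" using r by (intro mult_left_mono) auto
          also have "\<dots> = g r - g (2 * r)" using z g'_eq[of z] r by simp
          also have "\<dots> \<le> g r" using gnn[of "2 * r"] by simp
          finally show ?thesis by (simp add: power_mult_distrib power_one_over field_simps)
        qed
        have Mge: "M r \<ge> m0" if "r \<ge> r1" for r using Mmono[of r1 r] Mlow r1 that by simp
        have MM: "c1 * M r powr p / r \<le> r ^ (n - 1) * (\<kappa> r * g r powr p)" if r: "r1 \<le> r" "r \<le> R/2" for r
        proof -
          have rp: "r > 0" using r r1 by simp
          have Mp: "M r > 0" using Mge[OF r(1)] m0 by simp
          have "((1/2) ^ (n - 1) * (M r * (r / r ^ (n - 1)))) powr p \<le> g r powr p"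
            using gM[OF rp] Mp rp p1 by (intro powr_mono2) auto
          then have "c * ((1/2) ^ (n - 1) * (M r * (r / r ^ (n - 1)))) powr p \<le> \<kappa> r * g r powr p"
            using \<kappa>c[of r] r rp R c \<kappa>(1)[of r] by (intro mult_mono) auto
          then have le: "r ^ (n - 1) * (c * ((1/2) ^ (n - 1) * (M r * (r / r ^ (n - 1)))) powr p) \<le> r ^ (n - 1) * (\<kappa> r * g r powr p)"
            using rp by (intro mult_left_mono) auto
          \<comment> \<open>The powers of \<open>r\<close> combine to
            \<open>r ^ (n - 1) * r powr ((2 - N) * p)\<close>, which is exactly \<open>1 / r\<close>
            because \<open>(N - 2) * p = N\<close>.\<close>
          have "r / r ^ (n - 1) = r powr (2 - N)"
          proof -
            have "r ^ (n - 1) = r powr (N - 1)" using rp n by (simp add: N_def of_nat_diff flip: powr_realpow)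
            then have "r / r ^ (n - 1) = r powr 1 / r powr (N - 1)" using rp by simp
            also have "\<dots> = r powr (2 - N)" unfolding powr_diff[symmetric] by (simp add: algebra_simps)
            finally show ?thesis .
          qed
          then have "(r / r ^ (n - 1)) powr p = r powr ((2 - N) * p)" by (simp add: powr_powr)
          also have "(2 - N) * p = - N" using pN by (simp add: algebra_simps)
          also have "r powr (- N) = 1 / (r ^ (n - 1) * r)"
            unfolding n1[symmetric] using rp by (simp add: N_def powr_minus powr_realpow divide_inverse)
          finally have "(r / r ^ (n - 1)) powr p = 1 / (r ^ (n - 1) * r)" .
          moreover have "(x * (y * z)) powr p = x powr p * (y powr p * z powr p)"
            if "x > 0" "y > 0" "z > 0" for x y z :: real
            using that by (simp add: powr_mult)
          from this[of "(1/2) ^ (n - 1)" "M r" "r / r ^ (n - 1)"]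
          have "((1/2) ^ (n - 1) * (M r * (r / r ^ (n - 1)))) powr p
              = ((1/2) ^ (n - 1)) powr p * (M r powr p * (r / r ^ (n - 1)) powr p)"
            using Mp rp by (simp del: times_divide_eq_right)
          ultimately have "((1/2) ^ (n - 1) * (M r * (r / r ^ (n - 1)))) powr p
              = ((1/2) ^ (n - 1)) powr p * (M r powr p * (1 / (r ^ (n - 1) * r)))"
            by (simp only:)
          then have "r ^ (n - 1) * (c * ((1/2) ^ (n - 1) * (M r * (r / r ^ (n - 1)))) powr p) = c1 * M r powr p / r"
            using rp by (simp add: c1_def del: power_one_over)
          with le show ?thesis by simp
        qed
        have r1R': "r1 \<le> R/2" using r1R by simp
        \<comment> \<open>Divided by \<open>M r powr p\<close>, the flux inequality says that
          \<open>M r powr (1 - p) + (p - 1) * c1 * ln r\<close> does not increase.\<close>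
        have "- (M r1 powr (1 - p) + (p - 1) * c1 * ln r1) \<le> - (M (R/2) powr (1 - p) + (p - 1) * c1 * ln (R/2))"
        proof (rule DERIV_nonneg_mono_right[OF r1R'])
          have pos: "M r > 0" if "r \<in> {r1..R/2}" for r using Mge[of r] m0 that by simp
          show "continuous_on {r1..R/2} (\<lambda>r. - (M r powr (1 - p) + (p - 1) * c1 * ln r))"
            using r1 pos by (intro continuous_intros contM) (auto simp: less_imp_neq[symmetric])
          fix r assume r: "r1 < r" "r < R/2"
          have Mp: "M r > 0" using pos r by simp
          have "((\<lambda>r. M r powr (1 - p)) has_real_derivative (1 - p) * M r powr (1 - p - 1) * (r ^ (n - 1) * (\<kappa> r * g r powr p))) (at r)"
            using DERIV_chain2[OF has_real_derivative_powr[OF Mp, of "1 - p"] Md[of r]] r r1 by simp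
          then show "((\<lambda>r. - (M r powr (1 - p) + (p - 1) * c1 * ln r)) has_real_derivative
              - ((1 - p) * M r powr (1 - p - 1) * (r ^ (n - 1) * (\<kappa> r * g r powr p)) + (p - 1) * c1 * (1 / r))) (at r)"
            using r r1 by (intro DERIV_minus DERIV_add DERIV_cmult DERIV_ln_divide) auto
          have "M r powr (- p) * (c1 * M r powr p / r) \<le> M r powr (- p) * (r ^ (n - 1) * (\<kappa> r * g r powr p))"
            using MM[of r] r by (intro mult_left_mono) auto
          moreover have "M r powr (- p) * (c1 * M r powr p / r) = c1 / r"
            using Mp by (simp add: powr_minus)
          ultimately have "c1 / r \<le> M r powr (- p) * (r ^ (n - 1) * (\<kappa> r * g r powr p))"
            by (simp only:)
          then have *: "(p - 1) * (c1 / r) \<le> (p - 1) * (M r powr (- p) * (r ^ (n - 1) * (\<kappa> r * g r powr p)))"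
            by (rule mult_left_mono) (use p1 in simp)
          show "0 \<le> - ((1 - p) * M r powr (1 - p - 1) * (r ^ (n - 1) * (\<kappa> r * g r powr p)) + (p - 1) * c1 * (1 / r))"
          proof -
            have "- ((1 - p) * x * y + (p - 1) * c1 * (1 / r)) = (p - 1) * (x * y) - (p - 1) * (c1 / r)" for x y
              by (simp add: algebra_simps diff_divide_distrib)
            moreover have "1 - p - 1 = - p" by simp
            ultimately show ?thesis using * by (simp only: diff_ge_0_iff_ge)
          qed
        qed
        moreover have "M (R/2) powr (1 - p) \<ge> 0" by simp
        moreover have "M r1 powr (1 - p) \<le> m0 powr (1 - p)" using Mlow m0 p1 by (intro powr_mono2') auto
        ultimately have "(p - 1) * c1 * ln (R/2) - m0 powr (1 - p) \<le> (p - 1) * c1 * ln r1" by linarith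
        then have "((p - 1) * c1 * ln (R/2) - m0 powr (1 - p)) / ((p - 1) * c1) \<le> ln r1"
          using p1 c1 by (subst pos_divide_le_eq) (auto simp: mult.commute)
        then have "L \<le> ln r1" using p1 c1 by (simp add: L_def diff_divide_distrib)
        then have "exp L \<le> r1" using r1 by (simp add: ln_ge_iff)
        then have "e \<ge> exp L / r0" using r0 by (simp add: r1_def field_simps)
        then show ?thesis by (simp add: e0_def)
      qed
      then have "a \<le> e0 powr (- (N - 2))" unfolding ae using e0 N by (intro powr_mono2') auto
      then show ?thesis using gdec[of 0 s] s by (simp add: a_def)
    qed
  qed
  then show ?thesis by blast
qed

text \<open>Across the axis \<open>u\<close> depends on the displacement \<open>s\<close> through
  \<open>sqrt (r\<^sup>2 + s\<^sup>2)\<close>, so its derivative in \<open>s\<close> is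
  \<open>s\<close> times a continuous factor with value \<open>g' r / r\<close> at 0. Each
  transversal direction contributes this value.\<close>

lemma laplacian_radial:
  fixes u :: "'a::euclidean_space \<Rightarrow> real"
  assumes u: "C2_fun u" and rad: "\<And>x y. norm x = norm y \<Longrightarrow> u x = u y"
    and e: "e \<in> Basis" and r: "r > 0"
  shows "laplacian u (r *\<^sub>R e) = pd u [e, e] (r *\<^sub>R e) + (real DIM('a) - 1) * (pd u [e] (r *\<^sub>R e) / r)"
proof -
  define g where "g r = u (r *\<^sub>R e)" for r
  define g' where "g' r = pd u [e] (r *\<^sub>R e)" for r
  have g: "(g has_real_derivative g' t) (at t)" for t
    using C2_fun_line_derivative(1)[OF u e, of 0 t] by (simp add: g_def[abs_def] g'_def del: pd.simps)
  have g': "isCont g' t" for t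
    using DERIV_isCont[OF C2_fun_line_derivative(2)[OF u e, of 0 t]] by (simp add: g'_def[abs_def] del: pd.simps)
  have "pd u [i, i] (r *\<^sub>R e) = g' r / r" if i: "i \<in> Basis - {e}" for i
  proof -
    have ei: "e \<bullet> i = 0" "i \<bullet> i = 1" "e \<bullet> e = 1" using i e by (auto simp: inner_Basis)
    let ?\<rho> = "\<lambda>s. sqrt (r\<^sup>2 + s\<^sup>2)"
    have \<rho>: "?\<rho> s > 0" "r\<^sup>2 + s\<^sup>2 > 0" for s using r by (auto simp: add_pos_nonneg)
    have line: "u (r *\<^sub>R e + s *\<^sub>R i) = g (?\<rho> s)" for s
      unfolding g_def
    proof (rule rad)
      have "norm (r *\<^sub>R e + s *\<^sub>R i) = ?\<rho> s"
        using ei by (simp add: norm_eq_sqrt_inner inner_add_left inner_add_right inner_commute power2_eq_square)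
      also have "\<dots> = norm (?\<rho> s *\<^sub>R e)" using e \<rho>(1)[of s] by simp
      finally show "norm (r *\<^sub>R e + s *\<^sub>R i) = norm (?\<rho> s *\<^sub>R e)" .
    qed
    have pd_i: "pd u [i] (r *\<^sub>R e + s *\<^sub>R i) = g' (?\<rho> s) / ?\<rho> s * s" for s
    proof (rule DERIV_unique)
      show "((\<lambda>s. u (r *\<^sub>R e + s *\<^sub>R i)) has_real_derivative pd u [i] (r *\<^sub>R e + s *\<^sub>R i)) (at s)"
        by (rule C2_fun_line_derivative(1)[OF u]) (use i in auto)
      have "(?\<rho> has_real_derivative s / ?\<rho> s) (at s)"
        using \<rho>[of s] by (auto intro!: derivative_eq_intros simp: field_simps)
      from DERIV_chain2[OF g this]
      show "((\<lambda>s. u (r *\<^sub>R e + s *\<^sub>R i)) has_real_derivative g' (?\<rho> s) / ?\<rho> s * s) (at s)"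
        unfolding line by simp
    qed
    \<comment> \<open>Caratheodory's form of the derivative: with the factor \<open>s\<close> split
      off, continuity of \<open>g'\<close> is enough.\<close>
    have "((\<lambda>s. pd u [i] (r *\<^sub>R e + s *\<^sub>R i)) has_real_derivative g' r / r) (at 0)"
      unfolding CARAT_DERIV
    proof (intro exI conjI allI)
      show "pd u [i] (r *\<^sub>R e + z *\<^sub>R i) - pd u [i] (r *\<^sub>R e + 0 *\<^sub>R i) = g' (?\<rho> z) / ?\<rho> z * (z - 0)" for z
        using pd_i[of z] pd_i[of 0] by (simp del: pd.simps)
      show "isCont (\<lambda>s. g' (?\<rho> s) / ?\<rho> s) 0"
        by (intro continuous_intros isCont_o2[OF _ g']) (use r in auto)
      show "g' (?\<rho> 0) / ?\<rho> 0 = g' r / r" using r by simp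
    qed
    moreover have "((\<lambda>s. pd u [i] (r *\<^sub>R e + s *\<^sub>R i)) has_real_derivative pd u [i, i] (r *\<^sub>R e + 0 *\<^sub>R i)) (at 0)"
      by (rule C2_fun_line_derivative(2)[OF u]) (use i in auto)
    ultimately show ?thesis using DERIV_unique by (metis add.right_neutral scaleR_zero_left)
  qed
  then have "(\<Sum>i\<in>Basis - {e}. pd u [i, i] (r *\<^sub>R e)) = (\<Sum>i\<in>Basis - {e}. g' r / r)"
    by (intro sum.cong) auto
  also have "\<dots> = (real DIM('a) - 1) * (g' r / r)" using e by (simp add: card_Diff_singleton of_nat_diff)
  finally show ?thesis
    unfolding laplacian_def using e
    by (subst sum.remove[OF _ e]) (auto simp: g'_def simp del: pd.simps)
qed

text \<open>A symmetric involution is orthogonal, so it leaves the trace of the Hessian invariant;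
  reflections are of this kind.\<close>

lemma C2_fun_compose_involution:
  fixes u :: "'a::euclidean_space \<Rightarrow> real"
  assumes u: "C2_fun u" and T: "linear T" "\<And>x y. T x \<bullet> y = x \<bullet> T y" "\<And>x. T (T x) = x"
  shows "C2_fun (\<lambda>x. u (T x))" "laplacian (\<lambda>x. u (T x)) x = laplacian u (T x)"
proof -
  have Td: "(T has_derivative T) (at x)" for x
    using T(1) by (simp add: bounded_linear_imp_has_derivative linear_conv_bounded_linear)
  have Tc: "continuous_on UNIV T" using T(1) by (simp add: linear_continuous_on linear_conv_bounded_linear)
  have expand: "frechet_derivative f (at y) h = (\<Sum>j\<in>Basis. (h \<bullet> j) * frechet_derivative f (at y) j)"
    if "(f has_derivative frechet_derivative f (at y)) (at y)" for f :: "'a \<Rightarrow> real" and y h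
  proof -
    have lin: "linear (frechet_derivative f (at y))" using that by (rule has_derivative_linear)
    have "frechet_derivative f (at y) h = frechet_derivative f (at y) (\<Sum>j\<in>Basis. (h \<bullet> j) *\<^sub>R j)"
      by (simp add: euclidean_representation)
    then show ?thesis by (simp add: linear_sum[OF lin] linear_cmul[OF lin])
  qed
  have 1: "((\<lambda>x. u (T x)) has_derivative (\<lambda>h. \<Sum>j\<in>Basis. (T h \<bullet> j) * pd u [j] (T x))) (at x)" for x
    using has_derivative_compose[OF Td C2_fun_has_derivative(1)[OF u], of x]
    by (subst (asm) expand[OF C2_fun_has_derivative(1)[OF u]]) simp
  have 2: "((\<lambda>x. \<Sum>j\<in>Basis. (T i \<bullet> j) * pd u [j] (T x)) has_derivative
      (\<lambda>h. \<Sum>j\<in>Basis. (T i \<bullet> j) * (\<Sum>k\<in>Basis. (T h \<bullet> k) * pd u [k, j] (T x)))) (at x)" for i x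
  proof (intro has_derivative_sum has_derivative_mult_right)
    fix j :: 'a assume j: "j \<in> Basis"
    have "((\<lambda>x. pd u [j] (T x)) has_derivative (\<lambda>h. frechet_derivative (pd u [j]) (at (T x)) (T h))) (at x)"
      by (rule has_derivative_compose[OF Td C2_fun_has_derivative(2)[OF u j]])
    then show "((\<lambda>x. pd u [j] (T x)) has_derivative (\<lambda>h. \<Sum>k\<in>Basis. (T h \<bullet> k) * pd u [k, j] (T x))) (at x)"
      by (subst (asm) expand[OF C2_fun_has_derivative(2)[OF u j]]) simp
  qed
  have 3: "continuous_on UNIV (\<lambda>x. \<Sum>j\<in>Basis. (T i \<bullet> j) * (\<Sum>k\<in>Basis. (T h \<bullet> k) * pd u [k, j] (T x)))" for i h
  proof (intro continuous_intros)
    fix j k :: 'a assume jk: "j \<in> Basis" "k \<in> Basis"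
    have "continuous_on UNIV (pd u [k, j])" using u jk unfolding C2_fun_def by (simp del: pd.simps)
    then show "continuous_on UNIV (\<lambda>x. pd u [k, j] (T x))"
      by (rule continuous_on_compose2[OF _ Tc]) auto
  qed
  show "C2_fun (\<lambda>x. u (T x))" by (rule C2_funI(1)[OF 1 2 3])
  have "laplacian (\<lambda>x. u (T x)) x = (\<Sum>i\<in>Basis. \<Sum>j\<in>Basis. (T i \<bullet> j) * (\<Sum>k\<in>Basis. (T i \<bullet> k) * pd u [k, j] (T x)))"
    by (rule C2_funI(2)[OF 1 2 3])
  also have "\<dots> = (\<Sum>i\<in>Basis. \<Sum>j\<in>Basis. \<Sum>k\<in>Basis. ((T j \<bullet> i) * (T k \<bullet> i)) * pd u [k, j] (T x))"
  proof (intro sum.cong refl)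
    fix i j :: 'a
    have sw: "T i \<bullet> k = T k \<bullet> i" for k by (metis T(2) inner_commute)
    show "(T i \<bullet> j) * (\<Sum>k\<in>Basis. (T i \<bullet> k) * pd u [k, j] (T x))
        = (\<Sum>k\<in>Basis. ((T j \<bullet> i) * (T k \<bullet> i)) * pd u [k, j] (T x))"
      by (simp only: sum_distrib_left sw mult.assoc)
  qed
  also have "\<dots> = (\<Sum>j\<in>Basis. \<Sum>k\<in>Basis. \<Sum>i\<in>Basis. ((T j \<bullet> i) * (T k \<bullet> i)) * pd u [k, j] (T x))"
    by (subst sum.swap, rule sum.cong[OF refl], rule sum.swap)
  also have "\<dots> = (\<Sum>j\<in>Basis. \<Sum>k\<in>Basis. (j \<bullet> k) * pd u [k, j] (T x))"
  proof -
    \<comment> \<open>Orthogonality of \<open>T\<close>: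
      \<open>T j \<bullet> T k = j \<bullet> T (T k) = j \<bullet> k\<close>.\<close>
    have "(\<Sum>i\<in>Basis. (T j \<bullet> i) * (T k \<bullet> i)) = j \<bullet> k" for j k
      using euclidean_inner[of "T j" "T k"] T(2)[of j "T k"] T(3)[of k] by simp
    then show ?thesis by (simp only: sum_distrib_right[symmetric])
  qed
  also have "\<dots> = (\<Sum>j\<in>Basis. pd u [j, j] (T x))"
  proof (rule sum.cong[OF refl])
    fix j :: 'a assume j: "j \<in> Basis"
    have "(\<Sum>k\<in>Basis. (j \<bullet> k) * pd u [k, j] (T x)) = (\<Sum>k\<in>Basis. if k = j then pd u [j, j] (T x) else 0)"
      using j by (intro sum.cong) (auto simp: inner_Basis simp del: pd.simps)
    then show "(\<Sum>k\<in>Basis. (j \<bullet> k) * pd u [k, j] (T x)) = pd u [j, j] (T x)" using j by (simp del: pd.simps)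
  qed
  finally show "laplacian (\<lambda>x. u (T x)) x = laplacian u (T x)" by (simp add: laplacian_def del: pd.simps)
qed

context semilinear
begin

text \<open>The reflection that exchanges \<open>x\<close> and \<open>y\<close> maps solutions to
  solutions. Minimality then gives both \<open>u x \<le> u y\<close> and
  \<open>u y \<le> u x\<close>.\<close>

lemma minimal_solution_radial:
  assumes rad: "\<And>x y. norm x = norm y \<Longrightarrow> K x = K y"
    and u: "is_solution K \<beta> u" and min: "\<And>v x. is_solution K \<beta> v \<Longrightarrow> u x \<le> v x"
    and xy: "norm x = norm y"
  shows "u x = u y"
proof (cases "x = y")
  case False
  define e where "e = (1 / norm (x - y)) *\<^sub>R (x - y)"
  have e: "e \<bullet> e = 1" using False by (simp add: e_def dot_square_norm power2_eq_square)
  define T where "T z = z - (2 * (z \<bullet> e)) *\<^sub>R e" for z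
  have lin: "linear T" unfolding T_def
    by (intro linearI) (auto simp: inner_add_left algebra_simps)
  have adj: "T z \<bullet> w = z \<bullet> T w" for z w
    by (simp add: T_def inner_diff_left inner_diff_right inner_commute)
  have inv: "T (T z) = z" for z
    using e by (simp add: T_def inner_diff_left algebra_simps)
  have norm: "norm (T z) = norm z" for z
    using adj[of z "T z"] inv by (simp add: norm_eq_sqrt_inner)
  have Txy: "T x = y"
  proof -
    \<comment> \<open>Equal norms make the component of \<open>x\<close> along \<open>x - y\<close>
      exactly half of \<open>x - y\<close>, so the reflection sends \<open>x\<close> to
      \<open>y\<close>.\<close>
    have d: "(x - y) \<bullet> (x - y) = 2 * (x \<bullet> (x - y))"
      using xy by (simp add: inner_diff_left inner_diff_right inner_commute norm_eq)
    have "norm (x - y) * norm (x - y) = (x - y) \<bullet> (x - y)" by (simp add: dot_square_norm power2_eq_square)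
    then have nn: "2 * (x \<bullet> (x - y)) = norm (x - y) * norm (x - y)" using d by simp
    have xe: "x \<bullet> e = x \<bullet> (x - y) / norm (x - y)" unfolding e_def by (simp only: inner_scaleR_right) simp
    have "2 * (x \<bullet> e) * (1 / norm (x - y)) = 2 * (x \<bullet> (x - y)) / (norm (x - y) * norm (x - y))"
      unfolding xe by simp
    also have "\<dots> = 1" unfolding nn using False by simp
    finally have one: "2 * (x \<bullet> e) * (1 / norm (x - y)) = 1" .
    have "c *\<^sub>R e = (c * (1 / norm (x - y))) *\<^sub>R (x - y)" for c by (simp add: e_def)
    from this[of "2 * (x \<bullet> e)"] have "(2 * (x \<bullet> e)) *\<^sub>R e = x - y" unfolding one by simp
    then show ?thesis by (simp add: T_def)
  qed
  have "filterlim T at_infinity at_infinity"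
  proof (rule filterlim_norm_at_top_imp_at_infinity)
    show "filterlim (\<lambda>z. norm (T z)) at_top at_infinity"
      unfolding norm by (rule filterlim_at_infinity_imp_norm_at_top[OF filterlim_ident])
  qed
  then have "((\<lambda>z. u (T z)) \<longlongrightarrow> \<beta>) at_infinity"
    using u unfolding is_solution_def by (blast intro: filterlim_compose)
  moreover have "laplacian (\<lambda>z. u (T z)) z + K z * u (T z) powr (real DIM('a) / (real DIM('a) - 2)) = 0" for z
  proof -
    have "laplacian u (T z) + K (T z) * u (T z) powr (real DIM('a) / (real DIM('a) - 2)) = 0"
      using u unfolding is_solution_def by blast
    moreover have "laplacian (\<lambda>z. u (T z)) z = laplacian u (T z)"
      using u unfolding is_solution_def by (intro C2_fun_compose_involution(2) lin adj inv) auto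
    ultimately show ?thesis using rad[OF norm, of z] by (simp only:)
  qed
  ultimately have v: "is_solution K \<beta> (\<lambda>z. u (T z))"
    using u C2_fun_compose_involution(1)[OF _ lin adj inv, of u] unfolding is_solution_def by simp
  have "u x \<le> u y" using min[OF v, of x] Txy by simp
  moreover have "u y \<le> u x" using min[OF v, of y] Txy inv[of x] by simp
  ultimately show ?thesis by simp
qed simp

text \<open>\<open>A\<close> is chosen before \<open>\<beta>\<close>. The bound \<open>B\<close> may
  vary with \<open>\<beta>\<close>: it serves to produce the minimal solution, which is radial, so
  that \<open>radial_ode_bound\<close> applies to its profile.\<close>

lemma radial_iter_bound:
  assumes rad: "\<And>x y. norm x = norm y \<Longrightarrow> K x = K y" and K0: "K 0 > 0"
  shows "\<exists>A. \<forall>\<beta>>0. (\<exists>B. \<forall>k x. iter \<beta> k x \<le> B) \<longrightarrow> (\<forall>k x. iter \<beta> k x \<le> A)"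
proof -
  obtain e :: 'a where e: "e \<in> Basis" using nonempty_Basis by blast
  obtain C where C: "\<And>y. \<bar>K y\<bar> \<le> C" using K_bdd by (auto simp: bdd_integrable_def)
  have "C > 0" using C[of 0] K0 by linarith
  have "isCont K 0" using C1_fun_continuous[OF K_C1] by (simp add: continuous_on_eq_continuous_at)
  then obtain d where d: "d > 0" "\<And>y. dist y 0 < d \<Longrightarrow> dist (K y) (K 0) < K 0 / 2"
    using K0 by (metis half_gt_zero continuous_at_eps_delta)
  have Kc: "K 0 / 2 \<le> K (r *\<^sub>R e)" if "0 \<le> r" "r \<le> d/2" for r
  proof -
    have "dist (r *\<^sub>R e) 0 < d" using that e d by simp
    from d(2)[OF this] have "\<bar>K (r *\<^sub>R e) - K 0\<bar> < K 0 / 2" by (simp only: dist_real_def)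
    then show ?thesis by linarith
  qed
  have "d/2 > 0" "K 0 / 2 > 0" using d K0 by auto
  then obtain A where
    A: "\<And>g g' \<kappa> r. radial_profile DIM('a) p (d/2) (K 0 / 2) C g g' \<kappa> \<Longrightarrow> r \<ge> 0 \<Longrightarrow> g r \<le> A"
    using radial_ode_bound[OF dim _ _ \<open>C > 0\<close> meta_eq_to_obj_eq[OF p_def]] by metis
  have "iter \<beta> k x \<le> A" if \<beta>: "\<beta> > 0" and B: "\<And>k x. iter \<beta> k x \<le> B" for \<beta> B k x
  proof -
    obtain u where u: "is_solution K \<beta> u" "\<And>x. (\<lambda>k. iter \<beta> k x) \<longlonglongrightarrow> u x"
      using solution_of_bounded_iter[OF \<beta> B] by blast
    have min: "u x \<le> v x" if "is_solution K \<beta> v" for v x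
      by (rule LIMSEQ_le_const2[OF u(2)]) (use iter_le_solution[OF \<beta> order_refl that] in auto)
    have ur: "u x = u y" if "norm x = norm y" for x y
      using rad u(1) min that by (rule minimal_solution_radial)
    have C2: "C2_fun u" and unn: "\<And>x. u x \<ge> 0" and eq: "\<And>x. laplacian u x = - (K x * u x powr p)"
      using u(1) unfolding is_solution_def p_def by (auto simp: eq_neg_iff_add_eq_0)
    define g where "g r = u (r *\<^sub>R e)" for r
    define g' where "g' r = pd u [e] (r *\<^sub>R e)" for r
    have g: "(g has_real_derivative g' t) (at t)" for t
      using C2_fun_line_derivative(1)[OF C2 e, of 0 t] by (simp add: g_def[abs_def] g'_def del: pd.simps)
    have g': "(g' has_real_derivative pd u [e, e] (t *\<^sub>R e)) (at t)" for t
      using C2_fun_line_derivative(2)[OF C2 e, of 0 t] by (simp add: g'_def[abs_def] del: pd.simps)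
    have M': "((\<lambda>r. - (r ^ (DIM('a) - 1) * g' r)) has_real_derivative r ^ (DIM('a) - 1) * (K (r *\<^sub>R e) * g r powr p)) (at r)"
      if r: "r > 0" for r
    proof -
      have n: "DIM('a) - 1 = Suc (DIM('a) - 2)" using dim by simp
      have rn: "real (DIM('a) - 1) * r ^ (DIM('a) - 1 - 1) = (real DIM('a) - 1) * (r ^ (DIM('a) - 1) / r)"
        using r dim unfolding n by (simp add: of_nat_diff)
      have lap: "laplacian u (r *\<^sub>R e) = pd u [e, e] (r *\<^sub>R e) + (real DIM('a) - 1) * (pd u [e] (r *\<^sub>R e) / r)"
        by (rule laplacian_radial[OF C2 _ e r]) (rule ur)
      have "((\<lambda>r. - (r ^ (DIM('a) - 1) * g' r)) has_real_derivative
          - (real (DIM('a) - 1) * r ^ (DIM('a) - 1 - 1) * g' r + pd u [e, e] (r *\<^sub>R e) * r ^ (DIM('a) - 1))) (at r)"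
        by (intro DERIV_minus DERIV_mult g') (auto intro!: derivative_eq_intros)
      moreover have "- (real (DIM('a) - 1) * r ^ (DIM('a) - 1 - 1) * g' r + pd u [e, e] (r *\<^sub>R e) * r ^ (DIM('a) - 1))
          = - (r ^ (DIM('a) - 1) * laplacian u (r *\<^sub>R e))"
        unfolding lap rn by (simp add: g'_def algebra_simps del: pd.simps)
      ultimately show ?thesis unfolding eq by (simp add: g_def)
    qed
    have "iter \<beta> k x \<le> u x"
      by (rule incseq_le[OF incseq_SucI u(2)]) (rule iter_mono[OF \<beta>])
    also have "u x = g (norm x)" unfolding g_def by (rule ur) (use e in simp)
    also have "g (norm x) \<le> A"
    proof (rule A[of g g' "\<lambda>r. K (r *\<^sub>R e)" "norm x"])
      show "radial_profile DIM('a) p (d/2) (K 0 / 2) C g g' (\<lambda>r. K (r *\<^sub>R e))"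
        unfolding radial_profile_def
      proof (intro conjI)
        show "continuous_on UNIV g'"
          using g' by (intro continuous_at_imp_continuous_on ballI DERIV_isCont)
        show "\<forall>r. 0 \<le> K (r *\<^sub>R e) \<and> K (r *\<^sub>R e) \<le> C"
          using K_nonneg abs_le_D1[OF C] by blast
        show "\<forall>r. g r \<ge> 0" using unn by (simp add: g_def)
        show "\<forall>r. (g has_real_derivative g' r) (at r)" using g by blast
        show "\<forall>r>0. ((\<lambda>r. - (r ^ (DIM('a) - 1) * g' r)) has_real_derivative
            r ^ (DIM('a) - 1) * (K (r *\<^sub>R e) * g r powr p)) (at r)" using M' by blast
        show "\<forall>r. 0 \<le> r \<and> r \<le> d/2 \<longrightarrow> K 0 / 2 \<le> K (r *\<^sub>R e)" using Kc by blast
      qed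
    qed simp
    finally show ?thesis .
  qed
  then show ?thesis by blast
qed

end

section \<open>The critical value\<close>

text \<open>Turns a solution into a uniform bound for the iterates below it.\<close>

lemma bounded_above_of_limit_at_infinity:
  fixes v :: "'a::euclidean_space \<Rightarrow> real"
  assumes v: "continuous_on UNIV v" and lim: "(v \<longlongrightarrow> L) at_infinity"
  shows "\<exists>B. \<forall>x. v x \<le> B"
proof -
  have "\<forall>\<^sub>F x in at_infinity. v x < L + 1" by (rule order_tendstoD(2)[OF lim]) simp
  then obtain r where r: "\<And>x. norm x \<ge> r \<Longrightarrow> v x < L + 1" by (auto simp: eventually_at_infinity)
  have "compact (v ` cball 0 r)"
    by (intro compact_continuous_image continuous_on_subset[OF v]) auto
  then obtain C where C: "\<And>x. x \<in> cball 0 r \<Longrightarrow> \<bar>v x\<bar> \<le> C"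
    by (fastforce dest!: compact_imp_bounded simp: bounded_real)
  have "v x \<le> max (L + 1) C" for x
  proof (cases "norm x \<ge> r")
    case True
    with r[of x] show ?thesis by simp
  next
    case False
    with C[of x] show ?thesis by simp
  qed
  then show ?thesis by blast
qed

text \<open>Smoothness is given through iterated partial derivatives along \<open>Basis\<close>;
  linearity expresses the full derivative through the first ones.\<close>

lemma smooth_fun_C1:
  fixes K :: "'a::euclidean_space \<Rightarrow> real"
  assumes "smooth_fun K"
  shows "C1_fun K"
proof -
  have d: "pd K vs differentiable_on UNIV" if "set vs \<subseteq> Basis" for vs
    using assms that unfolding smooth_fun_def by blast
  have "pd K [] differentiable_on UNIV" by (rule d) simp
  then have D: "(K has_derivative frechet_derivative K (at x)) (at x)" for x
    by (simp add: differentiable_on_def frechet_derivative_works)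
  have eq: "frechet_derivative K (at x) h = (\<Sum>i\<in>Basis. (h \<bullet> i) * pd K [i] x)" for x h
  proof -
    have lin: "linear (frechet_derivative K (at x))" using D by (rule has_derivative_linear)
    have "frechet_derivative K (at x) h = frechet_derivative K (at x) (\<Sum>i\<in>Basis. (h \<bullet> i) *\<^sub>R i)"
      by (simp add: euclidean_representation)
    then show ?thesis by (simp add: linear_sum[OF lin] linear_cmul[OF lin])
  qed
  have "(K has_derivative (\<lambda>h. \<Sum>i\<in>Basis. (h \<bullet> i) * pd K [i] x)) (at x)" for x
    by (rule has_derivative_eq_rhs[OF D]) (rule ext, rule eq)
  moreover have "continuous_on UNIV (\<lambda>x. \<Sum>i\<in>Basis. (h \<bullet> i) * pd K [i] x)" for h
    by (intro continuous_intros differentiable_imp_continuous_on d) auto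
  ultimately show ?thesis unfolding C1_fun_def
    by (intro exI[of _ "\<lambda>x h. \<Sum>i\<in>Basis. (h \<bullet> i) * pd K [i] x"] conjI allI)
qed

text \<open>Beyond radius 1 the power \<open>norm x powr (- l)\<close> is at most 1, and a closed
  ball is compact.\<close>

lemma bounded_of_decay:
  fixes K :: "'a::euclidean_space \<Rightarrow> real"
  assumes K: "continuous_on UNIV K" and l: "l > 0" and O: "K \<in> O[at_infinity](\<lambda>x. norm x powr (- l))"
  shows "\<exists>C. \<forall>x. \<bar>K x\<bar> \<le> C"
proof -
  obtain c where c: "c > 0" "\<forall>\<^sub>F x in at_infinity. norm (K x) \<le> c * norm (norm x powr (- l))"
    using O by (auto elim: landau_o.bigE)
  then obtain r where r: "\<And>x. norm x \<ge> r \<Longrightarrow> \<bar>K x\<bar> \<le> c * norm x powr (- l)"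
    by (auto simp: eventually_at_infinity)
  define s where "s = max r 1"
  have "compact (K ` cball 0 s)"
    by (intro compact_continuous_image continuous_on_subset[OF K]) auto
  then obtain C where C: "\<And>x. x \<in> cball 0 s \<Longrightarrow> \<bar>K x\<bar> \<le> C"
    by (fastforce dest!: compact_imp_bounded simp: bounded_real)
  have "\<bar>K x\<bar> \<le> max c C" for x
  proof (cases "norm x \<ge> s")
    case True
    then have x: "norm x \<ge> r" "norm x \<ge> 1" by (auto simp: s_def)
    have "norm x powr (- l) \<le> norm x powr 0" using x l by (intro powr_mono) auto
    moreover have "x \<noteq> 0" using x by auto
    ultimately have "norm x powr (- l) \<le> 1" by simp
    then have "c * norm x powr (- l) \<le> c * 1" using c by (intro mult_left_mono) auto
    with r[OF x(1)] show ?thesis by simp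
  next
    case False
    with C[of x] show ?thesis by simp
  qed
  then show ?thesis by blast
qed

theorem theorem7p4:
  fixes K :: "'a::euclidean_space \<Rightarrow> real"
  assumes dim: "DIM('a) \<ge> 3"
    and smooth: "smooth_fun K"
    and nonneg: "\<forall>x. K x \<ge> 0"
    and nonzero: "\<exists>x. K x \<noteq> 0"
    and integrable: "integrable lborel K"
    and decay: "\<exists>l>2. K \<in> O[at_infinity](\<lambda>x. norm x powr (- l))"
  shows "\<exists>\<beta>0. 0 < \<beta>0 \<and>
           (\<forall>\<beta>. 0 < \<beta> \<and> \<beta> < \<beta>0 \<longrightarrow>
              (\<exists>u. is_solution K \<beta> u \<and> (\<forall>v. is_solution K \<beta> v \<longrightarrow> (\<forall>x. u x \<le> v x)))) \<and>
           (\<forall>\<beta>. \<beta> > \<beta>0 \<longrightarrow> \<not> (\<exists>u. is_solution K \<beta> u)) \<and>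
           (((\<forall>x y. norm x = norm y \<longrightarrow> K x = K y) \<and> K 0 > 0) \<longrightarrow>
              (\<exists>u. is_solution K \<beta>0 u))"
proof -
  have C1: "C1_fun K" by (rule smooth_fun_C1[OF smooth])
  obtain l where l: "l > 2" "K \<in> O[at_infinity](\<lambda>x. norm x powr (- l))" using decay by blast
  have "\<exists>C. \<forall>x. \<bar>K x\<bar> \<le> C"
    by (rule bounded_of_decay[OF C1_fun_continuous[OF C1] _ l(2)]) (use l(1) in simp)
  with integrable have bdd: "bdd_integrable K" by (simp add: bdd_integrable_def)
  interpret semilinear K "real DIM('a) / (real DIM('a) - 2)"
    by unfold_locales (use dim nonneg nonzero C1 bdd in auto)
  define S where "S = {\<beta>. \<beta> > 0 \<and> (\<exists>A. \<forall>k x. iter \<beta> k x \<le> A)}"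
  \<comment> \<open>With \<open>\<beta> = \<beta>'\<close> this says that solvability implies
    bounded iterates; with \<open>\<beta> < \<beta>'\<close> it makes \<open>S\<close> an
    interval.\<close>
  have S_of_solution: "\<beta> \<in> S" if \<beta>: "0 < \<beta>" "\<beta> \<le> \<beta>'" and v: "is_solution K \<beta>' v" for \<beta> \<beta>' v
  proof -
    obtain B where B: "\<And>x. v x \<le> B"
      using bounded_above_of_limit_at_infinity[of v \<beta>'] v C2_fun_continuous[of v]
      unfolding is_solution_def by blast
    have "iter \<beta> k x \<le> B" for k x
      using iter_le_solution[OF \<beta> v, of k x] B[of x] by linarith
    with \<beta> show ?thesis unfolding S_def by blast
  qed
  have solution_of_S: "\<exists>u. is_solution K \<beta> u \<and> (\<forall>v. is_solution K \<beta> v \<longrightarrow> (\<forall>x. u x \<le> v x))"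
    if \<beta>: "\<beta> \<in> S" for \<beta>
  proof -
    obtain A where A: "\<beta> > 0" "\<And>k x. iter \<beta> k x \<le> A" using \<beta> by (auto simp: S_def)
    obtain u where u: "is_solution K \<beta> u" "\<And>x. (\<lambda>k. iter \<beta> k x) \<longlonglongrightarrow> u x"
      using solution_of_bounded_iter[OF A] by blast
    have "u x \<le> v x" if "is_solution K \<beta> v" for v x
      by (rule LIMSEQ_le_const2[OF u(2)]) (use iter_le_solution[OF A(1) order_refl that] in auto)
    with u(1) show ?thesis by blast
  qed
  obtain \<beta>1 where \<beta>1: "\<beta>1 \<in> S" using iter_bounded_small unfolding S_def by blast
  have bdd_S: "bdd_above S"
  proof -
    obtain b where b: "\<And>\<beta> A. \<beta> \<ge> b \<Longrightarrow> \<exists>k x. iter \<beta> k x > A" using iter_unbounded_large by blast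
    have "\<beta> \<le> b" if \<beta>: "\<beta> \<in> S" for \<beta>
    proof (rule ccontr)
      assume "\<not> \<beta> \<le> b"
      then have "\<beta> \<ge> b" by simp
      obtain A where A: "\<And>k x. iter \<beta> k x \<le> A" using \<beta> unfolding S_def by blast
      obtain k x where "iter \<beta> k x > A" using b[OF \<open>\<beta> \<ge> b\<close>] by blast
      with A[of k x] show False by simp
    qed
    then show ?thesis by (auto simp: bdd_above_def)
  qed
  define \<beta>0 where "\<beta>0 = Sup S"
  have upper: "\<beta> \<le> \<beta>0" if "\<beta> \<in> S" for \<beta>
    unfolding \<beta>0_def by (rule cSup_upper[OF that bdd_S])
  have pos: "\<beta>0 > 0" using upper[OF \<beta>1] \<beta>1 by (auto simp: S_def)
  have below: "\<beta> \<in> S" if \<beta>: "0 < \<beta>" "\<beta> < \<beta>0" for \<beta>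
  proof -
    obtain \<beta>' where \<beta>': "\<beta>' \<in> S" "\<beta> < \<beta>'"
      using \<beta>(2) less_cSup_iff[of S \<beta>] \<beta>1 bdd_S by (auto simp: \<beta>0_def)
    obtain v where "is_solution K \<beta>' v" using solution_of_S[OF \<beta>'(1)] by blast
    then show ?thesis using S_of_solution \<beta>(1) \<beta>'(2) by (meson less_imp_le)
  qed
  have above: "\<not> (\<exists>u. is_solution K \<beta> u)" if "\<beta> > \<beta>0" for \<beta>
    using S_of_solution[of \<beta> \<beta>] upper[of \<beta>] that pos by auto
  have radial: "\<exists>u. is_solution K \<beta>0 u" if rad: "\<forall>x y. norm x = norm y \<longrightarrow> K x = K y" and K0: "K 0 > 0"
  proof -
    obtain A where A: "\<And>\<beta> k x. \<beta> \<in> S \<Longrightarrow> iter \<beta> k x \<le> A"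
      using radial_iter_bound rad K0 unfolding S_def by blast
    \<comment> \<open>For fixed \<open>k\<close> the exponent in \<open>iter_scale\<close> is fixed,
      so its factor tends to 1 along with \<open>t j\<close>, while
      \<open>t j * \<beta>0 < \<beta>0\<close> stays in the range where \<open>A\<close> is
      available.\<close>
    have "iter \<beta>0 k x \<le> A" for k x
    proof (rule LIMSEQ_le_const2)
      define t where "t j = 1 - 1 / (real j + 2)" for j :: nat
      have t: "0 < t j" "t j < 1" for j by (auto simp: t_def field_simps)
      have "(\<lambda>j. 1 / (real (Suc (Suc j)))) \<longlonglongrightarrow> 0"
        using LIMSEQ_Suc[OF LIMSEQ_inverse_real_of_nat] by (simp add: inverse_eq_divide)
      then have "(\<lambda>j. 1 - 1 / (real j + 2)) \<longlonglongrightarrow> 1 - 0"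
        by (intro tendsto_diff tendsto_const) (simp add: add.commute)
      then have "t \<longlonglongrightarrow> 1" by (simp add: t_def[abs_def])
      then have "(\<lambda>j. t j powr ((real DIM('a) / (real DIM('a) - 2)) ^ k) * iter \<beta>0 k x)
          \<longlonglongrightarrow> 1 powr ((real DIM('a) / (real DIM('a) - 2)) ^ k) * iter \<beta>0 k x"
        by (intro tendsto_intros) auto
      then show "(\<lambda>j. t j powr ((real DIM('a) / (real DIM('a) - 2)) ^ k) * iter \<beta>0 k x) \<longlonglongrightarrow> iter \<beta>0 k x"
        by simp
      show "\<exists>N. \<forall>j\<ge>N. t j powr ((real DIM('a) / (real DIM('a) - 2)) ^ k) * iter \<beta>0 k x \<le> A"
      proof (intro exI allI impI)
        fix j
        have "t j * \<beta>0 \<in> S" using t[of j] pos by (intro below) auto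
        then show "t j powr ((real DIM('a) / (real DIM('a) - 2)) ^ k) * iter \<beta>0 k x \<le> A"
          using iter_scale[OF pos t(1) less_imp_le[OF t(2)], of j k x] A[of "t j * \<beta>0" k x] by linarith
      qed
    qed
    from solution_of_bounded_iter[OF pos this] show ?thesis by blast
  qed
  show ?thesis
    by (intro exI[of _ \<beta>0] conjI allI impI pos)
       (use below solution_of_S above radial in blast)+
qed

end
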